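(* Let $m=(m_t)_{t\in[0,1]}$ be a standard Brownian meander on $[0,1]$ and let $B$ be a standard Brownian motion independent of $m$. For $c\ge 0$ define the continuous processes \[ u_t:=\begin{cases}\frac{1}{\sqrt2}\,m_{2t}, & t\in[0,1/2],\\[2pt] \frac1{\sqrt2}\,m_1+B_{t-\frac12}, & t\in[1/2,1],\end{cases} \qquad U^c_t:=\begin{cases}u_t, & t\in[0,1/2],\\[2pt] u_t+\bigl(12\,t(2-t)-9\bigr)\Bigl(c-\int_0^1u_r\,dr\Bigr), & t\in[1/2,1].\end{cases} \] Write $\langle m,1\rangle:=\int_0^1 m_r\,dr$. Then for all bounded Borel $\Phi:C([0,1])\to\mathbb R$ and bounded Borel $f:\mathbb R\to\mathbb R$, \[ \mathbb E\bigl[\Phi(m)\,f(\langle m,1\rangle)\bigr]=\int_0^\infty\sqrt{\tfrac{24}{\pi}}\;\mathbb E\Bigl[\Phi(U^c)\,e^{-12\left(\int_0^{1/2}(U^c_r+U^c_{1/2})\,dr-c\right)^2}\,1_{\{U^c_t\ge0,\ \forall t\in[0,1]\}}\Bigr]\,f(c)\,dc. \]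
   Context: The Brownian meander is a Brownian motion on $[0,1]$ conditioned to stay non-negative on $[0,1]$ (obtained as the weak limit as $\varepsilon\to0$ of $B$ conditioned on $\{B_t\ge-\varepsilon\ \forall t\in[0,1]\}$). Note $\int_0^1U^c_t\,dt=c$. *)

theory Defs
  imports "HOL-Probability.Probability"
begin

text \<open>Path space over [0,1]: paths are represented by their restriction to [0,1],
  with the product (cylinder) sigma-algebra; on continuous paths this is the Borel
  sigma-algebra of C([0,1]) with the sup norm.\<close>

abbreviation path01 :: "(real \<Rightarrow> real) measure" where
  "path01 \<equiv> PiM {0..1} (\<lambda>_. borel)"

abbreviation path_pos :: "(real \<Rightarrow> real) measure" where
  "path_pos \<equiv> PiM {0..} (\<lambda>_. borel)"

definition std_BM :: "'a measure \<Rightarrow> ('a \<Rightarrow> real \<Rightarrow> real) \<Rightarrow> bool" where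
  "std_BM M W \<longleftrightarrow> prob_space M
     \<and> (\<forall>t\<ge>0. (\<lambda>\<omega>. W \<omega> t) \<in> borel_measurable M)
     \<and> (\<forall>\<omega>\<in>space M. W \<omega> 0 = 0 \<and> continuous_on {0..} (W \<omega>))
     \<and> (\<forall>s t. 0 \<le> s \<and> s < t \<longrightarrow>
          distributed M lborel (\<lambda>\<omega>. W \<omega> t - W \<omega> s) (normal_density 0 (sqrt (t - s))))
     \<and> (\<forall>(n::nat) (\<tau>::nat \<Rightarrow> real). 0 \<le> \<tau> 0 \<and> strict_mono \<tau> \<longrightarrow>
          prob_space.indep_vars M (\<lambda>_. borel) (\<lambda>i \<omega>. W \<omega> (\<tau> (Suc i)) - W \<omega> (\<tau> i)) {..<n})"

definition sup_continuous01 :: "((real \<Rightarrow> real) \<Rightarrow> real) \<Rightarrow> bool" where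
  "sup_continuous01 \<Phi> \<longleftrightarrow>
     (\<forall>f g. continuous_on {0..1} f \<longrightarrow> (\<forall>n. continuous_on {0..1} (g n)) \<longrightarrow>
        uniform_limit {0..1} g f sequentially \<longrightarrow>
        (\<lambda>n. \<Phi> (restrict (g n) {0..1})) \<longlonglongrightarrow> \<Phi> (restrict f {0..1}))"

text \<open>Brownian meander on [0,1] under M: continuous paths, and its law is the weak limit
  (eps -> 0+) of the law of a standard Brownian motion conditioned on staying >= -eps
  on [0,1]; the reference Brownian motion W may live on any probability space N.\<close>
definition brownian_meander :: "'a measure \<Rightarrow> ('a \<Rightarrow> real \<Rightarrow> real) \<Rightarrow> bool" where
  "brownian_meander M m \<longleftrightarrow> prob_space M
     \<and> (\<lambda>\<omega>. restrict (m \<omega>) {0..1}) \<in> measurable M path01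
     \<and> (\<forall>\<omega>\<in>space M. continuous_on {0..1} (m \<omega>))
     \<and> (\<forall>(N::(real \<Rightarrow> real) measure) W \<Phi>. std_BM N W \<longrightarrow>
          \<Phi> \<in> borel_measurable path01 \<longrightarrow> bounded (range \<Phi>) \<longrightarrow> sup_continuous01 \<Phi> \<longrightarrow>
          ((\<lambda>\<epsilon>. (\<integral>\<omega>. \<Phi> (restrict (W \<omega>) {0..1})
                        * indicator {\<omega>\<in>space N. \<forall>t\<in>{0..1}. W \<omega> t \<ge> - \<epsilon>} \<omega> \<partial>N)
                   / measure N {\<omega>\<in>space N. \<forall>t\<in>{0..1}. W \<omega> t \<ge> - \<epsilon>})
            \<longlongrightarrow> (\<integral>\<omega>. \<Phi> (restrict (m \<omega>) {0..1}) \<partial>M)) (at_right 0))"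

definition u_proc :: "('a \<Rightarrow> real \<Rightarrow> real) \<Rightarrow> ('a \<Rightarrow> real \<Rightarrow> real) \<Rightarrow> 'a \<Rightarrow> real \<Rightarrow> real" where
  "u_proc m B \<omega> t = (if t \<le> 1/2 then m \<omega> (2 * t) / sqrt 2
                      else m \<omega> 1 / sqrt 2 + B \<omega> (t - 1/2))"

definition U_proc :: "('a \<Rightarrow> real \<Rightarrow> real) \<Rightarrow> ('a \<Rightarrow> real \<Rightarrow> real) \<Rightarrow> real \<Rightarrow> 'a \<Rightarrow> real \<Rightarrow> real" where
  "U_proc m B c \<omega> t = (if t \<le> 1/2 then u_proc m B \<omega> t
      else u_proc m B \<omega> t + (12 * t * (2 - t) - 9) * (c - integral {0..1} (u_proc m B \<omega>)))"

end

theory Submission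
  imports Defs
begin

text \<open>The Markov property at time \<open>1/2\<close>, combined with
  \<open>P(B \<ge> -\<epsilon> on [0,1]) = P(\<bar>B\<^sub>1\<bar> \<le> \<epsilon>)\<close> and Brownian scaling, turns the weak limit defining the
  meander into \<open>E[\<Psi>(m)] = \<surd>2 E[\<Psi>(u); u \<ge> 0]\<close>: the factor \<open>\<surd>2\<close> is the limiting ratio of the probabilities
  of staying above \<open>-\<epsilon>\<close> on \<open>[0,1/2]\<close> and on \<open>[0,1]\<close>.

  It remains to disintegrate along the area of \<open>u\<close>. Let \<open>I\<close> be the integral of \<open>B\<close> over \<open>[0,1/2]\<close> and
  \<open>g s = 12 s (1 - s)\<close>. Since the stochastic integral of \<open>g'\<close> is \<open>24 I\<close>, the Cameron--Martin formula
  multiplied by a Gaussian weight in \<open>I\<close> reads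
  \<open>E[F(B + a g) exp(-12 (I + a)\<^sup>2)] = E[F(B) exp(-12 (I - a)\<^sup>2)]\<close>.
  In this form every density is bounded, so it passes to the limit from time grids by bounded
  convergence. Adding \<open>a g\<close> to \<open>B\<close> adds \<open>a\<close> to the area of \<open>u\<close>; substituting \<open>c = area(u) + a\<close> and
  integrating out \<open>a\<close> gives the claim, without knowing the law of \<open>I\<close>.\<close>

section \<open>Paths and measures on path space\<close>

text \<open>The numbers 12 and 24 come from the Gaussian variable I. Its covariance with
  \<open>B s\<close> is s (1 - s) / 2 and its variance is 1/24, so g is covariance over variance: it
  has area 1 on [0,1/2], and B - I g is independent of I. Hence U^c is u with its area pinned to c,
  exp(-12 x^2) is up to a constant the density of I, and sqrt(24/pi) is the factor sqrt 2 divided by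
  the total mass sqrt(pi/12) of that weight.

  Two obstacles shape the proof. The meander is accessible only through functionals continuous in
  the sup norm, and the indicator of staying nonnegative is not one of them. So the second half of
  the path is integrated out first: the resulting function of the value at time 1/2 is continuous,
  and it changes by O(\<epsilon>) uniformly when the barrier moves from 0 to -\<epsilon>. Moreover,
  in an uncountable product sigma-algebra a condition at all times is not measurable, so barrier
  events and integrals are replaced by countable grid expressions that agree with them on continuous
  paths, and laws are compared through finite products of continuous functions of
  coordinates.\<close>

abbreviation borel_paths :: "'i set \<Rightarrow> ('i \<Rightarrow> real) measure" where
  "borel_paths I \<equiv> PiM I (\<lambda>_. borel)"

text \<open>Cylinders over closed sets form an intersection-stable generator, and the indicator of a
  closed set is a pointwise limit of continuous functions with values in [0,1]. Continuous tests are
  the right currency here: they survive the passage from time grids to all times, and they are all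
  that a weak limit offers.\<close>

lemma measure_eqI_PiM_continuous:
  fixes P Q :: "('i \<Rightarrow> real) measure"
  assumes P: "finite_measure P" "sets P = sets (borel_paths I)"
    and Q: "finite_measure Q" "sets Q = sets (borel_paths I)"
    and eq: "\<And>J (\<phi> :: 'i \<Rightarrow> real \<Rightarrow> real). finite J \<Longrightarrow> J \<subseteq> I \<Longrightarrow> (\<And>i. continuous_on UNIV (\<phi> i)) \<Longrightarrow>
        (\<And>i x. 0 \<le> \<phi> i x \<and> \<phi> i x \<le> 1) \<Longrightarrow>
        (\<integral>w. (\<Prod>i\<in>J. \<phi> i (w i)) \<partial>P) = (\<integral>w. (\<Prod>i\<in>J. \<phi> i (w i)) \<partial>Q)"
  shows "P = Q"
proof -
  interpret P: finite_measure P by fact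
  interpret Q: finite_measure Q by fact
  define \<Omega> :: "('i \<Rightarrow> real) set" where "\<Omega> = (\<Pi>\<^sub>E i\<in>I. UNIV)"
  define E where "E = {{f\<in>\<Omega>. \<forall>i\<in>j. f i \<in> A i} | A j.
     j \<in> {j. finite j \<and> j \<subseteq> I} \<and> A \<in> Pi j (\<lambda>_. Collect closed)}"
  have EP: "E \<subseteq> Pow \<Omega>" by (auto simp: E_def)
  have "sets (borel_paths I) = sets (PiM I (\<lambda>_. sigma UNIV (Collect closed)))"
    by (simp add: borel_eq_closed)
  also have "\<dots> = sets (sigma \<Omega> E)"
    unfolding E_def \<Omega>_def
    by (rule sets_PiM_sigma) (auto intro!: exI[of _ "{UNIV}"])
  finally have sets: "sets (borel_paths I) = sigma_sets \<Omega> E"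
    using EP by simp
  have "measure P X = measure Q X" if "X \<in> E" for X
  proof -
    from that obtain A j where X: "X = {f\<in>\<Omega>. \<forall>i\<in>j. f i \<in> A i}" and j: "finite j" "j \<subseteq> I"
      and A: "\<And>i. i \<in> j \<Longrightarrow> closed (A i)"
      by (auto simp: E_def)
    \<comment> \<open>Continuous tents that decrease to the indicator of \<open>A i\<close>. The
      empty set is treated apart because \<open>infdist x {}\<close> is 0, which would turn the tent
      into the constant 1.\<close>
    define \<psi> where "\<psi> n i x = (if i \<in> j \<and> A i \<noteq> {} then max 0 (1 - real n * infdist x (A i)) else 0)"
      for n i x
    have lim1: "(\<lambda>n. \<psi> n i x) \<longlonglongrightarrow> indicator (A i) x" if i: "i \<in> j" for i x
    proof (cases "x \<in> A i")
      case True
      then have "\<psi> n i x = 1" for n using i by (auto simp: \<psi>_def)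
      then show ?thesis using True by simp
    next
      case False
      have "eventually (\<lambda>n. \<psi> n i x = 0) sequentially"
      proof (cases "A i = {}")
        case True then show ?thesis by (simp add: \<psi>_def)
      next
        case ne: False
        then have pos: "infdist x (A i) > 0"
          using False A[OF i] by (simp add: infdist_pos_not_in_closed)
        have "eventually (\<lambda>n. real n > 1 / infdist x (A i)) sequentially"
          using filterlim_real_sequentially unfolding filterlim_at_top_dense by blast
        then show ?thesis
          by eventually_elim (use pos in \<open>auto simp: \<psi>_def field_simps\<close>)
      qed
      then have "(\<lambda>n. \<psi> n i x) \<longlonglongrightarrow> 0" by (rule tendsto_eventually)
      with False show ?thesis by simp
    qed
    have cont: "continuous_on UNIV (\<psi> n i)" for n i
      unfolding \<psi>_def by (cases "i \<in> j \<and> A i \<noteq> {}") (auto intro!: continuous_intros)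
    have bd: "0 \<le> \<psi> n i x \<and> \<psi> n i x \<le> 1" for n i x
      by (auto simp: \<psi>_def infdist_nonneg)
    have lim2: "(\<lambda>n. \<Prod>i\<in>j. \<psi> n i (w i)) \<longlonglongrightarrow> indicator X w" if "w \<in> \<Omega>" for w
    proof -
      have "(\<lambda>n. \<Prod>i\<in>j. \<psi> n i (w i)) \<longlonglongrightarrow> (\<Prod>i\<in>j. indicator (A i) (w i))"
        by (intro tendsto_prod lim1)
      also have "(\<Prod>i\<in>j. indicator (A i) (w i)) = (indicator X w :: real)"
        using that j by (auto simp: X indicator_def)
      finally show ?thesis .
    qed
    have lim3: "(\<lambda>n. \<integral>w. (\<Prod>i\<in>j. \<psi> n i (w i)) \<partial>R) \<longlonglongrightarrow> measure R X"
      if R: "finite_measure R" "sets R = sets (borel_paths I)" for R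
    proof -
      interpret R: finite_measure R by fact
      have sp: "space R = \<Omega>" using sets_eq_imp_space_eq[OF R(2)] by (simp add: \<Omega>_def space_PiM)
      have XR: "X \<in> sets R" using \<open>X \<in> E\<close> R(2) sets by auto
      have mR: "borel_measurable R = borel_measurable (borel_paths I)"
        by (rule measurable_cong_sets[OF R(2) refl])
      have mj: "(\<lambda>w. \<psi> n i (w i)) \<in> borel_measurable (borel_paths I)" if "i \<in> j" for n i
        using j that borel_measurable_continuous_onI[OF cont]
        by (intro measurable_compose[OF measurable_component_singleton[of i I]]) auto
      have "(\<lambda>n. \<integral>w. (\<Prod>i\<in>j. \<psi> n i (w i)) \<partial>R) \<longlonglongrightarrow> (\<integral>w. indicator X w \<partial>R)"
      proof (rule integral_dominated_convergence[where w="\<lambda>_. 1"])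
        show "AE w in R. (\<lambda>n. \<Prod>i\<in>j. \<psi> n i (w i)) \<longlonglongrightarrow> indicator X w"
          using lim2 sp by (intro AE_I2) auto
        show "AE w in R. norm (\<Prod>i\<in>j. \<psi> n i (w i)) \<le> 1" for n
          using bd by (auto intro!: AE_I2 prod_le_1 simp: abs_prod)
        show "(\<lambda>w. \<Prod>i\<in>j. \<psi> n i (w i)) \<in> borel_measurable R" for n
          unfolding mR by (intro borel_measurable_prod mj)
      qed (use XR in auto)
      then show ?thesis using XR by simp
    qed
    have "(\<integral>w. (\<Prod>i\<in>j. \<psi> n i (w i)) \<partial>P) = (\<integral>w. (\<Prod>i\<in>j. \<psi> n i (w i)) \<partial>Q)" for n
      using eq[of j "\<psi> n"] j cont bd by blast
    then show ?thesis using lim3[OF P] lim3[OF Q] LIMSEQ_unique by simp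
  qed
  then have em: "emeasure P X = emeasure Q X" if "X \<in> E" for X
    using that by (simp add: P.emeasure_eq_measure Q.emeasure_eq_measure)
  show ?thesis
  proof (rule measure_eqI_generator_eq[where \<Omega>=\<Omega> and E=E and A="\<lambda>_. \<Omega>"])
    show "Int_stable E"
    proof (rule Int_stableI)
      fix X Y assume "X \<in> E" "Y \<in> E"
      then obtain A j B k where X: "X = {f\<in>\<Omega>. \<forall>i\<in>j. f i \<in> A i}" "finite j" "j \<subseteq> I"
           "\<And>i. i \<in> j \<Longrightarrow> closed (A i)"
        and Y: "Y = {f\<in>\<Omega>. \<forall>i\<in>k. f i \<in> B i}" "finite k" "k \<subseteq> I"
           "\<And>i. i \<in> k \<Longrightarrow> closed (B i)"
        by (auto simp: E_def Pi_iff)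
      define C where "C i = (if i \<in> j then A i else UNIV) \<inter> (if i \<in> k then B i else UNIV)" for i
      have "closed (C i)" for i using X Y by (auto simp: C_def)
      moreover have "X \<inter> Y = {f\<in>\<Omega>. \<forall>i\<in>j \<union> k. f i \<in> C i}"
        by (auto simp: X Y C_def)
      ultimately show "X \<inter> Y \<in> E" unfolding E_def using X(2,3) Y(2,3)
        by (intro CollectI exI[of _ C] exI[of _ "j \<union> k"] conjI) auto
    qed
    have "\<Omega> = {f\<in>\<Omega>. \<forall>i\<in>{}. f i \<in> UNIV}" by simp
    then have "\<Omega> \<in> E" unfolding E_def by blast
    then show "range (\<lambda>_::nat. \<Omega>) \<subseteq> E" by auto
  qed (use EP em sets P Q in auto)
qed

section \<open>Rounding times down to a grid\<close>

definition rnd :: "real \<Rightarrow> real \<Rightarrow> real" where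
  "rnd h t = real (nat \<lfloor>t / h\<rfloor>) * h"

lemma rnd_bounds:
  assumes "h > 0" "t \<ge> 0"
  shows "0 \<le> rnd h t" "rnd h t \<le> t" "t - h < rnd h t"
proof -
  define k where "k = real (nat \<lfloor>t / h\<rfloor>)"
  have "0 \<le> \<lfloor>t / h\<rfloor>" using assms by simp
  then have "k = of_int \<lfloor>t / h\<rfloor>" unfolding k_def by (rule of_nat_nat)
  then have *: "k \<le> t / h" "t / h < k + 1" by linarith+
  moreover have "0 \<le> k" by (simp only: k_def of_nat_0_le_iff)
  ultimately show "0 \<le> rnd h t" "rnd h t \<le> t" "t - h < rnd h t"
    using assms unfolding rnd_def k_def[symmetric]
    by (auto simp: pos_le_divide_eq pos_divide_less_eq algebra_simps)
qed

lemma rnd_tendsto: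
  assumes "\<And>n. h n > 0" "h \<longlonglongrightarrow> 0" "t \<ge> 0"
  shows "(\<lambda>n. rnd (h n) t) \<longlonglongrightarrow> t"
proof (rule tendsto_sandwich)
  show "(\<lambda>n. t - h n) \<longlonglongrightarrow> t" using tendsto_diff[OF tendsto_const assms(2), of t] by simp
  show "(\<lambda>n. t) \<longlonglongrightarrow> t" by simp
qed (use rnd_bounds[OF assms(1,3)] in \<open>auto intro!: always_eventually less_imp_le\<close>)

lemma rnd_tendsto_continuous:
  fixes f :: "real \<Rightarrow> real"
  assumes h: "\<And>n. h n > 0" "h \<longlonglongrightarrow> 0" and t: "t \<in> S" and f: "continuous_on S f"
    and S: "{0..t} \<subseteq> S" "t \<ge> 0"
  shows "(\<lambda>n. f (rnd (h n) t)) \<longlonglongrightarrow> f t"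
  by (rule continuous_on_tendsto_compose[OF f rnd_tendsto[OF h] t])
     (use rnd_bounds h S in \<open>auto intro!: always_eventually\<close>)

lemma step_tendsto: "(\<lambda>n. s / real (Suc n)) \<longlonglongrightarrow> 0"
  using LIMSEQ_Suc[OF lim_const_over_n[of s]] by simp

text \<open>The value \<open>Suc n\<close> is attained at t = s: the endpoint is itself a grid
  point, so [0,s] carries \<open>Suc n\<close> increments but one more grid time.\<close>

lemma rnd_step_index:
  assumes "s > 0" "t \<in> {0..s}"
  shows "nat \<lfloor>t / (s / real (Suc n))\<rfloor> \<le> Suc n"
proof -
  have "t / (s / real (Suc n)) \<le> real (Suc n)"
    using assms mult_right_mono[of t s "real (Suc n)"] by (simp add: divide_le_eq mult.commute)
  then show ?thesis by linarith
qed

lemma grid_point: "k \<le> Suc n \<Longrightarrow> s > 0 \<Longrightarrow> real k * (s / real (Suc n)) \<in> {0..s}"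
proof -
  assume k: "k \<le> Suc n" "s > 0"
  have "real k * (s / real (Suc n)) = s * (real k / real (Suc n))" by simp
  also have "\<dots> \<le> s * 1" using k by (intro mult_left_mono) auto
  finally show ?thesis using k by simp
qed

text \<open>Every t is the limit of its own roundings on finer and finer grids, so a lower bound at
  the countably many grid times passes to t by continuity.\<close>

lemma continuous_ge_iff_grid:
  fixes f :: "real \<Rightarrow> real"
  assumes f: "continuous_on {0..s} f" and s: "s > 0"
  shows "(\<forall>t\<in>{0..s}. c \<le> f t) \<longleftrightarrow> (\<forall>n. \<forall>k\<le>Suc n. c \<le> f (real k * (s / real (Suc n))))"
proof
  assume *: "\<forall>t\<in>{0..s}. c \<le> f t"
  have "real k * (s / real (Suc n)) \<in> {0..s}" if "k \<le> Suc n" for k n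
    using s that mult_left_mono[of "real k" "real (Suc n)" s]
    by (simp add: divide_le_eq mult.commute del: of_nat_Suc)
  with * show "\<forall>n. \<forall>k\<le>Suc n. c \<le> f (real k * (s / real (Suc n)))"
    by blast
next
  assume *: "\<forall>n. \<forall>k\<le>Suc n. c \<le> f (real k * (s / real (Suc n)))"
  show "\<forall>t\<in>{0..s}. c \<le> f t"
  proof
    fix t assume t: "t \<in> {0..s}"
    have "(\<lambda>n. f (rnd (s / real (Suc n)) t)) \<longlonglongrightarrow> f t"
      by (rule rnd_tendsto_continuous[OF _ step_tendsto t f]) (use s t in auto)
    then show "c \<le> f t"
      by (rule LIMSEQ_le_const) (use * rnd_step_index[OF s t] in \<open>auto simp: rnd_def\<close>)
  qed
qed

text \<open>A measurable surrogate for the event that a continuous path stays above a level.\<close>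

definition grid_ge :: "real \<Rightarrow> real \<Rightarrow> (real \<Rightarrow> real) \<Rightarrow> bool" where
  "grid_ge s c w \<longleftrightarrow> (\<forall>n. \<forall>k\<in>{..Suc n}. c \<le> w (real k * (s / real (Suc n))))"

lemma grid_ge_iff:
  assumes "continuous_on {0..s} w" "s > 0"
  shows "grid_ge s c w \<longleftrightarrow> (\<forall>t\<in>{0..s}. c \<le> w t)"
  unfolding grid_ge_def continuous_ge_iff_grid[OF assms] by auto

lemma grid_ge_measurable:
  assumes s: "s > 0" and Z: "\<And>t. t \<in> {0..s} \<Longrightarrow> (\<lambda>x. Z x t) \<in> borel_measurable M"
  shows "Measurable.pred M (\<lambda>x. grid_ge s c (Z x))"
  unfolding grid_ge_def pred_def
  by (intro sets.sets_Collect_countable_All sets.sets_Collect_finite_All'[OF _ finite_atMost]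
        borel_measurable_le[OF borel_measurable_const Z] grid_point[OF _ s]) auto

lemma grid_ge_cong: "s > 0 \<Longrightarrow> (\<And>t. t \<in> {0..s} \<Longrightarrow> w t = v t) \<Longrightarrow> grid_ge s c w = grid_ge s c v"
  unfolding grid_ge_def using grid_point[of _ _ s] by simp

lemma sets_path_ge:
  fixes Z :: "'a \<Rightarrow> real \<Rightarrow> real"
  assumes s: "s > 0" and Z: "\<And>t. t \<in> {0..s} \<Longrightarrow> (\<lambda>\<omega>. Z \<omega> t) \<in> borel_measurable M"
    and c: "\<And>\<omega>. \<omega> \<in> space M \<Longrightarrow> continuous_on {0..s} (Z \<omega>)"
  shows "{\<omega>\<in>space M. \<forall>t\<in>{0..s}. c \<le> Z \<omega> t} \<in> sets M"
proof -
  have "{\<omega>\<in>space M. \<forall>t\<in>{0..s}. c \<le> Z \<omega> t} = {\<omega>\<in>space M. grid_ge s c (Z \<omega>)}"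
    using grid_ge_iff[OF c s] by auto
  then show ?thesis using grid_ge_measurable[of s Z M c] s Z unfolding pred_def by simp
qed

text \<open>Uniform continuity bounds the error on each cell by its length times a small number, and
  these errors add up to at most that number times s.\<close>

lemma riemann_sum_tendsto:
  fixes f :: "real \<Rightarrow> real"
  assumes f: "continuous_on {0..s} f" and s: "s > 0"
  shows "(\<lambda>n. s / real (Suc n) * (\<Sum>k<Suc n. f (real k * (s / real (Suc n))))) \<longlonglongrightarrow> integral {0..s} f"
proof (rule LIMSEQ_I)
  fix r :: real assume r: "r > 0"
  \<comment> \<open>Chosen so that the total error s * e is r / 2, strictly below r.\<close>
  define e where "e = r / (2 * s)"
  have e: "e > 0" using r s by (simp add: e_def)
  from compact_uniformly_continuous[OF f] obtain d where d: "d > 0"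
    and dd: "\<And>x y. x \<in> {0..s} \<Longrightarrow> y \<in> {0..s} \<Longrightarrow> dist y x < d \<Longrightarrow> dist (f y) (f x) < e"
    using e unfolding uniformly_continuous_on_def by (metis compact_Icc)
  from LIMSEQ_D[OF step_tendsto[of s] d] obtain N where "\<And>n. n \<ge> N \<Longrightarrow> norm (s / real (Suc n) - 0) < d"
    by blast
  then have N: "\<And>n. n \<ge> N \<Longrightarrow> s / real (Suc n) < d"
    using s by simp
  have "norm (s / real (Suc n) * (\<Sum>k<Suc n. f (real k * (s / real (Suc n)))) - integral {0..s} f) < r"
    if n: "n \<ge> N" for n
  proof -
    define h where "h = s / real (Suc n)"
    have h: "h > 0" "h < d" "real (Suc n) * h = s" using s N[OF n] by (auto simp: h_def)
    \<comment> \<open>Induction over the number of cells already covered; each further cell costs at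
      most h * e.\<close>
    have "\<bar>integral {0..real k * h} f - h * (\<Sum>j<k. f (real j * h))\<bar> \<le> real k * (h * e)"
      if "k \<le> Suc n" for k
      using that
    proof (induction k)
      case (Suc k)
      have ks: "real (Suc k) * h \<le> s"
        using Suc.prems h by (metis of_nat_le_iff mult_right_mono less_imp_le)
      have sub: "{0..real (Suc k) * h} \<subseteq> {0..s}" using ks by auto
      have int: "f integrable_on {0..real (Suc k) * h}"
        by (intro integrable_continuous_interval continuous_on_subset[OF f sub])
      have split: "integral {0..real (Suc k) * h} f
          = integral {0..real k * h} f + integral {real k * h..real (Suc k) * h} f"
        using h by (intro Henstock_Kurzweil_Integration.integral_combine[symmetric] int)
           (auto simp: mult_right_mono)
      have k0: "0 \<le> real k * h" using h by simp
      have sub2: "{real k * h..real (Suc k) * h} \<subseteq> {0..s}" using ks k0 by auto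
      have le: "real k * h \<le> real (Suc k) * h" using h by (simp add: algebra_simps)
      have "norm (integral {real k * h..real (Suc k) * h} (\<lambda>x. f x - f (real k * h)))
          \<le> e * (real (Suc k) * h - real k * h)"
      proof (rule integral_bound)
        show "continuous_on {real k * h..real (Suc k) * h} (\<lambda>x. f x - f (real k * h))"
          by (intro continuous_intros continuous_on_subset[OF f sub2])
        fix x assume x: "x \<in> {real k * h..real (Suc k) * h}"
        then have "dist x (real k * h) < d" using h by (auto simp: dist_real_def algebra_simps)
        moreover have "x \<in> {0..s}" "real k * h \<in> {0..s}" using x sub2 le by auto
        ultimately have "dist (f x) (f (real k * h)) < e" using dd by blast
        then show "norm (f x - f (real k * h)) \<le> e" by (simp add: dist_real_def)
      qed (use le in auto)
      moreover have "integral {real k * h..real (Suc k) * h} (\<lambda>x. f x - f (real k * h))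
          = integral {real k * h..real (Suc k) * h} f - h * f (real k * h)"
        using le h integrable_continuous_interval[OF continuous_on_subset[OF f sub2]]
        by (subst Henstock_Kurzweil_Integration.integral_diff) (auto simp: algebra_simps)
      ultimately have "\<bar>integral {real k * h..real (Suc k) * h} f - h * f (real k * h)\<bar> \<le> h * e"
        by (simp add: algebra_simps)
      with Suc.IH Suc.prems show ?case unfolding split
        by (simp add: algebra_simps)
    qed simp
    from this[of "Suc n"] have "\<bar>integral {0..s} f - h * (\<Sum>j<Suc n. f (real j * h))\<bar> \<le> s * e"
      using h by (simp add: mult.assoc[symmetric] del: of_nat_Suc sum.lessThan_Suc)
    also have "s * e < r" using s r by (simp add: e_def)
    finally show ?thesis unfolding h_def by (simp add: abs_minus_commute)
  qed
  then show "\<exists>no. \<forall>n\<ge>no. norm (s / real (Suc n) * (\<Sum>k<Suc n. f (real k * (s / real (Suc n)))) - integral {0..s} f) < r"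
    by blast
qed

text \<open>A measurable surrogate for the integral of a continuous path.\<close>

definition path_int :: "real \<Rightarrow> (real \<Rightarrow> real) \<Rightarrow> real" where
  "path_int s w = lim (\<lambda>n. s / real (Suc n) * (\<Sum>k<Suc n. w (real k * (s / real (Suc n)))))"

lemma path_int_eq:
  assumes "continuous_on {0..s} w" "s > 0"
  shows "path_int s w = integral {0..s} w"
  unfolding path_int_def by (rule limI[OF riemann_sum_tendsto[OF assms]])

lemma path_int_measurable:
  assumes s: "s > 0" and Z: "\<And>t. t \<in> {0..s} \<Longrightarrow> (\<lambda>x. Z x t) \<in> borel_measurable M"
  shows "(\<lambda>x. path_int s (Z x)) \<in> borel_measurable M"
  unfolding path_int_def
  by (intro borel_measurable_lim_metric borel_measurable_times borel_measurable_sum borel_measurable_const Z grid_point[OF _ s]) auto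

lemma path_int_cong: "s > 0 \<Longrightarrow> (\<And>t. t \<in> {0..s} \<Longrightarrow> w t = v t) \<Longrightarrow> path_int s w = path_int s v"
  unfolding path_int_def using grid_point[of _ _ s] by simp

lemma integral_process_measurable:
  fixes Z :: "'a \<Rightarrow> real \<Rightarrow> real"
  assumes s: "s > 0" and Z: "\<And>t. t \<in> {0..s} \<Longrightarrow> (\<lambda>\<omega>. Z \<omega> t) \<in> borel_measurable M"
    and c: "\<And>\<omega>. \<omega> \<in> space M \<Longrightarrow> continuous_on {0..s} (Z \<omega>)"
  shows "(\<lambda>\<omega>. integral {0..s} (Z \<omega>)) \<in> borel_measurable M"
proof -
  have "(\<lambda>\<omega>. path_int s (Z \<omega>)) \<in> borel_measurable M" by (rule path_int_measurable[OF s]) (rule Z)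
  then show ?thesis by (rule measurable_cong[THEN iffD1, rotated]) (simp add: path_int_eq c s)
qed

section \<open>Brownian motion\<close>

text \<open>The weights become densities, and the weighted measures are pushed forward to path
  space, where they coincide by the uniqueness criterion. Every later passage from finitely many
  coordinates to general functionals goes through this lemma; the weights carry indicators,
  Cameron-Martin exponentials or the other factor of an independence statement.\<close>

lemma integral_eq_of_test_functions:
  fixes M :: "'a measure" and N :: "'b measure" and X :: "'a \<Rightarrow> 'i \<Rightarrow> real" and Y :: "'b \<Rightarrow> 'i \<Rightarrow> real"
  assumes X: "X \<in> measurable M (borel_paths I)" and Y: "Y \<in> measurable N (borel_paths I)"
    and U: "integrable M U" "\<And>x. 0 \<le> U x" and V: "integrable N V" "\<And>x. 0 \<le> V x"
    and eq: "\<And>J (\<phi> :: 'i \<Rightarrow> real \<Rightarrow> real). finite J \<Longrightarrow> J \<subseteq> I \<Longrightarrow> (\<And>i. continuous_on UNIV (\<phi> i)) \<Longrightarrow>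
        (\<And>i x. 0 \<le> \<phi> i x \<and> \<phi> i x \<le> 1) \<Longrightarrow>
        (\<integral>x. U x * (\<Prod>i\<in>J. \<phi> i (X x i)) \<partial>M) = (\<integral>y. V y * (\<Prod>i\<in>J. \<phi> i (Y y i)) \<partial>N)"
    and \<Psi>: "\<Psi> \<in> borel_measurable (borel_paths I)"
  shows "(\<integral>x. U x * \<Psi> (X x) \<partial>M) = (\<integral>y. V y * (\<Psi> (Y y) :: real) \<partial>N)"
proof -
  have mU[measurable]: "U \<in> borel_measurable M" and mV[measurable]: "V \<in> borel_measurable N"
    using U V by auto
  note [measurable] = X Y
  define P where "P = distr (density M (\<lambda>x. ennreal (U x))) (borel_paths I) X"
  define Q where "Q = distr (density N (\<lambda>x. ennreal (V x))) (borel_paths I) Y"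
  have P: "(\<integral>w. f w \<partial>P) = (\<integral>x. U x * f (X x) \<partial>M)" if [measurable]: "f \<in> borel_measurable (borel_paths I)"
    for f :: "('i \<Rightarrow> real) \<Rightarrow> real"
    unfolding P_def using U by (subst integral_distr) (auto simp: integral_real_density)
  have Q: "(\<integral>w. f w \<partial>Q) = (\<integral>x. V x * f (Y x) \<partial>N)" if [measurable]: "f \<in> borel_measurable (borel_paths I)"
    for f :: "('i \<Rightarrow> real) \<Rightarrow> real"
    unfolding Q_def using V by (subst integral_distr) (auto simp: integral_real_density)
  have "P = Q"
  proof (rule measure_eqI_PiM_continuous)
    have fin: "finite_measure (density L (\<lambda>x. ennreal (g x)))"
      if "integrable L g" "\<And>x. 0 \<le> g x" for g and L :: "'z measure"
    proof (rule finite_measureI)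
      have [measurable]: "g \<in> borel_measurable L" using that by auto
      have "emeasure (density L (\<lambda>x. ennreal (g x))) (space L) = (\<integral>\<^sup>+x. ennreal (g x) \<partial>L)"
        by (subst emeasure_density) (auto intro!: nn_integral_cong)
      also have "\<dots> = ennreal (\<integral>x. g x \<partial>L)"
        using that by (intro nn_integral_eq_integral) auto
      finally show "emeasure (density L (\<lambda>x. ennreal (g x))) (space (density L (\<lambda>x. ennreal (g x)))) \<noteq> \<infinity>"
        by simp
    qed
    show "finite_measure P" unfolding P_def
      by (intro finite_measure.finite_measure_distr fin U) (use X in simp)
    show "finite_measure Q" unfolding Q_def
      by (intro finite_measure.finite_measure_distr fin V) (use Y in simp)
    fix J and \<phi> :: "'i \<Rightarrow> real \<Rightarrow> real" assume J: "finite J" "J \<subseteq> I" and c: "\<And>i. continuous_on UNIV (\<phi> i)"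
      and b: "\<And>i x. 0 \<le> \<phi> i x \<and> \<phi> i x \<le> 1"
    have [measurable]: "(\<lambda>w. \<Prod>i\<in>J. \<phi> i (w i)) \<in> borel_measurable (borel_paths I)"
      using J borel_measurable_continuous_onI[OF c]
      by (intro borel_measurable_prod measurable_compose[OF measurable_component_singleton]) auto
    show "(\<integral>w. (\<Prod>i\<in>J. \<phi> i (w i)) \<partial>P) = (\<integral>w. (\<Prod>i\<in>J. \<phi> i (w i)) \<partial>Q)"
      by (simp add: P Q eq[OF J c b])
  qed (auto simp: P_def Q_def)
  then show ?thesis using P[OF \<Psi>] Q[OF \<Psi>] by simp
qed

lemma
  assumes "std_BM M W"
  shows std_BM_prob_space: "prob_space M"
    and std_BM_measurable: "t \<ge> 0 \<Longrightarrow> (\<lambda>\<omega>. W \<omega> t) \<in> borel_measurable M"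
    and std_BM_zero: "\<omega> \<in> space M \<Longrightarrow> W \<omega> 0 = 0"
    and std_BM_continuous: "\<omega> \<in> space M \<Longrightarrow> continuous_on {0..} (W \<omega>)"
    and std_BM_increment: "0 \<le> s \<Longrightarrow> s < t \<Longrightarrow>
          distributed M lborel (\<lambda>\<omega>. W \<omega> t - W \<omega> s) (normal_density 0 (sqrt (t - s)))"
    and std_BM_indep: "0 \<le> \<tau> 0 \<Longrightarrow> strict_mono \<tau> \<Longrightarrow>
          prob_space.indep_vars M (\<lambda>_. borel) (\<lambda>i \<omega>. W \<omega> (\<tau> (Suc i)) - W \<omega> (\<tau> i)) {..<n::nat}"
  using assms unfolding std_BM_def by auto

lemma std_BM_path_measurable:
  assumes "std_BM M W" "I \<subseteq> {0..}"
  shows "(\<lambda>\<omega>. restrict (W \<omega>) I) \<in> measurable M (borel_paths I)"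
  using std_BM_measurable[OF assms(1)] assms(2) by (intro measurable_restrict) auto

section \<open>Shifting, scaling and the canonical version\<close>

lemma std_BM_shift:
  assumes W: "std_BM M W" and s: "s \<ge> 0"
  shows "std_BM M (\<lambda>\<omega> t. W \<omega> (s + t) - W \<omega> s)"
  unfolding std_BM_def
proof (intro conjI allI impI ballI)
  show "prob_space M" by (rule std_BM_prob_space[OF W])
  show "(\<lambda>\<omega>. W \<omega> (s + t) - W \<omega> s) \<in> borel_measurable M" if "0 \<le> t" for t
    using std_BM_measurable[OF W] that s by auto
  show "continuous_on {0..} (\<lambda>t. W \<omega> (s + t) - W \<omega> s)" if "\<omega> \<in> space M" for \<omega>
    using s by (intro continuous_intros continuous_on_compose2[OF std_BM_continuous[OF W that]]) auto
  show "distributed M lborel (\<lambda>\<omega>. W \<omega> (s + t) - W \<omega> s - (W \<omega> (s + r) - W \<omega> s))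
      (normal_density 0 (sqrt (t - r)))" if "0 \<le> r \<and> r < t" for r t
    using std_BM_increment[OF W, of "s + r" "s + t"] that s by simp
  show "prob_space.indep_vars M (\<lambda>_. borel)
      (\<lambda>i \<omega>. W \<omega> (s + \<tau> (Suc i)) - W \<omega> s - (W \<omega> (s + \<tau> i) - W \<omega> s)) {..<n}"
    if "0 \<le> \<tau> 0 \<and> strict_mono \<tau>" for n and \<tau> :: "nat \<Rightarrow> real"
    using std_BM_indep[OF W, of "\<lambda>i. s + \<tau> i" n] that s by (simp add: strict_mono_def)
qed simp

lemma std_BM_scale:
  assumes W: "std_BM M W" and a: "a > 0"
  shows "std_BM M (\<lambda>\<omega> t. sqrt a * W \<omega> (t / a))"
  unfolding std_BM_def
proof (intro conjI allI impI ballI)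
  interpret prob_space M by (rule std_BM_prob_space[OF W])
  show "prob_space M" by (rule std_BM_prob_space[OF W])
  show "(\<lambda>\<omega>. sqrt a * W \<omega> (t / a)) \<in> borel_measurable M" if "0 \<le> t" for t
    using std_BM_measurable[OF W] that a by auto
  show "continuous_on {0..} (\<lambda>t. sqrt a * W \<omega> (t / a))" if "\<omega> \<in> space M" for \<omega>
    using a by (intro continuous_intros continuous_on_compose2[OF std_BM_continuous[OF W that]]) auto
  show "sqrt a * W \<omega> (0 / a) = 0" if "\<omega> \<in> space M" for \<omega>
    using std_BM_zero[OF W that] by simp
  show "distributed M lborel (\<lambda>\<omega>. sqrt a * W \<omega> (t / a) - sqrt a * W \<omega> (s / a))
      (normal_density 0 (sqrt (t - s)))" if "0 \<le> s \<and> s < t" for s t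
  proof -
    have st: "s / a < t / a" "0 \<le> s / a" using that a by (auto simp: divide_strict_right_mono)
    have "distributed M lborel (\<lambda>\<omega>. 0 + sqrt a * (W \<omega> (t / a) - W \<omega> (s / a)))
       (normal_density (0 + sqrt a * 0) (\<bar>sqrt a\<bar> * sqrt (t / a - s / a)))"
      using st a by (intro normal_density_affine std_BM_increment[OF W]) auto
    moreover have "\<bar>sqrt a\<bar> * sqrt (t / a - s / a) = sqrt (t - s)"
      using a by (simp add: real_sqrt_mult[symmetric] algebra_simps)
    ultimately show ?thesis by (simp add: algebra_simps)
  qed
  show "indep_vars (\<lambda>_. borel)
      (\<lambda>i \<omega>. sqrt a * W \<omega> (\<tau> (Suc i) / a) - sqrt a * W \<omega> (\<tau> i / a)) {..<n}"
    if \<tau>: "0 \<le> \<tau> 0 \<and> strict_mono \<tau>" for n and \<tau> :: "nat \<Rightarrow> real"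
  proof -
    have "indep_vars (\<lambda>_. borel) (\<lambda>i \<omega>. W \<omega> (\<tau> (Suc i) / a) - W \<omega> (\<tau> i / a)) {..<n}"
      using std_BM_indep[OF W, of "\<lambda>i. \<tau> i / a" n] \<tau> a by (simp add: strict_mono_def divide_strict_right_mono)
    from indep_vars_compose2[OF this, of "\<lambda>_ x. sqrt a * x" "\<lambda>_. borel"]
    show ?thesis by (simp add: algebra_simps)
  qed
qed

text \<open>The definition of the meander quantifies only over Brownian motions whose sample points
  are functions, so a given W has to be moved to path space. Since \<open>std_BM\<close> asks for
  continuity at every sample point, the target is the trace on the set of continuous paths from 0;
  this set is not measurable in the product, but it contains every path of W.\<close>

lemma std_BM_canonical:
  assumes W: "std_BM M W"
  defines "C \<equiv> {w \<in> space path_pos. w 0 = 0 \<and> continuous_on {0..} w}"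
  defines "N \<equiv> distr M (restrict_space path_pos C) (\<lambda>\<omega>. restrict (W \<omega>) {0..})"
  shows "(\<lambda>\<omega>. restrict (W \<omega>) {0..}) \<in> measurable M (restrict_space path_pos C)"
    and "std_BM N (\<lambda>w. w)"
proof -
  interpret prob_space M by (rule std_BM_prob_space[OF W])
  let ?R = "\<lambda>\<omega>. restrict (W \<omega>) {0..}"
  have RC: "?R \<omega> \<in> C" if "\<omega> \<in> space M" for \<omega>
  proof -
    have "continuous_on {0..} (?R \<omega>) \<longleftrightarrow> continuous_on {0..} (W \<omega>)"
      by (rule continuous_on_cong) auto
    then show ?thesis
      using std_BM_zero[OF W that] std_BM_continuous[OF W that] by (simp add: C_def space_PiM)
  qed
  show mR: "?R \<in> measurable M (restrict_space path_pos C)"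
    using RC by (intro measurable_restrict_space2 std_BM_path_measurable[OF W]) auto
  have mc: "(\<lambda>w. w t) \<in> borel_measurable (restrict_space path_pos C)" if "t \<ge> 0" for t
    using that by (intro measurable_restrict_space1 measurable_component_singleton) auto
  interpret N: prob_space N unfolding N_def by (rule prob_space_distr[OF mR])
  have mcN: "(\<lambda>w. w t) \<in> borel_measurable N" if "t \<ge> 0" for t
    using mc[OF that] by (simp add: N_def)
  have sp: "space N \<subseteq> C" by (auto simp: N_def space_restrict_space)
  show "std_BM N (\<lambda>w. w)"
    unfolding std_BM_def
  proof (intro conjI allI impI ballI)
    show "prob_space N" by (rule N.prob_space_axioms)
    show "(\<lambda>\<omega>. \<omega> t) \<in> borel_measurable N" if "t \<ge> 0" for t by (rule mcN[OF that])
    show "\<omega> 0 = 0" "continuous_on {0..} \<omega>" if "\<omega> \<in> space N" for \<omega>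
      using that sp by (auto simp: C_def)
    show "distributed N lborel (\<lambda>\<omega>. \<omega> t - \<omega> s) (normal_density 0 (sqrt (t - s)))"
      if "0 \<le> s \<and> s < t" for s t
    proof -
      have "distr N lborel (\<lambda>\<omega>. \<omega> t - \<omega> s) = distr M lborel ((\<lambda>\<omega>. \<omega> t - \<omega> s) \<circ> ?R)"
        unfolding N_def using that mc by (intro distr_distr mR) auto
      also have "\<dots> = distr M lborel (\<lambda>\<omega>. W \<omega> t - W \<omega> s)"
        using that by (intro distr_cong) auto
      finally show ?thesis
        using std_BM_increment[OF W, of s t] that mcN by (auto simp: distributed_def)
    qed
    show "prob_space.indep_vars N (\<lambda>_. borel) (\<lambda>i \<omega>. \<omega> (\<tau> (Suc i)) - \<omega> (\<tau> i)) {..<n}"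
      if \<tau>: "0 \<le> \<tau> 0 \<and> strict_mono \<tau>" for n and \<tau> :: "nat \<Rightarrow> real"
    \<comment> \<open>The criterion that expresses independence by a product law requires a nonempty
      index set.\<close>
    proof (cases "n = 0")
      case True
      then show ?thesis by (simp add: N.indep_vars_def N.indep_sets_def)
    next
      case False
      have pos: "\<tau> i \<ge> 0" for i
        using \<tau> strict_mono_less_eq[of \<tau> 0 i] by auto
      have "distr N (borel_paths {..<n}) (\<lambda>\<omega>. \<lambda>i\<in>{..<n}. \<omega> (\<tau> (Suc i)) - \<omega> (\<tau> i))
        = distr M (borel_paths {..<n}) ((\<lambda>\<omega>. \<lambda>i\<in>{..<n}. \<omega> (\<tau> (Suc i)) - \<omega> (\<tau> i)) \<circ> ?R)"
        unfolding N_def using mc pos by (intro distr_distr mR measurable_restrict) auto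
      also have "\<dots> = distr M (borel_paths {..<n}) (\<lambda>\<omega>. \<lambda>i\<in>{..<n}. W \<omega> (\<tau> (Suc i)) - W \<omega> (\<tau> i))"
        using pos by (intro distr_cong) auto
      also have "\<dots> = PiM {..<n} (\<lambda>i. distr M borel (\<lambda>\<omega>. W \<omega> (\<tau> (Suc i)) - W \<omega> (\<tau> i)))"
        using False std_BM_measurable[OF W] pos std_BM_indep[OF W, of \<tau> n] \<tau>
        by (subst indep_vars_iff_distr_eq_PiM[symmetric]) auto
      also have "(\<lambda>i. distr M borel (\<lambda>\<omega>. W \<omega> (\<tau> (Suc i)) - W \<omega> (\<tau> i)))
          = (\<lambda>i. distr N borel (\<lambda>\<omega>. \<omega> (\<tau> (Suc i)) - \<omega> (\<tau> i)))"
      proof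
        fix i
        have "distr N borel (\<lambda>\<omega>. \<omega> (\<tau> (Suc i)) - \<omega> (\<tau> i)) = distr M borel ((\<lambda>\<omega>. \<omega> (\<tau> (Suc i)) - \<omega> (\<tau> i)) \<circ> ?R)"
          unfolding N_def using mc pos by (intro distr_distr mR) auto
        also have "\<dots> = distr M borel (\<lambda>\<omega>. W \<omega> (\<tau> (Suc i)) - W \<omega> (\<tau> i))"
          using pos by (intro distr_cong) auto
        finally show "distr M borel (\<lambda>\<omega>. W \<omega> (\<tau> (Suc i)) - W \<omega> (\<tau> i))
          = distr N borel (\<lambda>\<omega>. \<omega> (\<tau> (Suc i)) - \<omega> (\<tau> i))" by simp
      qed
      finally have *: "distr N (borel_paths {..<n}) (\<lambda>\<omega>. \<lambda>i\<in>{..<n}. \<omega> (\<tau> (Suc i)) - \<omega> (\<tau> i))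
        = PiM {..<n} (\<lambda>i. distr N borel (\<lambda>\<omega>. \<omega> (\<tau> (Suc i)) - \<omega> (\<tau> i)))" .
      show ?thesis
      proof (subst N.indep_vars_iff_distr_eq_PiM)
        show "{..<n} \<noteq> {}" using False by auto
        show "(\<lambda>\<omega>. \<omega> (\<tau> (Suc i)) - \<omega> (\<tau> i)) \<in> borel_measurable N" for i
          using mcN pos by auto
      qed (rule *)
    qed
  qed
qed

section \<open>Increments along a grid determine the law\<close>

lemma std_BM_grid_indep:
  assumes W: "std_BM M W" and h: "h > 0"
  shows "prob_space.indep_vars M (\<lambda>_. borel) (\<lambda>i \<omega>. W \<omega> (real (Suc i) * h) - W \<omega> (real i * h)) {..<n}"
  using std_BM_indep[OF W, of "\<lambda>i. real i * h" n] h by (simp add: strict_mono_def)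

text \<open>Independence and the Gaussian increments combine into one explicit product law, the same
  for every Brownian motion. Counting \<open>Suc n\<close> increments keeps the index set
  nonempty.\<close>

lemma std_BM_grid_law:
  assumes W: "std_BM M W" and h: "h > 0"
  shows "distr M (borel_paths {..<Suc n}) (\<lambda>\<omega>. \<lambda>i\<in>{..<Suc n}. W \<omega> (real (Suc i) * h) - W \<omega> (real i * h))
    = PiM {..<Suc n} (\<lambda>_. density lborel (\<lambda>x. ennreal (normal_density 0 (sqrt h) x)))"
proof -
  interpret prob_space M by (rule std_BM_prob_space[OF W])
  have "distr M borel (\<lambda>\<omega>. W \<omega> (real (Suc i) * h) - W \<omega> (real i * h))
     = density lborel (\<lambda>x. ennreal (normal_density 0 (sqrt h) x))" for i
    using distributed_distr_eq_density[OF std_BM_increment[OF W, of "real i * h" "real (Suc i) * h"]] h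
    by (simp add: algebra_simps cong: distr_cong)
  moreover have "random_variable borel (\<lambda>\<omega>. W \<omega> (real (Suc i) * h) - W \<omega> (real i * h))" for i
    using std_BM_measurable[OF W] h by auto
  ultimately show ?thesis
    using std_BM_grid_indep[OF W h, of "Suc n"]
    by (subst (asm) indep_vars_iff_distr_eq_PiM) auto
qed

lemma std_BM_grid_sum:
  assumes W: "std_BM M W" and "\<omega> \<in> space M"
  shows "W \<omega> (real k * h) = (\<Sum>i<k. W \<omega> (real (Suc i) * h) - W \<omega> (real i * h))"
  using std_BM_zero[OF assms] by (subst sum_lessThan_telescope) simp

lemma std_BM_test_tendsto:
  fixes \<phi> :: "real \<Rightarrow> real \<Rightarrow> real"
  assumes W: "std_BM M W" and h: "\<And>n. h n > 0" "h \<longlonglongrightarrow> 0"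
    and J: "finite J" "J \<subseteq> {0..}" and c: "\<And>t. continuous_on UNIV (\<phi> t)" and \<omega>: "\<omega> \<in> space M"
  shows "(\<lambda>n. \<Prod>t\<in>J. \<phi> t (W \<omega> (rnd (h n) t))) \<longlonglongrightarrow> (\<Prod>t\<in>J. \<phi> t (W \<omega> t))"
proof (rule tendsto_prod)
  fix t assume "t \<in> J"
  then have "(\<lambda>n. W \<omega> (rnd (h n) t)) \<longlonglongrightarrow> W \<omega> t"
    using J by (intro rnd_tendsto_continuous[OF h _ std_BM_continuous[OF W \<omega>]]) auto
  then show "(\<lambda>n. \<phi> t (W \<omega> (rnd (h n) t))) \<longlonglongrightarrow> \<phi> t (W \<omega> t)"
    by (rule continuous_on_tendsto_compose[OF c]) auto
qed

text \<open>At times rounded to a grid the motion is a vector of partial sums of independent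
  Gaussians whose law involves only the mesh. Letting the mesh tend to 0, path continuity and
  bounded convergence give equal integrals of all test products. Rounding to a common grid avoids
  having to sort the times in J.\<close>

lemma std_BM_law_unique:
  assumes W: "std_BM M W" and V: "std_BM N V" and I: "I \<subseteq> {0..}"
    and \<Psi>: "\<Psi> \<in> borel_measurable (borel_paths I)"
  shows "(\<integral>\<omega>. \<Psi> (restrict (W \<omega>) I) \<partial>M) = (\<integral>\<omega>. (\<Psi> (restrict (V \<omega>) I) :: real) \<partial>N)"
proof -
  interpret M: prob_space M by (rule std_BM_prob_space[OF W])
  interpret N: prob_space N by (rule std_BM_prob_space[OF V])
  have "(\<integral>\<omega>. 1 * \<Psi> (restrict (W \<omega>) I) \<partial>M) = (\<integral>\<omega>. 1 * \<Psi> (restrict (V \<omega>) I) \<partial>N)"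
  proof (rule integral_eq_of_test_functions[OF std_BM_path_measurable[OF W I] std_BM_path_measurable[OF V I] _ _ _ _ _ \<Psi>])
    fix J and \<phi> :: "real \<Rightarrow> real \<Rightarrow> real"
    assume J: "finite J" "J \<subseteq> I" and c: "\<And>i. continuous_on UNIV (\<phi> i)"
      and b: "\<And>i x. 0 \<le> \<phi> i x \<and> \<phi> i x \<le> 1"
    define h where "h n = 1 / real (Suc n)" for n
    have h: "\<And>n. h n > 0" "h \<longlonglongrightarrow> 0" using step_tendsto[of 1] by (auto simp: h_def[abs_def])
    have J0: "J \<subseteq> {0..}" using J I by auto
    have [measurable]: "\<phi> i \<in> borel_measurable borel" for i
      by (rule borel_measurable_continuous_onI[OF c])
    have grid: "(\<integral>\<omega>. (\<Prod>t\<in>J. \<phi> t (W \<omega> (rnd (h n) t))) \<partial>M) =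
      (\<integral>x. (\<Prod>t\<in>J. \<phi> t (\<Sum>i<nat \<lfloor>t / h n\<rfloor>. x i))
         \<partial>PiM {..<Suc (\<Sum>t\<in>J. nat \<lfloor>t / h n\<rfloor>)} (\<lambda>_. density lborel (\<lambda>x. ennreal (normal_density 0 (sqrt (h n)) x))))"
      if W: "std_BM M W" for M :: "'z measure" and W n
    proof -
      \<comment> \<open>The sum of all indices is a crude bound for each of them, so a single block
        of increments serves every t in J; the successor covers an empty J.\<close>
      let ?m = "Suc (\<Sum>t\<in>J. nat \<lfloor>t / h n\<rfloor>)"
      have le: "nat \<lfloor>t / h n\<rfloor> < ?m" if "t \<in> J" for t
        using member_le_sum[OF that, of "\<lambda>t. nat \<lfloor>t / h n\<rfloor>"] J by simp
      have "(\<integral>\<omega>. (\<Prod>t\<in>J. \<phi> t (W \<omega> (rnd (h n) t))) \<partial>M) = (\<integral>\<omega>. (\<Prod>t\<in>J. \<phi> t (\<Sum>i<nat \<lfloor>t / h n\<rfloor>.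
         (\<lambda>i\<in>{..<?m}. W \<omega> (real (Suc i) * h n) - W \<omega> (real i * h n)) i)) \<partial>M)"
      proof (intro Bochner_Integration.integral_cong refl prod.cong arg_cong[where f="\<phi> _"])
        fix \<omega> t assume \<omega>: "\<omega> \<in> space M" and t: "t \<in> J"
        show "W \<omega> (rnd (h n) t) = (\<Sum>i<nat \<lfloor>t / h n\<rfloor>.
         (\<lambda>i\<in>{..<?m}. W \<omega> (real (Suc i) * h n) - W \<omega> (real i * h n)) i)"
          unfolding rnd_def
        proof (rule trans[OF std_BM_grid_sum[OF W \<omega>]], rule sum.cong)
          fix i assume "i \<in> {..<nat \<lfloor>t / h n\<rfloor>}"
          then have "i \<in> {..<?m}" using le[OF t] by auto
          then show "W \<omega> (real (Suc i) * h n) - W \<omega> (real i * h n)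
             = (\<lambda>i\<in>{..<?m}. W \<omega> (real (Suc i) * h n) - W \<omega> (real i * h n)) i"
            by simp
        qed simp
      qed
      also have "\<dots> = (\<integral>x. (\<Prod>t\<in>J. \<phi> t (\<Sum>i<nat \<lfloor>t / h n\<rfloor>. x i))
         \<partial>distr M (borel_paths {..<?m}) (\<lambda>\<omega>. \<lambda>i\<in>{..<?m}. W \<omega> (real (Suc i) * h n) - W \<omega> (real i * h n)))"
      proof (rule integral_distr[symmetric])
        show "(\<lambda>\<omega>. \<lambda>i\<in>{..<?m}. W \<omega> (real (Suc i) * h n) - W \<omega> (real i * h n)) \<in> measurable M (borel_paths {..<?m})"
          using std_BM_measurable[OF W] h(1)[of n] by (intro measurable_restrict) auto
        show "(\<lambda>x. \<Prod>t\<in>J. \<phi> t (\<Sum>i<nat \<lfloor>t / h n\<rfloor>. x i)) \<in> borel_measurable (borel_paths {..<?m})"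
          using le by (intro borel_measurable_prod measurable_compose[OF borel_measurable_sum, of _ _ _ "\<phi> _"]
            measurable_component_singleton) (auto intro: less_trans)
      qed
      finally show ?thesis unfolding std_BM_grid_law[OF W h(1)] .
    qed
    have lim: "(\<lambda>n. \<integral>\<omega>. (\<Prod>t\<in>J. \<phi> t (W \<omega> (rnd (h n) t))) \<partial>M) \<longlonglongrightarrow> (\<integral>\<omega>. (\<Prod>t\<in>J. \<phi> t (W \<omega> t)) \<partial>M)"
      if W: "std_BM M W" for M :: "'z measure" and W
    proof (rule integral_dominated_convergence[where w="\<lambda>_. 1"])
      show "integrable M (\<lambda>_. 1::real)"
        by (rule finite_measure.integrable_const[OF prob_space.finite_measure[OF std_BM_prob_space[OF W]]])
      show "AE \<omega> in M. (\<lambda>n. \<Prod>t\<in>J. \<phi> t (W \<omega> (rnd (h n) t))) \<longlonglongrightarrow> (\<Prod>t\<in>J. \<phi> t (W \<omega> t))"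
        using std_BM_test_tendsto[OF W h J(1) J0 c] by (intro AE_I2) auto
      show "AE \<omega> in M. norm (\<Prod>t\<in>J. \<phi> t (W \<omega> (rnd (h n) t))) \<le> 1" for n
        using b by (auto intro!: AE_I2 prod_le_1 simp: abs_prod)
      show "(\<lambda>\<omega>. \<Prod>t\<in>J. \<phi> t (W \<omega> (rnd (h n) t))) \<in> borel_measurable M" for n
        using J0 rnd_bounds(1)[OF h(1)[of n]]
        by (intro borel_measurable_prod measurable_compose[OF std_BM_measurable[OF W]]) auto
      show "(\<lambda>\<omega>. \<Prod>t\<in>J. \<phi> t (W \<omega> t)) \<in> borel_measurable M"
        using J0 by (intro borel_measurable_prod measurable_compose[OF std_BM_measurable[OF W]]) auto
    qed
    have "(\<integral>\<omega>. (\<Prod>t\<in>J. \<phi> t (W \<omega> t)) \<partial>M) = (\<integral>\<omega>. (\<Prod>t\<in>J. \<phi> t (V \<omega> t)) \<partial>N)"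
      using lim[OF W] lim[OF V] unfolding grid[OF W] grid[OF V] by (rule LIMSEQ_unique)
    then show "(\<integral>\<omega>. 1 * (\<Prod>t\<in>J. \<phi> t (restrict (W \<omega>) I t)) \<partial>M) = (\<integral>\<omega>. 1 * (\<Prod>t\<in>J. \<phi> t (restrict (V \<omega>) I t)) \<partial>N)"
      using J by (simp add: subset_eq cong: prod.cong)
  qed auto
  then show ?thesis by simp
qed

section \<open>The Markov property at a fixed time\<close>

lemma bounded_convergence:
  assumes M: "finite_measure M"
    and lim: "\<And>\<omega>. \<omega> \<in> space M \<Longrightarrow> (\<lambda>n. F n \<omega>) \<longlonglongrightarrow> F' \<omega>"
    and b: "\<And>n \<omega>. \<omega> \<in> space M \<Longrightarrow> \<bar>F n \<omega>\<bar> \<le> (B::real)"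
    and m: "\<And>n. F n \<in> borel_measurable M"
  shows "(\<lambda>n. \<integral>\<omega>. F n \<omega> \<partial>M) \<longlonglongrightarrow> (\<integral>\<omega>. F' \<omega> \<partial>M)"
proof (rule integral_dominated_convergence[where w="\<lambda>_. B"])
  interpret finite_measure M by fact
  show "F' \<in> borel_measurable M" by (rule borel_measurable_LIMSEQ_real[OF lim m])
  show "AE x in M. norm (F n x) \<le> B" for n using b by (intro AE_I2) simp
qed (use lim m in \<open>auto intro: finite_measure.integrable_const[OF M]\<close>)

text \<open>The meshes s / \<open>Suc n\<close> make s a grid point, so rounded times before s use
  only the first \<open>Suc n\<close> increments and rounded times after s only later ones. Disjoint
  blocks of increments are independent, and refining the grid gives the product formula for
  continuous tests. Past and future events then replace the tests one after the other.\<close>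

lemma std_BM_markov:
  assumes W: "std_BM M W" and s: "s > 0"
  shows "prob_space.indep_var M (borel_paths {0..s}) (\<lambda>\<omega>. restrict (W \<omega>) {0..s})
       path_pos (\<lambda>\<omega>. restrict (\<lambda>t. W \<omega> (s + t) - W \<omega> s) {0..})"
proof -
  interpret prob_space M by (rule std_BM_prob_space[OF W])
  define V where "V \<omega> t = W \<omega> (s + t) - W \<omega> s" for \<omega> t
  have V: "std_BM M V" unfolding V_def[abs_def] using s by (intro std_BM_shift[OF W]) auto
  have mW: "(\<lambda>\<omega>. restrict (W \<omega>) {0..s}) \<in> measurable M (borel_paths {0..s})"
    by (intro std_BM_path_measurable[OF W]) auto
  have mV: "(\<lambda>\<omega>. restrict (V \<omega>) {0..}) \<in> measurable M path_pos"
    by (intro std_BM_path_measurable[OF V]) auto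
  note [measurable] = mW mV
  define h where "h n = s / real (Suc n)" for n
  have h: "\<And>n. h n > 0" "h \<longlonglongrightarrow> 0" using step_tendsto[of s] s by (auto simp: h_def[abs_def])
  have hs: "real (Suc n) * h n = s" for n using s by (simp add: h_def)
  have test: "(\<integral>\<omega>. (\<Prod>t\<in>K. \<psi> t (V \<omega> t)) * (\<Prod>t\<in>J. \<phi> t (W \<omega> t)) \<partial>M)
      = (\<integral>\<omega>. (\<Prod>t\<in>K. \<psi> t (V \<omega> t)) \<partial>M) * (\<integral>\<omega>. (\<Prod>t\<in>J. \<phi> t (W \<omega> t)) \<partial>M)"
    if J: "finite J" "J \<subseteq> {0..s}" and K: "finite K" "K \<subseteq> {0..}"
      and c: "\<And>t. continuous_on UNIV (\<phi> t)" "\<And>t. continuous_on UNIV (\<psi> t)"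
      and b: "\<And>i x. 0 \<le> \<phi> i x \<and> \<phi> i x \<le> 1" "\<And>i x. 0 \<le> \<psi> i x \<and> \<psi> i x \<le> 1"
    for J K and \<phi> \<psi> :: "real \<Rightarrow> real \<Rightarrow> real"
  proof -
    have J0: "J \<subseteq> {0..}" using J by auto
    have m\<phi>: "\<phi> i \<in> borel_measurable borel" and m\<psi>: "\<psi> i \<in> borel_measurable borel" for i
      using c by (auto intro: borel_measurable_continuous_onI)
    define F where "F n \<omega> = (\<Prod>t\<in>J. \<phi> t (W \<omega> (rnd (h n) t)))" for n \<omega>
    define G where "G n \<omega> = (\<Prod>t\<in>K. \<psi> t (V \<omega> (rnd (h n) t)))" for n \<omega>
    have mF: "F n \<in> borel_measurable M" for n unfolding F_def[abs_def]
      using J0 rnd_bounds(1)[OF h(1)[of n]]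
      by (intro borel_measurable_prod measurable_compose[OF std_BM_measurable[OF W] m\<phi>]) auto
    have mG: "G n \<in> borel_measurable M" for n unfolding G_def[abs_def]
      using K rnd_bounds(1)[OF h(1)[of n]]
      by (intro borel_measurable_prod measurable_compose[OF std_BM_measurable[OF V] m\<psi>]) auto
    have bF: "\<bar>F n \<omega>\<bar> \<le> 1" and bG: "\<bar>G n \<omega>\<bar> \<le> 1" for n \<omega>
      using b by (auto intro!: prod_le_1 simp: abs_prod F_def G_def)
    have bFG: "\<bar>G n \<omega> * F n \<omega>\<bar> \<le> 1" for n \<omega>
      using bF bG by (simp add: abs_mult mult_le_one)
    have lF: "(\<lambda>n. F n \<omega>) \<longlonglongrightarrow> (\<Prod>t\<in>J. \<phi> t (W \<omega> t))" if "\<omega> \<in> space M" for \<omega>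
      unfolding F_def by (rule std_BM_test_tendsto[OF W h J(1) J0 c(1) that])
    have lG: "(\<lambda>n. G n \<omega>) \<longlonglongrightarrow> (\<Prod>t\<in>K. \<psi> t (V \<omega> t))" if "\<omega> \<in> space M" for \<omega>
      unfolding G_def by (rule std_BM_test_tendsto[OF V h K c(2) that])
    have split: "(\<integral>\<omega>. G n \<omega> * F n \<omega> \<partial>M) = (\<integral>\<omega>. G n \<omega> \<partial>M) * (\<integral>\<omega>. F n \<omega> \<partial>M)" for n
    proof -
      let ?X = "\<lambda>i \<omega>. W \<omega> (real (Suc i) * h n) - W \<omega> (real i * h n)"
      let ?m = "\<Sum>t\<in>K. nat \<lfloor>t / h n\<rfloor>"
      \<comment> \<open>Block A fills exactly [0,s]; block B starts at s and is long enough for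
        every time in K.\<close>
      let ?A = "{..<Suc n}" and ?B = "{Suc n..<Suc n + ?m}"
      have leK: "nat \<lfloor>t / h n\<rfloor> \<le> ?m" if "t \<in> K" for t
        using member_le_sum[OF that, of "\<lambda>t. nat \<lfloor>t / h n\<rfloor>"] K by simp
      have leJ: "nat \<lfloor>t / h n\<rfloor> \<le> Suc n" if "t \<in> J" for t
        using that J rnd_step_index[OF s] unfolding h_def by auto
      define f where "f x = (\<Prod>t\<in>J. \<phi> t (\<Sum>i<nat \<lfloor>t / h n\<rfloor>. x i))" for x :: "nat \<Rightarrow> real"
      define g where "g x = (\<Prod>t\<in>K. \<psi> t (\<Sum>i<nat \<lfloor>t / h n\<rfloor>. x (Suc n + i)))" for x :: "nat \<Rightarrow> real"
      have mf: "f \<in> borel_measurable (borel_paths ?A)" unfolding f_def[abs_def]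
        using leJ by (intro borel_measurable_prod measurable_compose[OF borel_measurable_sum m\<phi>]
            measurable_component_singleton) (auto intro: less_le_trans)
      have mg: "g \<in> borel_measurable (borel_paths ?B)" unfolding g_def[abs_def]
        using leK by (intro borel_measurable_prod measurable_compose[OF borel_measurable_sum m\<psi>]
            measurable_component_singleton) (auto intro: less_le_trans)
      have indep: "indep_var borel (g \<circ> (\<lambda>\<omega>. restrict (\<lambda>i. ?X i \<omega>) ?B)) borel (f \<circ> (\<lambda>\<omega>. restrict (\<lambda>i. ?X i \<omega>) ?A))"
      proof (rule indep_var_compose[OF _ mg mf])
        show "indep_var (borel_paths ?B) (\<lambda>\<omega>. restrict (\<lambda>i. ?X i \<omega>) ?B)
            (borel_paths ?A) (\<lambda>\<omega>. restrict (\<lambda>i. ?X i \<omega>) ?A)"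
        proof -
          have "?B \<inter> ?A = {}" "?B \<subseteq> {..<Suc n + ?m}" "?A \<subseteq> {..<Suc n + ?m}" by auto
          from indep_var_restrict[OF std_BM_grid_indep[OF W h(1)[of n], of "Suc n + ?m"] this]
          show ?thesis .
        qed
      qed
      have fF: "(f \<circ> (\<lambda>\<omega>. restrict (\<lambda>i. ?X i \<omega>) ?A)) \<omega> = F n \<omega>" if "\<omega> \<in> space M" for \<omega>
      proof -
        have "W \<omega> (rnd (h n) t) = (\<Sum>i<nat \<lfloor>t / h n\<rfloor>. restrict (\<lambda>i. ?X i \<omega>) ?A i)" if "t \<in> J" for t
          unfolding rnd_def using leJ[OF that]
          by (intro trans[OF std_BM_grid_sum[OF W \<open>\<omega> \<in> space M\<close>]] sum.cong) auto
        then show ?thesis by (simp add: f_def F_def cong: prod.cong)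
      qed
      have gG: "(g \<circ> (\<lambda>\<omega>. restrict (\<lambda>i. ?X i \<omega>) ?B)) \<omega> = G n \<omega>" if "\<omega> \<in> space M" for \<omega>
      proof -
        have "V \<omega> (rnd (h n) t) = (\<Sum>i<nat \<lfloor>t / h n\<rfloor>. restrict (\<lambda>i. ?X i \<omega>) ?B (Suc n + i))" if "t \<in> K" for t
        proof -
          have "V \<omega> (rnd (h n) t) = (\<Sum>i<nat \<lfloor>t / h n\<rfloor>. V \<omega> (real (Suc i) * h n) - V \<omega> (real i * h n))"
            unfolding rnd_def by (rule std_BM_grid_sum[OF V \<open>\<omega> \<in> space M\<close>])
          also have "\<dots> = (\<Sum>i<nat \<lfloor>t / h n\<rfloor>. restrict (\<lambda>i. ?X i \<omega>) ?B (Suc n + i))"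
          proof (rule sum.cong)
            fix i assume i: "i \<in> {..<nat \<lfloor>t / h n\<rfloor>}"
            have "s + real j * h n = real (Suc n + j) * h n" for j
              using hs[of n] by (simp add: algebra_simps)
            from this[of i] this[of "Suc i"] show "V \<omega> (real (Suc i) * h n) - V \<omega> (real i * h n)
              = restrict (\<lambda>i. ?X i \<omega>) ?B (Suc n + i)"
              using i leK[OF that] unfolding V_def by simp
          qed simp
          finally show ?thesis .
        qed
        then show ?thesis by (simp add: g_def G_def cong: prod.cong)
      qed
      have "\<bar>f x\<bar> \<le> 1" "\<bar>g x\<bar> \<le> 1" for x
        using b by (auto intro!: prod_le_1 simp: abs_prod f_def g_def)
      then have "integrable M (f \<circ> (\<lambda>\<omega>. restrict (\<lambda>i. ?X i \<omega>) ?A))"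
        "integrable M (g \<circ> (\<lambda>\<omega>. restrict (\<lambda>i. ?X i \<omega>) ?B))"
        using indep_var_rv1[OF indep] indep_var_rv2[OF indep]
        by (auto intro!: integrable_const_bound[where B=1])
      note int = indep_var_lebesgue_integral[OF indep this(2,1)]
      have "(\<integral>\<omega>. G n \<omega> * F n \<omega> \<partial>M) = (\<integral>\<omega>. (g \<circ> (\<lambda>\<omega>. restrict (\<lambda>i. ?X i \<omega>) ?B)) \<omega>
          * (f \<circ> (\<lambda>\<omega>. restrict (\<lambda>i. ?X i \<omega>) ?A)) \<omega> \<partial>M)"
        by (intro Bochner_Integration.integral_cong arg_cong2[where f="(*)"] fF[symmetric] gG[symmetric] refl)
      also note int
      also have "(\<integral>\<omega>. (g \<circ> (\<lambda>\<omega>. restrict (\<lambda>i. ?X i \<omega>) ?B)) \<omega> \<partial>M) = (\<integral>\<omega>. G n \<omega> \<partial>M)"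
        by (intro Bochner_Integration.integral_cong gG refl)
      also have "(\<integral>\<omega>. (f \<circ> (\<lambda>\<omega>. restrict (\<lambda>i. ?X i \<omega>) ?A)) \<omega> \<partial>M) = (\<integral>\<omega>. F n \<omega> \<partial>M)"
        by (intro Bochner_Integration.integral_cong fF refl)
      finally show ?thesis .
    qed
    have "(\<lambda>n. \<integral>\<omega>. G n \<omega> * F n \<omega> \<partial>M) \<longlonglongrightarrow> (\<integral>\<omega>. (\<Prod>t\<in>K. \<psi> t (V \<omega> t)) * (\<Prod>t\<in>J. \<phi> t (W \<omega> t)) \<partial>M)"
      using mF mG bFG lF lG by (intro bounded_convergence[where B=1]) (auto intro!: tendsto_mult finite_measure_axioms)
    moreover have "(\<lambda>n. \<integral>\<omega>. G n \<omega> * F n \<omega> \<partial>M) \<longlonglongrightarrow> (\<integral>\<omega>. (\<Prod>t\<in>K. \<psi> t (V \<omega> t)) \<partial>M) * (\<integral>\<omega>. (\<Prod>t\<in>J. \<phi> t (W \<omega> t)) \<partial>M)"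
      unfolding split
      using mF mG bF bG lF lG by (intro tendsto_mult bounded_convergence[where B=1]) (auto intro!: finite_measure_axioms)
    ultimately show ?thesis by (rule LIMSEQ_unique)
  qed
  \<comment> \<open>With the product over the future as a fixed nonnegative weight, the tests on the
    past are upgraded to an arbitrary event.\<close>
  have step1: "(\<integral>\<omega>. (\<Prod>t\<in>K. \<psi> t (V \<omega> t)) * indicator A (restrict (W \<omega>) {0..s}) \<partial>M)
      = (\<integral>\<omega>. (\<Prod>t\<in>K. \<psi> t (V \<omega> t)) \<partial>M) * (\<integral>\<omega>. indicator A (restrict (W \<omega>) {0..s}) \<partial>M)"
    if A: "A \<in> sets (borel_paths {0..s})" and K: "finite K" "K \<subseteq> {0..}"
      and c: "\<And>t. continuous_on UNIV (\<psi> t)" and b: "\<And>i x. 0 \<le> \<psi> i x \<and> \<psi> i x \<le> 1"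
    for A K and \<psi> :: "real \<Rightarrow> real \<Rightarrow> real"
  proof -
    have "(\<integral>\<omega>. (\<Prod>t\<in>K. \<psi> t (V \<omega> t)) * indicator A (restrict (W \<omega>) {0..s}) \<partial>M)
      = (\<integral>\<omega>. (\<integral>\<omega>. (\<Prod>t\<in>K. \<psi> t (V \<omega> t)) \<partial>M) * indicator A (restrict (W \<omega>) {0..s}) \<partial>M)"
    proof (rule integral_eq_of_test_functions[OF mW mW])
      have "\<psi> t \<in> borel_measurable borel" for t using c by (auto intro: borel_measurable_continuous_onI)
      then show "integrable M (\<lambda>\<omega>. \<Prod>t\<in>K. \<psi> t (V \<omega> t))"
        using K b by (intro integrable_const_bound[where B=1] borel_measurable_prod
          measurable_compose[OF std_BM_measurable[OF V]]) (auto intro!: prod_le_1 simp: abs_prod)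
      show "0 \<le> (\<Prod>t\<in>K. \<psi> t (V \<omega> t))" for \<omega> using b by (intro prod_nonneg) auto
      then show "0 \<le> (\<integral>\<omega>. (\<Prod>t\<in>K. \<psi> t (V \<omega> t)) \<partial>M)" by simp
      fix J :: "real set" and \<phi> :: "real \<Rightarrow> real \<Rightarrow> real"
      assume J: "finite J" "J \<subseteq> {0..s}" "\<And>i. continuous_on UNIV (\<phi> i)" "\<And>i x. 0 \<le> \<phi> i x \<and> \<phi> i x \<le> 1"
      have *: "(\<Prod>i\<in>J. \<phi> i (restrict (W \<omega>) {0..s} i)) = (\<Prod>i\<in>J. \<phi> i (W \<omega> i))" for \<omega>
        using J(2) by (intro prod.cong) auto
      show "(\<integral>\<omega>. (\<Prod>t\<in>K. \<psi> t (V \<omega> t)) * (\<Prod>i\<in>J. \<phi> i (restrict (W \<omega>) {0..s} i)) \<partial>M)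
       = (\<integral>\<omega>. (\<integral>\<omega>. (\<Prod>t\<in>K. \<psi> t (V \<omega> t)) \<partial>M) * (\<Prod>i\<in>J. \<phi> i (restrict (W \<omega>) {0..s} i)) \<partial>M)"
        unfolding * by (simp add: test[OF J(1,2) K J(3) c J(4) b])
    qed (use A in auto)
    then show ?thesis by simp
  qed
  \<comment> \<open>Now the past event is the weight, and the tests on the future are
    upgraded.\<close>
  have step2: "(\<integral>\<omega>. indicator A (restrict (W \<omega>) {0..s}) * indicator B (restrict (V \<omega>) {0..}) \<partial>M)
      = (\<integral>\<omega>. indicator A (restrict (W \<omega>) {0..s}) \<partial>M) * (\<integral>\<omega>. (indicator B (restrict (V \<omega>) {0..}) :: real) \<partial>M)"
    if A[measurable]: "A \<in> sets (borel_paths {0..s})" and B[measurable]: "B \<in> sets path_pos" for A B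
  proof -
    have "(\<integral>\<omega>. indicator A (restrict (W \<omega>) {0..s}) * indicator B (restrict (V \<omega>) {0..}) \<partial>M)
      = (\<integral>\<omega>. (\<integral>\<omega>. indicator A (restrict (W \<omega>) {0..s}) \<partial>M) * (indicator B (restrict (V \<omega>) {0..}) :: real) \<partial>M)"
    proof (rule integral_eq_of_test_functions[OF mV mV])
      show "integrable M (\<lambda>\<omega>. indicator A (restrict (W \<omega>) {0..s}) :: real)"
        by (intro integrable_const_bound[where B=1]) auto
      fix K :: "real set" and \<psi> :: "real \<Rightarrow> real \<Rightarrow> real"
      assume J: "finite K" "K \<subseteq> {0..}" "\<And>i. continuous_on UNIV (\<psi> i)" "\<And>i x. 0 \<le> \<psi> i x \<and> \<psi> i x \<le> 1"
      have *: "(\<Prod>i\<in>K. \<psi> i (restrict (V \<omega>) {0..} i)) = (\<Prod>i\<in>K. \<psi> i (V \<omega> i))" for \<omega>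
        using J(2) by (intro prod.cong) auto
      show "(\<integral>\<omega>. indicator A (restrict (W \<omega>) {0..s}) * (\<Prod>i\<in>K. \<psi> i (restrict (V \<omega>) {0..} i)) \<partial>M)
       = (\<integral>\<omega>. (\<integral>\<omega>. indicator A (restrict (W \<omega>) {0..s}) \<partial>M) * (\<Prod>i\<in>K. \<psi> i (restrict (V \<omega>) {0..} i)) \<partial>M)"
        unfolding * using step1[OF A J(1,2), of \<psi>] J(3,4) by (simp add: mult.commute)
    qed auto
    then show ?thesis by simp
  qed
  have "distr M (borel_paths {0..s}) (\<lambda>\<omega>. restrict (W \<omega>) {0..s}) \<Otimes>\<^sub>M distr M path_pos (\<lambda>\<omega>. restrict (V \<omega>) {0..})
    = distr M (borel_paths {0..s} \<Otimes>\<^sub>M path_pos) (\<lambda>\<omega>. (restrict (W \<omega>) {0..s}, restrict (V \<omega>) {0..}))"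
  proof (rule pair_measure_eqI)
    fix A B assume "A \<in> sets (distr M (borel_paths {0..s}) (\<lambda>\<omega>. restrict (W \<omega>) {0..s}))"
      "B \<in> sets (distr M path_pos (\<lambda>\<omega>. restrict (V \<omega>) {0..}))"
    then have [measurable]: "A \<in> sets (borel_paths {0..s})" "B \<in> sets path_pos" by auto
    let ?a = "(\<lambda>\<omega>. restrict (W \<omega>) {0..s}) -` A \<inter> space M"
    let ?b = "(\<lambda>\<omega>. restrict (V \<omega>) {0..}) -` B \<inter> space M"
    have "(\<integral>\<omega>. indicator A (restrict (W \<omega>) {0..s}) * indicator B (restrict (V \<omega>) {0..}) \<partial>M)
       = (\<integral>\<omega>. indicator (?a \<inter> ?b) \<omega> \<partial>M :: real)"
      by (intro Bochner_Integration.integral_cong) (auto simp: indicator_def)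
    moreover have "(\<integral>\<omega>. indicator A (restrict (W \<omega>) {0..s}) \<partial>M) = (\<integral>\<omega>. indicator ?a \<omega> \<partial>M :: real)"
      by (intro Bochner_Integration.integral_cong) (auto simp: indicator_def)
    moreover have "(\<integral>\<omega>. indicator B (restrict (V \<omega>) {0..}) \<partial>M) = (\<integral>\<omega>. indicator ?b \<omega> \<partial>M :: real)"
      by (intro Bochner_Integration.integral_cong) (auto simp: indicator_def)
    ultimately have "prob (?a \<inter> ?b) = prob ?a * prob ?b"
      using step2[of A B] by simp
    moreover have "(\<lambda>\<omega>. (restrict (W \<omega>) {0..s}, restrict (V \<omega>) {0..})) -` (A \<times> B) \<inter> space M = ?a \<inter> ?b" by auto
    ultimately show "emeasure (distr M (borel_paths {0..s}) (\<lambda>\<omega>. restrict (W \<omega>) {0..s})) A *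
       emeasure (distr M path_pos (\<lambda>\<omega>. restrict (V \<omega>) {0..})) B
       = emeasure (distr M (borel_paths {0..s} \<Otimes>\<^sub>M path_pos) (\<lambda>\<omega>. (restrict (W \<omega>) {0..s}, restrict (V \<omega>) {0..}))) (A \<times> B)"
      by (simp add: emeasure_distr emeasure_eq_measure ennreal_mult')
  qed (auto intro!: prob_space_imp_sigma_finite prob_space_distr)
  then show ?thesis
    unfolding indep_var_distribution_eq using mW mV by (simp add: V_def[abs_def])
qed

section \<open>Reflection principle\<close>

lemma std_BM_ge_sets:
  assumes W: "std_BM M W" and s: "s > 0"
  shows "{\<omega>\<in>space M. \<forall>t\<in>{0..s}. c \<le> W \<omega> t} \<in> sets M"
  by (rule sets_path_ge[OF s])
    (auto intro!: std_BM_measurable[OF W] continuous_on_subset[OF std_BM_continuous[OF W]])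

lemma std_BM_marginal:
  assumes W: "std_BM M W" and t: "t > 0"
  shows "distributed M lborel (\<lambda>\<omega>. W \<omega> t) (normal_density 0 (sqrt t))"
proof -
  have "distr M lborel (\<lambda>\<omega>. W \<omega> t - W \<omega> 0) = distr M lborel (\<lambda>\<omega>. W \<omega> t)"
    using std_BM_zero[OF W] by (intro distr_cong) auto
  then show ?thesis using std_BM_increment[OF W, of 0 t] t std_BM_measurable[OF W, of t]
    by (auto simp: distributed_def)
qed

lemma std_BM_symmetric:
  assumes W: "std_BM M W" and t: "t > 0"
  shows "distr M borel (\<lambda>\<omega>. - W \<omega> t) = distr M borel (\<lambda>\<omega>. W \<omega> t)"
proof -
  interpret prob_space M by (rule std_BM_prob_space[OF W])
  have "distributed M lborel (\<lambda>\<omega>. 0 + (- 1) * W \<omega> t) (normal_density (0 + (- 1) * 0) (\<bar>- 1\<bar> * sqrt t))"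
    using t by (intro normal_density_affine std_BM_marginal[OF W]) auto
  then have "distr M lborel (\<lambda>\<omega>. - W \<omega> t) = density lborel (\<lambda>x. ennreal (normal_density 0 (sqrt t) x))"
    by (simp add: distributed_distr_eq_density)
  also have "\<dots> = distr M lborel (\<lambda>\<omega>. W \<omega> t)"
    by (simp add: distributed_distr_eq_density[OF std_BM_marginal[OF W t]])
  finally show ?thesis by (simp cong: distr_cong)
qed

text \<open>Unlike \<^const>\<open>prob_space.indep_var\<close>, this allows the two components to have different types.\<close>

lemma (in prob_space) indep_var_distr_pair:
  assumes XY: "indep_var S X T Y" and g[measurable]: "g \<in> measurable T R"
  shows "distr M (S \<Otimes>\<^sub>M R) (\<lambda>\<omega>. (X \<omega>, g (Y \<omega>))) = distr M S X \<Otimes>\<^sub>M distr M R (\<lambda>\<omega>. g (Y \<omega>))"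
proof -
  have [measurable]: "X \<in> measurable M S" "Y \<in> measurable M T"
    using indep_var_rv1[OF XY] indep_var_rv2[OF XY] by auto
  interpret D: prob_space "distr M R (\<lambda>\<omega>. g (Y \<omega>))" by (rule prob_space_distr) simp
  have gD: "distr (distr M T Y) R g = distr M R (\<lambda>\<omega>. g (Y \<omega>))"
    by (subst distr_distr) (auto simp: o_def)
  have "distr M S X \<Otimes>\<^sub>M distr M R (\<lambda>\<omega>. g (Y \<omega>)) = distr (distr M S X) S (\<lambda>x. x) \<Otimes>\<^sub>M distr (distr M T Y) R g"
    unfolding gD by (simp add: distr_distr o_def)
  also have "\<dots> = distr (distr M S X \<Otimes>\<^sub>M distr M T Y) (S \<Otimes>\<^sub>M R) (\<lambda>(x, y). (x, g y))"
    by (intro pair_measure_distr) (auto simp: gD intro: D.sigma_finite_measure_axioms)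
  also have "distr M S X \<Otimes>\<^sub>M distr M T Y = distr M (S \<Otimes>\<^sub>M T) (\<lambda>\<omega>. (X \<omega>, Y \<omega>))"
    using XY unfolding indep_var_distribution_eq by simp
  also have "distr (distr M (S \<Otimes>\<^sub>M T) (\<lambda>\<omega>. (X \<omega>, Y \<omega>))) (S \<Otimes>\<^sub>M R) (\<lambda>(x, y). (x, g y))
     = distr M (S \<Otimes>\<^sub>M R) (\<lambda>\<omega>. (X \<omega>, g (Y \<omega>)))"
    by (subst distr_distr) (auto simp: o_def)
  finally show ?thesis by simp
qed

text \<open>The reflection step in its barest form: an independent symmetric increment may change
  sign without changing its joint law with the past X.\<close>

lemma (in prob_space) prob_flip_indep:
  fixes g :: "'c \<Rightarrow> real"
  assumes XY: "indep_var S X T Y" and g[measurable]: "g \<in> borel_measurable T"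
    and sym: "distr M borel (\<lambda>\<omega>. - g (Y \<omega>)) = distr M borel (\<lambda>\<omega>. g (Y \<omega>))"
    and C: "C \<in> sets (S \<Otimes>\<^sub>M borel)"
  shows "prob {\<omega>\<in>space M. (X \<omega>, - g (Y \<omega>)) \<in> C} = prob {\<omega>\<in>space M. (X \<omega>, g (Y \<omega>)) \<in> C}"
proof -
  have [measurable]: "X \<in> measurable M S" "Y \<in> measurable M T"
    using indep_var_rv1[OF XY] indep_var_rv2[OF XY] by auto
  have "distr M (S \<Otimes>\<^sub>M borel) (\<lambda>\<omega>. (X \<omega>, - g (Y \<omega>))) = distr M (S \<Otimes>\<^sub>M borel) (\<lambda>\<omega>. (X \<omega>, g (Y \<omega>)))"
    using indep_var_distr_pair[OF XY g] indep_var_distr_pair[OF XY, of "\<lambda>y. - g y" borel] sym by simp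
  then have "measure (distr M (S \<Otimes>\<^sub>M borel) (\<lambda>\<omega>. (X \<omega>, - g (Y \<omega>)))) C
     = measure (distr M (S \<Otimes>\<^sub>M borel) (\<lambda>\<omega>. (X \<omega>, g (Y \<omega>)))) C" by simp
  then show ?thesis using C by (simp add: measure_distr vimage_def Int_def conj_commute)
qed

text \<open>Split by the first grid index k at which the walk is at or below -a. If the path ends
  above -a, flip the remaining increment Y: S + Y > -a becomes S - Y > -a, that is, the final value
  S + Y lies below 2 S + a. On a grid the walk may overshoot -a, which is why S remains in the
  formula; without overshoot the condition would read W 1 < -a.\<close>

lemma std_BM_first_passage:
  assumes W: "std_BM M W" and a: "a > 0"
  defines "S n k \<omega> \<equiv> W \<omega> (real k * (1 / real (Suc n)))"
  defines "T n k \<omega> \<equiv> (\<forall>j<k. - a < S n j \<omega>) \<and> S n k \<omega> \<le> - a"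
  shows "measure M {\<omega>\<in>space M. \<exists>k\<le>Suc n. S n k \<omega> \<le> - a}
    = measure M {\<omega>\<in>space M. W \<omega> 1 \<le> - a}
    + measure M {\<omega>\<in>space M. \<exists>k\<le>Suc n. T n k \<omega> \<and> W \<omega> 1 < 2 * S n k \<omega> + a}" (is "measure M ?A = _ + measure M ?R")
proof -
  interpret prob_space M by (rule std_BM_prob_space[OF W])
  let ?h = "1 / real (Suc n)"
  have [measurable]: "S n k \<in> borel_measurable M" for k
    unfolding S_def[abs_def] by (rule std_BM_measurable[OF W]) simp
  have [measurable]: "(\<lambda>\<omega>. W \<omega> 1) \<in> borel_measurable M" by (rule std_BM_measurable[OF W]) simp
  have SN: "S n (Suc n) \<omega> = W \<omega> 1" for \<omega> by (simp add: S_def)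
  have S0: "S n 0 \<omega> = 0" if "\<omega> \<in> space M" for \<omega> using std_BM_zero[OF W that] by (simp add: S_def)
  have [measurable]: "Measurable.pred M (T n k)" for k
    unfolding T_def[abs_def] by measurable
  have uniq: "j = k" if "T n j \<omega>" "T n k \<omega>" for j k \<omega>
    using that unfolding T_def by (meson linorder_neqE_nat not_le)
  define P where "P k = {\<omega>\<in>space M. T n k \<omega> \<and> - a < W \<omega> 1}" for k
  define Q where "Q k = {\<omega>\<in>space M. T n k \<omega> \<and> W \<omega> 1 < 2 * S n k \<omega> + a}" for k
  have mP: "P k \<in> sets M" and mQ: "Q k \<in> sets M" for k unfolding P_def Q_def by measurable
  have PQ: "prob (P k) = prob (Q k)" if k: "k \<le> Suc n" for k
  proof -
    \<comment> \<open>At k = 0 the walk is at 0, above -a; at the last index no increment is left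
      and both conditions contradict passage. Only in between is there time of positive length to
      reflect.\<close>
    consider "k = 0" | "k = Suc n" | "0 < k" "k < Suc n" using k by linarith
    then show ?thesis
    proof cases
      case 1
      then have "P k = {}" "Q k = {}" using S0 a by (auto simp: P_def Q_def T_def)
      then show ?thesis by simp
    next
      case 2
      then have "P k = {}" "Q k = {}" by (auto simp: P_def Q_def T_def SN)
      then show ?thesis by simp
    next
      case 3
      define s where "s = real k * ?h"
      have s: "0 < s" "s < 1" using 3 by (auto simp: s_def)
      define Y where "Y \<omega> = W \<omega> (s + (1 - s)) - W \<omega> s" for \<omega>
      have V: "std_BM M (\<lambda>\<omega> t. W \<omega> (s + t) - W \<omega> s)" using s by (intro std_BM_shift[OF W]) auto
      have gm: "(\<lambda>v. v (1 - s)) \<in> borel_measurable path_pos"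
        using s by (auto intro!: measurable_component_singleton)
      have gY: "restrict (\<lambda>t. W \<omega> (s + t) - W \<omega> s) {0..} (1 - s) = Y \<omega>" for \<omega>
        using s by (simp add: Y_def)
      have sym: "distr M borel (\<lambda>\<omega>. - Y \<omega>) = distr M borel Y"
        unfolding Y_def[abs_def] by (rule std_BM_symmetric[OF V]) (use s in auto)
      have js: "real j * ?h \<in> {0..s}" if "j \<le> k" for j
        using that by (auto simp: s_def intro!: mult_right_mono divide_right_mono)
      have cm: "(\<lambda>x. fst x (real j * ?h)) \<in> borel_measurable (borel_paths {0..s} \<Otimes>\<^sub>M (borel :: real measure))" if "j \<le> k" for j
        by (rule measurable_compose[OF measurable_fst measurable_component_singleton[OF js[OF that]]])
      \<comment> \<open>One set of pairs (past, increment): inserting Y gives \<open>P k\<close>,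
        inserting -Y gives \<open>Q k\<close>.\<close>
      define C where "C = {x \<in> space (borel_paths {0..s} \<Otimes>\<^sub>M (borel :: real measure)).
          (\<forall>j\<in>{..<k}. - a < fst x (real j * ?h)) \<and> fst x (real k * ?h) \<le> - a \<and> - a < fst x (real k * ?h) + snd x}"
      have C: "C \<in> sets (borel_paths {0..s} \<Otimes>\<^sub>M borel)"
        unfolding C_def
        by (intro sets.sets_Collect_conj sets.sets_Collect_finite_All' borel_measurable_less borel_measurable_le
          borel_measurable_add borel_measurable_const) (use cm 3 in \<open>simp_all del: of_nat_Suc add: less_imp_le lessThan_empty_iff bot_nat_def\<close>)
      have mem: "(restrict (W \<omega>) {0..s}, y) \<in> C \<longleftrightarrow> T n k \<omega> \<and> - a < S n k \<omega> + y" for \<omega> y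
        using js unfolding C_def T_def S_def by (auto simp: space_pair_measure space_PiM)
      have Sk: "S n k \<omega> = W \<omega> s" for \<omega> by (simp add: S_def s_def)
      have "{\<omega>\<in>space M. (restrict (W \<omega>) {0..s}, Y \<omega>) \<in> C} = P k"
        unfolding mem P_def by (auto simp: Sk Y_def)
      moreover have "{\<omega>\<in>space M. (restrict (W \<omega>) {0..s}, - Y \<omega>) \<in> C} = Q k"
        unfolding mem Q_def by (auto simp: Sk Y_def)
      ultimately show ?thesis
        using prob_flip_indep[OF std_BM_markov[OF W s(1)] gm _ C, unfolded gY, OF sym] by simp
    qed
  qed
  have dP: "disjoint_family_on P {..Suc n}" and dQ: "disjoint_family_on Q {..Suc n}"
    using uniq by (auto simp: disjoint_family_on_def P_def Q_def)
  have hit: "\<exists>k\<le>Suc n. T n k \<omega>" if "k \<le> Suc n" "S n k \<omega> \<le> - a" for k \<omega>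
  proof -
    define l where "l = (LEAST l. S n l \<omega> \<le> - a)"
    have "S n l \<omega> \<le> - a" unfolding l_def by (rule LeastI[of _ k]) (use that in auto)
    moreover have "l \<le> k" unfolding l_def by (rule Least_le) (use that in auto)
    moreover have "- a < S n j \<omega>" if "j < l" for j using not_less_Least[of j] that unfolding l_def by force
    ultimately show ?thesis using that unfolding T_def by (intro exI[of _ l]) auto
  qed
  have A: "?A = {\<omega>\<in>space M. W \<omega> 1 \<le> - a} \<union> (\<Union>k\<in>{..Suc n}. P k)"
  proof (intro equalityI subsetI)
    fix \<omega> assume "\<omega> \<in> ?A"
    then show "\<omega> \<in> {\<omega>\<in>space M. W \<omega> 1 \<le> - a} \<union> (\<Union>k\<in>{..Suc n}. P k)"
      using hit[of _ \<omega>] by (auto simp: P_def)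
  next
    fix \<omega> assume "\<omega> \<in> {\<omega>\<in>space M. W \<omega> 1 \<le> - a} \<union> (\<Union>k\<in>{..Suc n}. P k)"
    then show "\<omega> \<in> ?A" using SN[of \<omega>] by (auto simp: P_def T_def)
  qed
  have R: "?R = (\<Union>k\<in>{..Suc n}. Q k)" by (auto simp: Q_def)
  have "prob ?A = prob {\<omega>\<in>space M. W \<omega> 1 \<le> - a} + prob (\<Union>k\<in>{..Suc n}. P k)"
    unfolding A using mP by (intro finite_measure_Union) (auto simp: P_def)
  also have "prob (\<Union>k\<in>{..Suc n}. P k) = (\<Sum>k\<in>{..Suc n}. prob (P k))"
    using mP dP by (intro finite_measure_finite_Union) auto
  also have "\<dots> = (\<Sum>k\<in>{..Suc n}. prob (Q k))" using PQ by (intro sum.cong) auto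
  also have "\<dots> = prob ?R"
    unfolding R using mQ dQ by (intro finite_measure_finite_Union[symmetric]) auto
  finally show ?thesis .
qed


text \<open>The distribution function of the absolute value of a standard normal variable, hence 0
  for negative a. By reflection it is also the distribution function of minus the minimum of
  Brownian motion over [0,1].\<close>

definition std_normal_cdf2 :: "real \<Rightarrow> real" where
  "std_normal_cdf2 a = measure std_normal_distribution {-a..a}"

lemma std_normal_density_le_1: "std_normal_density x \<le> 1"
proof -
  have "1 \<le> 2 * pi" using pi_gt3 by simp
  then have "1 \<le> sqrt (2 * pi)" by (simp add: real_le_rsqrt)
  then have "1 / sqrt (2 * pi) \<le> 1" by simp
  moreover have "exp (- x\<^sup>2 / 2) \<le> 1" by simp
  ultimately show ?thesis
    unfolding std_normal_density_def by (intro mult_le_one) auto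
qed

lemma std_normal_measure_le:
  assumes "A \<in> sets borel" "emeasure lborel A < \<infinity>" and d: "\<And>x. x \<in> A \<Longrightarrow> std_normal_density x \<le> c" "c \<ge> 0"
  shows "measure std_normal_distribution A \<le> c * measure lborel A"
proof -
  interpret real_distribution std_normal_distribution by (rule real_dist_normal_dist)
  have "emeasure std_normal_distribution A = (\<integral>\<^sup>+x\<in>A. ennreal (std_normal_density x) \<partial>lborel)"
    using assms by (subst emeasure_density) auto
  also have "\<dots> \<le> (\<integral>\<^sup>+x. ennreal c * indicator A x \<partial>lborel)"
    using d by (intro nn_integral_mono) (auto simp: indicator_def intro!: ennreal_leI)
  also have "\<dots> = ennreal c * emeasure lborel A" using assms by (simp add: nn_integral_cmult)
  also have "\<dots> = ennreal (c * measure lborel A)"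
    using assms by (simp add: emeasure_eq_ennreal_measure ennreal_mult')
  finally show ?thesis using d by (simp add: emeasure_eq_measure)
qed

lemma std_normal_measure_ge:
  assumes "A \<in> sets borel" "emeasure lborel A < \<infinity>" and d: "\<And>x. x \<in> A \<Longrightarrow> c \<le> std_normal_density x" "c \<ge> 0"
  shows "c * measure lborel A \<le> measure std_normal_distribution A"
proof -
  interpret real_distribution std_normal_distribution by (rule real_dist_normal_dist)
  have "ennreal (c * measure lborel A) = ennreal c * emeasure lborel A"
    using assms by (simp add: emeasure_eq_ennreal_measure ennreal_mult')
  also have "\<dots> = (\<integral>\<^sup>+x. ennreal c * indicator A x \<partial>lborel)" using assms by (simp add: nn_integral_cmult)
  also have "\<dots> \<le> (\<integral>\<^sup>+x\<in>A. ennreal (std_normal_density x) \<partial>lborel)"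
    using d by (intro nn_integral_mono) (auto simp: indicator_def intro!: ennreal_leI)
  also have "\<dots> = emeasure std_normal_distribution A"
    using assms by (subst emeasure_density) auto
  finally show ?thesis using d by (simp add: emeasure_eq_measure)
qed

lemma std_normal_cdf2_neg: "a < 0 \<Longrightarrow> std_normal_cdf2 a = 0"
  by (simp add: std_normal_cdf2_def)

text \<open>Enlarging the interval adds two strips of length b - a, and the density is at most 1.
  This modulus removes the gap between barriers -a and -b in the reflection principle and controls
  how stay probabilities move with the barrier.\<close>

lemma std_normal_cdf2_lipschitz:
  assumes "a \<le> b"
  shows "std_normal_cdf2 b - std_normal_cdf2 a \<le> 2 * (b - a)"
proof -
  interpret real_distribution std_normal_distribution by (rule real_dist_normal_dist)
  have "std_normal_cdf2 b - std_normal_cdf2 a = measure std_normal_distribution ({-b..b} - {-a..a})"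
    unfolding std_normal_cdf2_def using assms by (intro finite_measure_Diff[symmetric]) auto
  also have "\<dots> \<le> measure std_normal_distribution ({-b..-a} \<union> {a..b})"
    by (intro finite_measure_mono) auto
  also have "\<dots> \<le> measure std_normal_distribution {-b..-a} + measure std_normal_distribution {a..b}"
    by (intro measure_Un_le) auto
  also have "\<dots> \<le> 1 * measure lborel {-b..-a} + 1 * measure lborel {a..b}"
    by (intro add_mono std_normal_measure_le) (auto simp: std_normal_density_le_1 emeasure_lborel_Icc_eq)
  also have "\<dots> = 2 * (b - a)" using assms by simp
  finally show ?thesis .
qed

text \<open>On a symmetric interval the density lies between its value at the endpoint and its value
  at the centre.\<close>

lemma std_normal_cdf2_bounds:
  assumes "a \<ge> 0"
  shows "2 * a * std_normal_density a \<le> std_normal_cdf2 a" "std_normal_cdf2 a \<le> 2 * a * std_normal_density 0"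
proof -
  have "std_normal_density a * measure lborel {-a..a} \<le> std_normal_cdf2 a"
    unfolding std_normal_cdf2_def
  proof (rule std_normal_measure_ge)
    fix x assume "x \<in> {-a..a}"
    then have "x\<^sup>2 \<le> a\<^sup>2" by (intro power2_le_iff_abs_le[THEN iffD2]) (use assms in auto)
    then show "std_normal_density a \<le> std_normal_density x"
      unfolding std_normal_density_def by (intro mult_left_mono) auto
  qed (auto simp: emeasure_lborel_Icc_eq)
  then show "2 * a * std_normal_density a \<le> std_normal_cdf2 a" using assms by (simp add: mult.commute)
  have "std_normal_cdf2 a \<le> std_normal_density 0 * measure lborel {-a..a}"
    unfolding std_normal_cdf2_def
    by (rule std_normal_measure_le) (auto simp: std_normal_density_def divide_right_mono emeasure_lborel_Icc_eq)
  then show "std_normal_cdf2 a \<le> 2 * a * std_normal_density 0" using assms by (simp add: mult.commute)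
qed

text \<open>Both masses are asymptotic to the interval length times the density at 0, so only the
  ratio of the lengths survives.\<close>

lemma std_normal_cdf2_ratio:
  "((\<lambda>\<epsilon>. std_normal_cdf2 (sqrt 2 * \<epsilon>) / std_normal_cdf2 \<epsilon>) \<longlongrightarrow> sqrt 2) (at_right 0)"
proof (rule tendsto_sandwich)
  let ?d = std_normal_density
  have pos: "0 < ?d x" for x by (simp add: std_normal_density_def)
  have c: "(?d \<longlongrightarrow> ?d 0) (at_right 0)"
    unfolding std_normal_density_def by (intro tendsto_intros) auto
  have c2: "((\<lambda>\<epsilon>. ?d (sqrt 2 * \<epsilon>)) \<longlongrightarrow> ?d (sqrt 2 * 0)) (at_right 0)"
    unfolding std_normal_density_def by (intro tendsto_intros) auto
  show "((\<lambda>\<epsilon>. sqrt 2 * ?d (sqrt 2 * \<epsilon>) / ?d 0) \<longlongrightarrow> sqrt 2) (at_right 0)"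
    using tendsto_divide[OF tendsto_mult[OF tendsto_const[of "sqrt 2"] c2] tendsto_const[of "?d 0"]] pos[of 0] by simp
  show "((\<lambda>\<epsilon>. sqrt 2 * ?d 0 / ?d \<epsilon>) \<longlongrightarrow> sqrt 2) (at_right 0)"
    using tendsto_divide[OF tendsto_const[of "sqrt 2 * ?d 0"] c] pos[of 0] by simp
  show "\<forall>\<^sub>F \<epsilon> in at_right 0. sqrt 2 * ?d (sqrt 2 * \<epsilon>) / ?d 0 \<le> std_normal_cdf2 (sqrt 2 * \<epsilon>) / std_normal_cdf2 \<epsilon>"
    unfolding eventually_at_right_field
  proof (intro exI[of _ 1] conjI allI impI)
    fix e :: real assume e: "0 < e"
    have "0 < 2 * e * ?d e" using e pos by simp
    then have pe: "0 < std_normal_cdf2 e" using std_normal_cdf2_bounds(1)[of e] e by linarith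
    have "sqrt 2 * ?d (sqrt 2 * e) / ?d 0 = (2 * (sqrt 2 * e) * ?d (sqrt 2 * e)) / (2 * e * ?d 0)"
      using e pos[of 0] by (simp add: field_simps)
    also have "\<dots> \<le> std_normal_cdf2 (sqrt 2 * e) / std_normal_cdf2 e"
      using std_normal_cdf2_bounds(1)[of "sqrt 2 * e"] std_normal_cdf2_bounds(2)[of e] e pe
    proof (intro frac_le)
      show "0 \<le> std_normal_cdf2 (sqrt 2 * e)" by (simp add: std_normal_cdf2_def)
    qed simp_all
    finally show "sqrt 2 * ?d (sqrt 2 * e) / ?d 0 \<le> std_normal_cdf2 (sqrt 2 * e) / std_normal_cdf2 e" .
  qed simp
  show "\<forall>\<^sub>F \<epsilon> in at_right 0. std_normal_cdf2 (sqrt 2 * \<epsilon>) / std_normal_cdf2 \<epsilon> \<le> sqrt 2 * ?d 0 / ?d \<epsilon>"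
    unfolding eventually_at_right_field
  proof (intro exI[of _ 1] conjI allI impI)
    fix e :: real assume e: "0 < e"
    have pe: "0 < 2 * e * ?d e" using e pos by simp
    have "std_normal_cdf2 (sqrt 2 * e) / std_normal_cdf2 e \<le> (2 * (sqrt 2 * e) * ?d 0) / (2 * e * ?d e)"
      using std_normal_cdf2_bounds(2)[of "sqrt 2 * e"] std_normal_cdf2_bounds(1)[of e] e pe
      by (intro frac_le) (auto simp: pos less_imp_le)
    also have "\<dots> = sqrt 2 * ?d 0 / ?d e" using e pos[of e] by (simp add: field_simps)
    finally show "std_normal_cdf2 (sqrt 2 * e) / std_normal_cdf2 e \<le> sqrt 2 * ?d 0 / ?d e" .
  qed simp
qed

text \<open>By symmetry the two lower tails are the two complementary tails of the normal law, and
  single points have no mass. One weak and one strict inequality is the combination that the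
  first-passage identity yields in the limit.\<close>

lemma std_BM_two_tails:
  assumes W: "std_BM M W" and a: "a > 0"
  shows "measure M {\<omega>\<in>space M. W \<omega> 1 \<le> - a} + measure M {\<omega>\<in>space M. W \<omega> 1 < - a} = 1 - std_normal_cdf2 a"
proof -
  interpret prob_space M by (rule std_BM_prob_space[OF W])
  interpret N: real_distribution std_normal_distribution by (rule real_dist_normal_dist)
  have mW[measurable]: "(\<lambda>\<omega>. W \<omega> 1) \<in> borel_measurable M" by (rule std_BM_measurable[OF W]) simp
  have law: "distr M borel (\<lambda>\<omega>. W \<omega> 1) = std_normal_distribution"
    using distributed_distr_eq_density[OF std_BM_marginal[OF W, of 1]] by (simp cong: distr_cong)
  have eq: "prob {\<omega>\<in>space M. W \<omega> 1 \<in> A} = measure std_normal_distribution A" if "A \<in> sets borel" for A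
    unfolding law[symmetric] using that by (simp add: measure_distr vimage_def Int_def conj_commute)
  have neg: "prob {\<omega>\<in>space M. - W \<omega> 1 \<in> A} = measure std_normal_distribution A" if "A \<in> sets borel" for A
    unfolding law[symmetric] std_BM_symmetric[OF W, of 1, simplified, symmetric]
    using that by (simp add: measure_distr vimage_def Int_def conj_commute)
  have "prob {\<omega>\<in>space M. W \<omega> 1 < - a} = prob {\<omega>\<in>space M. - W \<omega> 1 \<in> {a<..}}"
    by (intro arg_cong[where f=prob]) auto
  also have "\<dots> = measure std_normal_distribution {a<..}" by (rule neg) simp
  finally have 1: "prob {\<omega>\<in>space M. W \<omega> 1 < - a} = measure std_normal_distribution {a<..}" .
  have 2: "prob {\<omega>\<in>space M. W \<omega> 1 \<le> - a} = measure std_normal_distribution {..-a}"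
    using eq[of "{..-a}"] by simp
  have "measure std_normal_distribution {-a} \<le> 1 * measure lborel {-a}"
    by (rule std_normal_measure_le) (auto simp: std_normal_density_le_1)
  then have 0: "measure std_normal_distribution {-a} = 0"
    using measure_nonneg[of std_normal_distribution "{-a}"] by (simp del: measure_nonneg)
  have "{-a} \<union> {-a<..a} = {-a..a}" using a by auto
  then have "measure std_normal_distribution {-a..a} = measure std_normal_distribution ({-a} \<union> {-a<..a})" by simp
  also have "\<dots> = measure std_normal_distribution {-a<..a}"
    using 0 by (subst N.finite_measure_Union) auto
  finally have 3: "measure std_normal_distribution {-a..a} = measure std_normal_distribution {-a<..a}" .
  have "({..-a} \<union> {a<..}) \<union> {-a<..a} = (UNIV :: real set)" using a by auto
  then have "1 = measure std_normal_distribution (({..-a} \<union> {a<..}) \<union> {-a<..a})"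
    using N.prob_space by simp
  also have "\<dots> = measure std_normal_distribution ({..-a} \<union> {a<..}) + measure std_normal_distribution {-a<..a}"
    using a by (intro N.finite_measure_Union) auto
  also have "measure std_normal_distribution ({..-a} \<union> {a<..}) = measure std_normal_distribution {..-a} + measure std_normal_distribution {a<..}"
    using a by (intro N.finite_measure_Union) auto
  finally show ?thesis unfolding 1 2 std_normal_cdf2_def 3 by simp
qed

text \<open>As the mesh shrinks the overshoot vanishes, so the grid identity gives the limiting
  probability that some grid value is at most -a. Staying above the barrier at all times is squeezed
  between grid events at slightly different levels, and the Lipschitz bound closes the
  squeeze.\<close>

lemma std_BM_reflection:
  assumes W: "std_BM M W"
  shows "measure M {\<omega>\<in>space M. \<forall>t\<in>{0..1}. - a \<le> W \<omega> t} = std_normal_cdf2 a"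
proof -
  interpret prob_space M by (rule std_BM_prob_space[OF W])
  define q where "q a = prob {\<omega>\<in>space M. \<forall>t\<in>{0..1}. - a \<le> W \<omega> t}" for a
  have sets: "{\<omega>\<in>space M. \<forall>t\<in>{0..1}. c \<le> W \<omega> t} \<in> events" for c
    by (rule std_BM_ge_sets[OF W]) simp
  have mW1[measurable]: "(\<lambda>\<omega>. W \<omega> 1) \<in> borel_measurable M" by (rule std_BM_measurable[OF W]) simp
  define S where "S n k \<omega> = W \<omega> (real k * (1 / real (Suc n)))" for n k \<omega>
  define T where "T b n k \<omega> \<longleftrightarrow> (\<forall>j<k. - b < S n j \<omega>) \<and> S n k \<omega> \<le> - b" for b :: real and n k \<omega>
  have mS[measurable]: "S n k \<in> borel_measurable M" for n k unfolding S_def[abs_def]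
    by (rule std_BM_measurable[OF W]) simp
  have mT[measurable]: "Measurable.pred M (T a n k)" for a n k unfolding T_def[abs_def] by measurable
  have k01: "real k * (1 / real (Suc n)) \<in> {0..1}" if "k \<le> Suc n" for k n using that by simp
  have lim: "(\<lambda>n. prob {\<omega>\<in>space M. \<exists>k\<le>Suc n. S n k \<omega> \<le> - a}) \<longlonglongrightarrow> 1 - std_normal_cdf2 a" if a: "a > 0" for a
  proof -
    define R where "R n = {\<omega>\<in>space M. \<exists>k\<le>Suc n. T a n k \<omega> \<and> W \<omega> 1 < 2 * S n k \<omega> + a}" for n
    have mR: "R n \<in> events" for n unfolding R_def by measurable
    have "(\<lambda>n. \<integral>\<omega>. indicator (R n) \<omega> \<partial>M) \<longlonglongrightarrow> (\<integral>\<omega>. indicator {\<omega>\<in>space M. W \<omega> 1 < - a} \<omega> \<partial>M :: real)"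
    proof (rule bounded_convergence[where B=1, OF finite_measure_axioms])
      fix \<omega> assume \<omega>: "\<omega> \<in> space M"
      show "(\<lambda>n. indicator (R n) \<omega> :: real) \<longlonglongrightarrow> indicator {\<omega>\<in>space M. W \<omega> 1 < - a} \<omega>"
      \<comment> \<open>If W 1 \<ge> -a, membership in \<open>R n\<close> is impossible, since 2 S +
        a \<le> -a at a passage.\<close>
      proof (cases "W \<omega> 1 < - a")
        case False
        then have "\<omega> \<notin> R n" for n by (force simp: R_def T_def)
        then show ?thesis using False by simp
      next
        case True
        \<comment> \<open>Half the distance from the final value to -a: an overshoot smaller than e
          gives 2 S + a > -a - 2 e = W 1. Uniform continuity bounds the overshoot by the last
          increment before passage.\<close>
        define e where "e = (- a - W \<omega> 1) / 2"
        have e: "e > 0" using True by (simp add: e_def)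
        have "continuous_on {0..1} (W \<omega>)"
          by (rule continuous_on_subset[OF std_BM_continuous[OF W \<omega>]]) auto
        from compact_uniformly_continuous[OF this] obtain d where d: "d > 0"
          and dd: "\<And>x y. x \<in> {0..1} \<Longrightarrow> y \<in> {0..1} \<Longrightarrow> dist y x < d \<Longrightarrow> dist (W \<omega> y) (W \<omega> x) < e"
          using e unfolding uniformly_continuous_on_def by (metis compact_Icc)
        from LIMSEQ_D[OF step_tendsto[of 1] d] obtain N where "\<And>n. n \<ge> N \<Longrightarrow> norm (1 / real (Suc n) - 0) < d"
          by blast
        then have N: "\<And>n. n \<ge> N \<Longrightarrow> 1 / real (Suc n) < d" by simp
        have "\<omega> \<in> R n" if n: "n \<ge> N" for n
        proof -
          have SN: "S n (Suc n) \<omega> \<le> - a" using True by (simp add: S_def)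
          define l where "l = (LEAST l. S n l \<omega> \<le> - a)"
          have l1: "S n l \<omega> \<le> - a" unfolding l_def by (rule LeastI[of _ "Suc n"]) (rule SN)
          have l2: "l \<le> Suc n" unfolding l_def by (rule Least_le) (rule SN)
          have l3: "- a < S n j \<omega>" if "j < l" for j using not_less_Least[of j] that unfolding l_def by force
          have "l \<noteq> 0" using l1 a std_BM_zero[OF W \<omega>] by (intro notI) (simp add: S_def)
          then obtain j where j: "l = Suc j" by (cases l) auto
          have "dist (real j * (1 / real (Suc n))) (real l * (1 / real (Suc n))) = 1 / real (Suc n)"
            unfolding j by (simp add: dist_real_def diff_divide_distrib[symmetric])
          then have "dist (S n j \<omega>) (S n l \<omega>) < e"
            unfolding S_def using l2 j N[OF n] by (intro dd k01) auto
          then have "S n l \<omega> > - a - e" using l3[of j] j by (auto simp: dist_real_def)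
          then have "W \<omega> 1 < 2 * S n l \<omega> + a" by (simp add: e_def field_simps)
          then show ?thesis using \<omega> l1 l2 l3 by (auto simp: R_def T_def)
        qed
        then have "eventually (\<lambda>n. indicator (R n) \<omega> = (1::real)) sequentially"
          unfolding eventually_sequentially by (intro exI[of _ N]) simp
        then show ?thesis using True \<omega> by (simp add: tendsto_eventually)
      qed
    qed (use mR in auto)
    then have "(\<lambda>n. prob (R n)) \<longlonglongrightarrow> prob {\<omega>\<in>space M. W \<omega> 1 < - a}" using mR by simp
    then have "(\<lambda>n. prob {\<omega>\<in>space M. W \<omega> 1 \<le> - a} + prob (R n))
       \<longlonglongrightarrow> prob {\<omega>\<in>space M. W \<omega> 1 \<le> - a} + prob {\<omega>\<in>space M. W \<omega> 1 < - a}"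
      by (intro tendsto_intros)
    then show ?thesis
      unfolding std_BM_two_tails[OF W a] R_def S_def T_def std_BM_first_passage[OF W a, symmetric] .
  qed
  \<comment> \<open>A path that goes strictly below -a does so at some grid time once the grid is
    fine enough, so the probability of leaving is at most the grid limit.\<close>
  have lower: "std_normal_cdf2 a \<le> q a" if a: "a > 0" for a
  proof -
    let ?E = "{\<omega>\<in>space M. \<forall>t\<in>{0..1}. - a \<le> W \<omega> t}"
    define E where "E = space M - ?E"
    have mE: "E \<in> events" using sets by (auto simp: E_def)
    let ?A = "\<lambda>n. {\<omega>\<in>space M. \<exists>k\<le>Suc n. S n k \<omega> \<le> - a}"
    have mA: "?A n \<in> events" for n by measurable
    have "(\<lambda>n. \<integral>\<omega>. indicator (E \<inter> ?A n) \<omega> \<partial>M) \<longlonglongrightarrow> (\<integral>\<omega>. indicator E \<omega> \<partial>M :: real)"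
    proof (rule bounded_convergence[where B=1, OF finite_measure_axioms])
      fix \<omega> assume \<omega>: "\<omega> \<in> space M"
      show "(\<lambda>n. indicator (E \<inter> ?A n) \<omega> :: real) \<longlonglongrightarrow> indicator E \<omega>"
      proof (cases "\<omega> \<in> E")
        case True
        then obtain t where t: "t \<in> {0..1}" "W \<omega> t < - a" using \<omega> by (auto simp: E_def not_le)
        have "(\<lambda>n. W \<omega> (rnd (1 / real (Suc n)) t)) \<longlonglongrightarrow> W \<omega> t"
          by (rule rnd_tendsto_continuous[OF _ step_tendsto _ std_BM_continuous[OF W \<omega>]]) (use t in auto)
        then have "eventually (\<lambda>n. W \<omega> (rnd (1 / real (Suc n)) t) < - a) sequentially"
          using t(2) by (rule order_tendstoD)
        then have "eventually (\<lambda>n. indicator (E \<inter> ?A n) \<omega> = (1::real)) sequentially"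
        proof eventually_elim
          case (elim n)
          then have "S n (nat \<lfloor>t / (1 / real (Suc n))\<rfloor>) \<omega> \<le> - a" by (simp add: S_def rnd_def)
          moreover have "nat \<lfloor>t / (1 / real (Suc n))\<rfloor> \<le> Suc n" by (rule rnd_step_index) (use t in auto)
          ultimately have "\<omega> \<in> ?A n" using \<omega> by blast
          with True show ?case by simp
        qed
        then show ?thesis using True by (simp add: tendsto_eventually)
      qed simp
    qed (use mA mE in auto)
    then have "(\<lambda>n. prob (E \<inter> ?A n)) \<longlonglongrightarrow> prob E" using mA mE by simp
    then have "prob E \<le> 1 - std_normal_cdf2 a"
      by (rule LIMSEQ_le[OF _ lim[OF a]]) (use mA in \<open>auto intro!: finite_measure_mono\<close>)
    moreover have "prob E = 1 - q a" unfolding E_def q_def by (rule prob_compl[OF sets])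
    ultimately show ?thesis by simp
  qed
  \<comment> \<open>A grid value at most -a already violates the higher barrier -b. The strict
    inequality is needed because touching -a does not violate the barrier -a itself.\<close>
  have upper: "q b \<le> std_normal_cdf2 a" if a: "a > 0" and b: "b < a" for a b
  proof -
    let ?A = "\<lambda>n. {\<omega>\<in>space M. \<exists>k\<le>Suc n. S n k \<omega> \<le> - a}"
    let ?E = "{\<omega>\<in>space M. \<forall>t\<in>{0..1}. - b \<le> W \<omega> t}"
    have mA: "?A n \<in> events" for n by measurable
    have "?A n \<subseteq> space M - ?E" for n
    proof
      fix \<omega> assume "\<omega> \<in> ?A n"
      then obtain k where k: "k \<le> Suc n" "S n k \<omega> \<le> - a" and \<omega>: "\<omega> \<in> space M" by blast
      from k have "\<not> - b \<le> W \<omega> (real k * (1 / real (Suc n)))" using b by (simp add: S_def)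
      then show "\<omega> \<in> space M - ?E" using k01[OF k(1)] \<omega> by blast
    qed
    then have "prob (?A n) \<le> prob (space M - ?E)" for n
      using sets by (intro finite_measure_mono) auto
    then have "prob (?A n) \<le> 1 - q b" for n unfolding q_def prob_compl[OF sets] .
    then have "1 - std_normal_cdf2 a \<le> 1 - q b"
      by (intro LIMSEQ_le_const2[OF lim[OF a]]) auto
    then show ?thesis by simp
  qed
  have "q a = std_normal_cdf2 a"
  proof (cases "a < 0")
    case True
    then have "{\<omega>\<in>space M. \<forall>t\<in>{0..1}. - a \<le> W \<omega> t} = {}" using std_BM_zero[OF W] by force
    then show ?thesis unfolding q_def using True by (simp only: measure_empty std_normal_cdf2_neg)
  next
    case False
    \<comment> \<open>The increment e / 2 matches the Lipschitz constant 2.\<close>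
    have "q a \<le> std_normal_cdf2 a + e" if "e > 0" for e
    proof -
      have "q a \<le> std_normal_cdf2 (a + e / 2)" using False that by (intro upper) auto
      also have "\<dots> \<le> std_normal_cdf2 a + e" using std_normal_cdf2_lipschitz[of a "a + e / 2"] that by simp
      finally show ?thesis .
    qed
    then have 1: "q a \<le> std_normal_cdf2 a" by (rule field_le_epsilon)
    have "std_normal_cdf2 a \<le> q a"
    proof (cases "a = 0")
      case True
      have "std_normal_cdf2 0 \<le> 0" using std_normal_cdf2_bounds(2)[of 0] by simp
      then show ?thesis using True by (simp add: q_def order_trans[OF _ measure_nonneg])
    qed (use lower False in auto)
    with 1 show ?thesis by simp
  qed
  then show ?thesis by (simp add: q_def)
qed

section \<open>The Brownian meander\<close>

lemma
  assumes "brownian_meander M m"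
  shows brownian_meander_prob_space: "prob_space M"
    and brownian_meander_path_measurable: "(\<lambda>\<omega>. restrict (m \<omega>) {0..1}) \<in> measurable M path01"
    and brownian_meander_continuous: "\<omega> \<in> space M \<Longrightarrow> continuous_on {0..1} (m \<omega>)"
  using assms unfolding brownian_meander_def by auto

lemma brownian_meander_measurable:
  assumes "brownian_meander M m" "t \<in> {0..1}"
  shows "(\<lambda>\<omega>. m \<omega> t) \<in> borel_measurable M"
  using measurable_compose[OF brownian_meander_path_measurable[OF assms(1)]
      measurable_component_singleton[OF assms(2)]] assms(2) by simp

text \<open>The defining limit is taken for the canonical copy of V and its numerators are pulled
  back to P; the reflection principle makes the denominators explicit.\<close>

lemma brownian_meander_limit:
  assumes m: "brownian_meander M m" and V: "std_BM P V"
    and \<Phi>: "\<Phi> \<in> borel_measurable path01" "bounded (range \<Phi>)" "sup_continuous01 \<Phi>"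
  shows "((\<lambda>\<epsilon>. (\<integral>\<omega>. \<Phi> (restrict (V \<omega>) {0..1})
              * indicator {\<omega>\<in>space P. \<forall>t\<in>{0..1}. - \<epsilon> \<le> V \<omega> t} \<omega> \<partial>P) / std_normal_cdf2 \<epsilon>)
          \<longlongrightarrow> (\<integral>\<omega>. \<Phi> (restrict (m \<omega>) {0..1}) \<partial>M)) (at_right 0)"
proof -
  define C :: "(real \<Rightarrow> real) set" where "C = {w \<in> space path_pos. w 0 = 0 \<and> continuous_on {0..} w}"
  define N where "N = distr P (restrict_space path_pos C) (\<lambda>\<omega>. restrict (V \<omega>) {0..})"
  have mR: "(\<lambda>\<omega>. restrict (V \<omega>) {0..}) \<in> measurable P (restrict_space path_pos C)"
    and N: "std_BM N (\<lambda>w. w)"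
    using std_BM_canonical[OF V] unfolding N_def C_def by auto
  have sN: "sets N = sets (restrict_space path_pos C)" "space N = space (restrict_space path_pos C)"
    by (simp_all add: N_def)
  have RN: "restrict (V \<omega>) {0..} \<in> space N" if "\<omega> \<in> space P" for \<omega>
    using measurable_space[OF mR that] sN by simp
  let ?E = "\<lambda>\<epsilon>. {\<omega>\<in>space N. \<forall>t\<in>{0..1}. - \<epsilon> \<le> \<omega> t}"
  have E: "?E \<epsilon> \<in> sets N" for \<epsilon> by (rule std_BM_ge_sets[OF N]) simp
  have mN: "(\<lambda>w. restrict w {0..1}) \<in> measurable N path01"
    by (rule std_BM_path_measurable[OF N]) auto
  have num: "(\<integral>\<omega>. \<Phi> (restrict \<omega> {0..1}) * indicator (?E \<epsilon>) \<omega> \<partial>N)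
      = (\<integral>\<omega>. \<Phi> (restrict (V \<omega>) {0..1}) * indicator {\<omega>\<in>space P. \<forall>t\<in>{0..1}. - \<epsilon> \<le> V \<omega> t} \<omega> \<partial>P)" for \<epsilon>
  proof -
    have "(\<lambda>\<omega>. \<Phi> (restrict \<omega> {0..1}) * indicator (?E \<epsilon>) \<omega>) \<in> borel_measurable N"
      using E measurable_compose[OF mN \<Phi>(1)] by (intro borel_measurable_times) auto
    then have meas: "(\<lambda>\<omega>. \<Phi> (restrict \<omega> {0..1}) * indicator (?E \<epsilon>) \<omega>) \<in> borel_measurable (restrict_space path_pos C)"
      by (subst (asm) measurable_cong_sets[OF sN(1) refl])
    have "(\<integral>\<omega>. \<Phi> (restrict \<omega> {0..1}) * indicator (?E \<epsilon>) \<omega> \<partial>N)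
       = (\<integral>\<omega>. \<Phi> (restrict (restrict (V \<omega>) {0..}) {0..1}) * indicator (?E \<epsilon>) (restrict (V \<omega>) {0..}) \<partial>P)"
      by (subst N_def, rule integral_distr[OF mR meas])
    also have "\<dots> = (\<integral>\<omega>. \<Phi> (restrict (V \<omega>) {0..1}) * indicator {\<omega>\<in>space P. \<forall>t\<in>{0..1}. - \<epsilon> \<le> V \<omega> t} \<omega> \<partial>P)"
    proof (intro Bochner_Integration.integral_cong refl arg_cong2[where f="(*)"] arg_cong[where f=\<Phi>])
      fix \<omega> assume "\<omega> \<in> space P"
      then show "indicator (?E \<epsilon>) (restrict (V \<omega>) {0..}) = (indicator {\<omega>\<in>space P. \<forall>t\<in>{0..1}. - \<epsilon> \<le> V \<omega> t} \<omega> :: real)"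
        using RN by (auto simp: indicator_def)
    qed (auto simp: fun_eq_iff)
    finally show ?thesis .
  qed
  have "((\<lambda>\<epsilon>. (\<integral>\<omega>. \<Phi> (restrict \<omega> {0..1}) * indicator (?E \<epsilon>) \<omega> \<partial>N) / measure N (?E \<epsilon>))
          \<longlongrightarrow> (\<integral>\<omega>. \<Phi> (restrict (m \<omega>) {0..1}) \<partial>M)) (at_right 0)"
    using m N \<Phi> unfolding brownian_meander_def by auto
  then show ?thesis unfolding num std_BM_reflection[OF N] .
qed

text \<open>The negative part at a fixed time, truncated at 1, is an admissible continuous
  functional, and it is at most \<epsilon> on the conditioning event. Its conditional mean is
  therefore at most \<epsilon>, so its mean under the meander is 0. The motion V supplies an
  instance of the defining limit.\<close>

lemma brownian_meander_nonneg:
  assumes m: "brownian_meander M m" and V: "std_BM P V"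
  shows "AE \<omega> in M. \<forall>t\<in>{0..1}. 0 \<le> m \<omega> t"
proof -
  interpret prob_space M by (rule brownian_meander_prob_space[OF m])
  interpret P: prob_space P by (rule std_BM_prob_space[OF V])
  have pt: "AE \<omega> in M. 0 \<le> m \<omega> t" if t: "t \<in> {0..1}" for t
  proof -
    define \<Phi> :: "(real \<Rightarrow> real) \<Rightarrow> real" where "\<Phi> w = min 1 (max 0 (- w t))" for w
    have [measurable]: "(\<lambda>w. w t) \<in> borel_measurable path01" by (rule measurable_component_singleton[OF t])
    have \<Phi>m: "\<Phi> \<in> borel_measurable path01" unfolding \<Phi>_def[abs_def] by measurable
    have \<Phi>b: "bounded (range \<Phi>)" by (rule boundedI[of _ 1]) (auto simp: \<Phi>_def)
    have \<Phi>c: "sup_continuous01 \<Phi>" unfolding sup_continuous01_def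
    proof (intro allI impI)
      fix f :: "real \<Rightarrow> real" and g assume "uniform_limit {0..1} g f sequentially"
      from tendsto_uniform_limitI[OF this t]
      show "(\<lambda>n. \<Phi> (restrict (g n) {0..1})) \<longlonglongrightarrow> \<Phi> (restrict f {0..1})"
        using t by (auto simp: \<Phi>_def intro!: tendsto_intros)
    qed
    let ?E = "\<lambda>\<epsilon>. {\<omega>\<in>space P. \<forall>t\<in>{0..1}. - \<epsilon> \<le> V \<omega> t}"
    have E: "?E \<epsilon> \<in> P.events" for \<epsilon> by (rule std_BM_ge_sets[OF V]) simp
    note lim = brownian_meander_limit[OF m V \<Phi>m \<Phi>b \<Phi>c]
    have "((\<lambda>\<epsilon>. (\<integral>\<omega>. \<Phi> (restrict (V \<omega>) {0..1}) * indicator (?E \<epsilon>) \<omega> \<partial>P) / std_normal_cdf2 \<epsilon>) \<longlongrightarrow> 0) (at_right 0)"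
    proof (rule tendsto_sandwich[of "\<lambda>_. 0" _ _ "\<lambda>\<epsilon>. \<epsilon>"])
      have le: "(\<integral>\<omega>. \<Phi> (restrict (V \<omega>) {0..1}) * indicator (?E \<epsilon>) \<omega> \<partial>P) / std_normal_cdf2 \<epsilon> \<le> \<epsilon>"
        if e: "0 < \<epsilon>" for \<epsilon>
      proof -
        have "(\<integral>\<omega>. \<Phi> (restrict (V \<omega>) {0..1}) * indicator (?E \<epsilon>) \<omega> \<partial>P) \<le> (\<integral>\<omega>. \<epsilon> * indicator (?E \<epsilon>) \<omega> \<partial>P)"
        proof (rule integral_mono')
          show "integrable P (\<lambda>\<omega>. \<epsilon> * indicator (?E \<epsilon>) \<omega>)"
            using E by (intro integrable_mult_right) (simp add: P.emeasure_eq_measure)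
          show "\<Phi> (restrict (V \<omega>) {0..1}) * indicator (?E \<epsilon>) \<omega> \<le> \<epsilon> * indicator (?E \<epsilon>) \<omega>" for \<omega>
            using t e by (force simp: \<Phi>_def indicator_def)
        qed (use e in \<open>auto simp: indicator_def\<close>)
        also have "\<dots> = \<epsilon> * std_normal_cdf2 \<epsilon>"
          using E by (simp add: std_BM_reflection[OF V])
        finally have le: "(\<integral>\<omega>. \<Phi> (restrict (V \<omega>) {0..1}) * indicator (?E \<epsilon>) \<omega> \<partial>P) \<le> \<epsilon> * std_normal_cdf2 \<epsilon>" .
        have "0 \<le> std_normal_cdf2 \<epsilon>" by (simp add: std_normal_cdf2_def)
        then show ?thesis using le e by (cases "std_normal_cdf2 \<epsilon> = 0") (auto simp: divide_le_eq)
      qed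
      then show "\<forall>\<^sub>F \<epsilon> in at_right 0. (\<integral>\<omega>. \<Phi> (restrict (V \<omega>) {0..1}) * indicator (?E \<epsilon>) \<omega> \<partial>P) / std_normal_cdf2 \<epsilon> \<le> \<epsilon>"
        by (auto simp: eventually_at_right_field intro!: exI[of _ 1])
      have "0 \<le> (\<integral>\<omega>. \<Phi> (restrict (V \<omega>) {0..1}) * indicator (?E \<epsilon>) \<omega> \<partial>P)" for \<epsilon>
        by (intro integral_nonneg_AE) (auto simp: \<Phi>_def indicator_def)
      moreover have "0 \<le> std_normal_cdf2 \<epsilon>" for \<epsilon> by (simp add: std_normal_cdf2_def)
      ultimately show "\<forall>\<^sub>F \<epsilon> in at_right 0. 0 \<le> (\<integral>\<omega>. \<Phi> (restrict (V \<omega>) {0..1}) * indicator (?E \<epsilon>) \<omega> \<partial>P) / std_normal_cdf2 \<epsilon>"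
        by (intro always_eventually allI divide_nonneg_nonneg)
    qed (auto intro: tendsto_ident_at)
    from tendsto_unique[OF _ this lim]
    have "(\<integral>\<omega>. \<Phi> (restrict (m \<omega>) {0..1}) \<partial>M) = 0" by simp
    moreover have "integrable M (\<lambda>\<omega>. \<Phi> (restrict (m \<omega>) {0..1}))"
      using measurable_compose[OF brownian_meander_path_measurable[OF m] \<Phi>m]
      by (intro integrable_const_bound[where B=1]) (auto simp: \<Phi>_def)
    ultimately have "AE \<omega> in M. \<Phi> (restrict (m \<omega>) {0..1}) = 0"
      by (subst (asm) integral_nonneg_eq_0_iff_AE) (auto simp: \<Phi>_def)
    then show ?thesis by eventually_elim (use t in \<open>auto simp: \<Phi>_def\<close>)
  qed
  \<comment> \<open>Countably many grid times share one null set, and continuity extends the sign to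
    all times.\<close>
  have "AE \<omega> in M. \<forall>n. \<forall>k\<in>{..Suc n}. 0 \<le> m \<omega> (real k * (1 / real (Suc n)))"
    by (subst AE_all_countable, intro allI AE_finite_allI pt) auto
  with AE_space show ?thesis
    by eventually_elim (use continuous_ge_iff_grid[OF brownian_meander_continuous[OF m]] in auto)
qed

text \<open>Freezing the first variable: independence makes the joint law a product, and boundedness
  permits Fubini.\<close>

lemma (in prob_space) indep_var_integral_pair:
  fixes f :: "'c \<times> 'c \<Rightarrow> real"
  assumes XY: "indep_var S X T Y" and f[measurable]: "f \<in> borel_measurable (S \<Otimes>\<^sub>M T)" and b: "\<And>z. \<bar>f z\<bar> \<le> B"
  shows "(\<integral>\<omega>. f (X \<omega>, Y \<omega>) \<partial>M) = (\<integral>\<omega>. (\<integral>\<omega>'. f (X \<omega>, Y \<omega>') \<partial>M) \<partial>M)"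
proof -
  have [measurable]: "X \<in> measurable M S" "Y \<in> measurable M T"
    using indep_var_rv1[OF XY] indep_var_rv2[OF XY] by auto
  interpret X: prob_space "distr M S X" by (rule prob_space_distr) simp
  interpret Y: prob_space "distr M T Y" by (rule prob_space_distr) simp
  interpret XY: pair_prob_space "distr M S X" "distr M T Y" ..
  have "(\<integral>\<omega>. f (X \<omega>, Y \<omega>) \<partial>M) = (\<integral>z. f z \<partial>distr M (S \<Otimes>\<^sub>M T) (\<lambda>\<omega>. (X \<omega>, Y \<omega>)))"
    by (subst integral_distr) auto
  also have "distr M (S \<Otimes>\<^sub>M T) (\<lambda>\<omega>. (X \<omega>, Y \<omega>)) = distr M S X \<Otimes>\<^sub>M distr M T Y"
    using XY unfolding indep_var_distribution_eq by simp
  also have "(\<integral>z. f z \<partial>(distr M S X \<Otimes>\<^sub>M distr M T Y)) = (\<integral>x. (\<integral>y. f (x, y) \<partial>distr M T Y) \<partial>distr M S X)"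
    using b by (intro XY.integral_fst'[symmetric] XY.P.integrable_const_bound[where B=B]) auto
  also have "\<dots> = (\<integral>\<omega>. (\<integral>y. f (X \<omega>, y) \<partial>distr M T Y) \<partial>M)"
    by (subst integral_distr) auto
  also have "\<dots> = (\<integral>\<omega>. (\<integral>\<omega>'. f (X \<omega>, Y \<omega>') \<partial>M) \<partial>M)"
    by (intro Bochner_Integration.integral_cong refl, subst integral_distr)
       (auto intro!: measurable_compose[OF measurable_Pair1' f] dest: measurable_space[OF \<open>X \<in> measurable M S\<close>])
  finally show ?thesis .
qed

text \<open>Brownian scaling stretches [0,1/2] to [0,1] and multiplies the level by sqrt 2.\<close>

lemma std_BM_ge_half:
  assumes W: "std_BM M W"
  shows "measure M {\<omega>\<in>space M. \<forall>t\<in>{0..1/2}. - a \<le> W \<omega> t} = std_normal_cdf2 (sqrt 2 * a)"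
proof -
  have "{\<omega>\<in>space M. \<forall>t\<in>{0..1/2}. - a \<le> W \<omega> t} = {\<omega>\<in>space M. \<forall>t\<in>{0..1}. - (sqrt 2 * a) \<le> sqrt 2 * W \<omega> (t / 2)}"
  proof -
    have "(\<forall>t\<in>{0..1/2}. - a \<le> W \<omega> t) \<longleftrightarrow> (\<forall>t\<in>{0..1}. - (sqrt 2 * a) \<le> sqrt 2 * W \<omega> (t / 2))" for \<omega>
    proof -
      have "- (sqrt 2 * a) \<le> sqrt 2 * W \<omega> s \<longleftrightarrow> - a \<le> W \<omega> s" for s
        using mult_le_cancel_left_pos[of "sqrt 2" "- a" "W \<omega> s"] by simp
      moreover have "(\<forall>t\<in>{0..1/2}. - a \<le> W \<omega> t) \<longleftrightarrow> (\<forall>t\<in>{0..1}. - a \<le> W \<omega> (t / 2))"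
      proof
        assume *: "\<forall>t\<in>{0..1}. - a \<le> W \<omega> (t / 2)"
        show "\<forall>t\<in>{0..1/2}. - a \<le> W \<omega> t"
        proof
          fix t :: real assume "t \<in> {0..1/2}"
          then show "- a \<le> W \<omega> t" using bspec[OF *, of "2 * t"] by simp
        qed
      qed auto
      ultimately show ?thesis by simp
    qed
    then show ?thesis by simp
  qed
  also have "measure M \<dots> = std_normal_cdf2 (sqrt 2 * a)"
    by (rule std_BM_reflection[OF std_BM_scale[OF W]]) simp
  finally show ?thesis .
qed

section \<open>Integrating out the second half of the path\<close>

lemma abs_diff_le_1:
  fixes x y :: real
  assumes "0 \<le> x" "x \<le> 1" "0 \<le> y" "y \<le> 1"
  shows "\<bar>x - y\<bar> \<le> 1"
  using assms by (simp add: abs_le_iff)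

text \<open>The transition kernel of the second half: the motion starts from x at time 1/2, is
  killed below -\<epsilon> up to time 1, and is tested at the times in K. The argument
  \<open>t - 1/2\<close> restarts the clock at time 1/2.\<close>

definition stay_exp :: "'a measure \<Rightarrow> ('a \<Rightarrow> real \<Rightarrow> real) \<Rightarrow> real set \<Rightarrow> (real \<Rightarrow> real \<Rightarrow> real) \<Rightarrow> real \<Rightarrow> real \<Rightarrow> real"
  where "stay_exp M B K \<phi> \<epsilon> x =
    (\<integral>\<omega>. (\<Prod>t\<in>K. \<phi> t (x + B \<omega> (t - 1/2))) * indicator {\<omega>\<in>space M. \<forall>s\<in>{0..1/2}. - \<epsilon> \<le> x + B \<omega> s} \<omega> \<partial>M)"

locale half_test =
  fixes M :: "'a measure" and B and K :: "real set" and \<phi> :: "real \<Rightarrow> real \<Rightarrow> real"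
  assumes B: "std_BM M B" and K: "finite K" "K \<subseteq> {1/2<..}"
    and c: "\<And>t. continuous_on UNIV (\<phi> t)" and b: "\<And>t x. 0 \<le> \<phi> t x \<and> \<phi> t x \<le> 1"
begin

interpretation prob_space M by (rule std_BM_prob_space[OF B])

definition "P x \<omega> = (\<Prod>t\<in>K. \<phi> t (x + B \<omega> (t - 1/2)))"
definition "E e x = {\<omega>\<in>space M. \<forall>s\<in>{0..1/2}. - e \<le> x + B \<omega> s}"

lemma stay_exp_eq: "stay_exp M B K \<phi> e x = (\<integral>\<omega>. P x \<omega> * indicator (E e x) \<omega> \<partial>M)"
  by (simp add: stay_exp_def P_def E_def)

lemma P_bounds: "0 \<le> P x \<omega>" "P x \<omega> \<le> 1"
  unfolding P_def using b by (auto intro!: prod_nonneg prod_le_1)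

lemma P_meas: "P x \<in> borel_measurable M"
proof -
  have "\<phi> t \<in> borel_measurable borel" for t using c by (auto intro: borel_measurable_continuous_onI)
  then show ?thesis
    unfolding P_def[abs_def] using K
    by (intro borel_measurable_prod measurable_compose[OF borel_measurable_add[OF borel_measurable_const std_BM_measurable[OF B]]])
       force+
qed

lemma E_eq: "E e x = {\<omega>\<in>space M. \<forall>s\<in>{0..1/2}. - (x + e) \<le> B \<omega> s}"
proof -
  have "- e \<le> x + y \<longleftrightarrow> - (x + e) \<le> y" for y by linarith
  then show ?thesis unfolding E_def by simp
qed

lemma E_sets: "E e x \<in> sets M" unfolding E_eq by (rule std_BM_ge_sets[OF B]) simp

lemma prob_E: "prob (E e x) = std_normal_cdf2 (sqrt 2 * (x + e))"
  unfolding E_eq by (rule std_BM_ge_half[OF B])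

lemma E_mono: "x + e \<le> y + d \<Longrightarrow> E e x \<subseteq> E d y" unfolding E_eq by force

lemma integrable_PE: "integrable M (\<lambda>\<omega>. P x \<omega> * indicator (E e y) \<omega>)"
  using P_bounds P_meas E_sets
  by (intro integrable_const_bound[where B=1]) (auto simp: abs_mult mult_le_one)

lemma stay_exp_bounds: "0 \<le> stay_exp M B K \<phi> e x" "stay_exp M B K \<phi> e x \<le> 1"
proof -
  show "0 \<le> stay_exp M B K \<phi> e x" unfolding stay_exp_eq
    by (intro integral_nonneg_AE) (auto simp: P_bounds)
  have "stay_exp M B K \<phi> e x \<le> (\<integral>\<omega>. 1 \<partial>M)" unfolding stay_exp_eq
    by (intro integral_mono integrable_PE) (auto simp: P_bounds mult_le_one)
  then show "stay_exp M B K \<phi> e x \<le> 1" by (simp add: prob_space)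
qed

text \<open>The events are nested, so the integrand is at most the difference of their indicators,
  whose mean is an increment of \<open>std_normal_cdf2\<close>. The factor sqrt 2 is the scaling of
  levels on [0,1/2].\<close>

lemma indicator_diff:
  assumes "x + e \<le> y + d"
  shows "(\<integral>\<omega>. \<bar>P z \<omega> * indicator (E d y) \<omega> - P z \<omega> * indicator (E e x) \<omega>\<bar> \<partial>M) \<le> 2 * sqrt 2 * (y + d - (x + e))"
proof -
  have "(\<integral>\<omega>. \<bar>P z \<omega> * indicator (E d y) \<omega> - P z \<omega> * indicator (E e x) \<omega>\<bar> \<partial>M)
      \<le> (\<integral>\<omega>. indicator (E d y) \<omega> - indicator (E e x) \<omega> \<partial>M)"
  proof (intro integral_mono integrable_abs Bochner_Integration.integrable_diff integrable_PE)
    show "\<bar>P z \<omega> * indicator (E d y) \<omega> - P z \<omega> * indicator (E e x) \<omega>\<bar> \<le> indicator (E d y) \<omega> - indicator (E e x) \<omega>" for \<omega>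
      using E_mono[OF assms] P_bounds[of z \<omega>] by (auto simp: indicator_def)
  qed (use E_sets in \<open>auto simp: emeasure_eq_measure\<close>)
  also have "\<dots> = prob (E d y) - prob (E e x)"
    using E_sets by (subst Bochner_Integration.integral_diff) (auto simp: emeasure_eq_measure)
  also have "\<dots> \<le> 2 * (sqrt 2 * (y + d) - sqrt 2 * (x + e))"
    unfolding prob_E using assms by (intro std_normal_cdf2_lipschitz) (simp add: mult_left_mono)
  finally show ?thesis by (simp add: algebra_simps)
qed

text \<open>The bound is uniform in the starting point x, which allows the moving barrier to be
  replaced by 0 inside an integral over the value at time 1/2.\<close>

lemma stay_exp_close:
  assumes "e \<ge> 0"
  shows "\<bar>stay_exp M B K \<phi> e x - stay_exp M B K \<phi> 0 x\<bar> \<le> 2 * sqrt 2 * e"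
proof -
  have "\<bar>stay_exp M B K \<phi> e x - stay_exp M B K \<phi> 0 x\<bar>
      = \<bar>\<integral>\<omega>. P x \<omega> * indicator (E e x) \<omega> - P x \<omega> * indicator (E 0 x) \<omega> \<partial>M\<bar>"
    unfolding stay_exp_eq by (subst Bochner_Integration.integral_diff) (auto intro: integrable_PE)
  also have "\<dots> \<le> (\<integral>\<omega>. \<bar>P x \<omega> * indicator (E e x) \<omega> - P x \<omega> * indicator (E 0 x) \<omega>\<bar> \<partial>M)"
    by (rule integral_abs_bound)
  also have "\<dots> \<le> 2 * sqrt 2 * e" using indicator_diff[of x 0 x e x] assms by simp
  finally show ?thesis .
qed

text \<open>For a fixed path the barrier indicator jumps in x, but its mean does not, because the
  minimum has a Lipschitz distribution function. The tests are handled by bounded convergence. This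
  continuity makes the kernel usable inside a functional for the weak limit.\<close>

lemma stay_exp_tendsto:
  assumes x: "X \<longlonglongrightarrow> x"
  shows "(\<lambda>n. stay_exp M B K \<phi> e (X n)) \<longlonglongrightarrow> stay_exp M B K \<phi> e x"
proof -
  have "(\<lambda>n. \<integral>\<omega>. \<bar>P (X n) \<omega> - P x \<omega>\<bar> \<partial>M) \<longlonglongrightarrow> (\<integral>\<omega>. 0 \<partial>M)"
  proof (rule bounded_convergence[where B=1, OF finite_measure_axioms])
    fix \<omega>
    have "(\<lambda>n. P (X n) \<omega>) \<longlonglongrightarrow> P x \<omega>" unfolding P_def
      by (intro tendsto_prod continuous_on_tendsto_compose[OF c] tendsto_add x tendsto_const) auto
    then show "(\<lambda>n. \<bar>P (X n) \<omega> - P x \<omega>\<bar>) \<longlonglongrightarrow> 0"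
      using Lim_null tendsto_rabs_zero by blast
    show "\<bar>\<bar>P (X n) \<omega> - P x \<omega>\<bar>\<bar> \<le> 1" for n
      unfolding abs_idempotent by (intro abs_diff_le_1 P_bounds)
  qed (use P_meas in auto)
  then have 1: "(\<lambda>n. \<integral>\<omega>. \<bar>P (X n) \<omega> - P x \<omega>\<bar> \<partial>M) \<longlonglongrightarrow> 0" by simp
  have 2: "(\<lambda>n. 2 * sqrt 2 * \<bar>X n - x\<bar>) \<longlonglongrightarrow> 0"
    using tendsto_mult_left[OF tendsto_rabs_zero[OF LIM_zero[OF x]], of "2 * sqrt 2"] by simp
  have bound: "\<bar>stay_exp M B K \<phi> e y - stay_exp M B K \<phi> e x\<bar> \<le> (\<integral>\<omega>. \<bar>P y \<omega> - P x \<omega>\<bar> \<partial>M) + 2 * sqrt 2 * \<bar>y - x\<bar>" for y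
  proof -
    have iP: "integrable M (P z)" for z
      using P_bounds P_meas by (intro integrable_const_bound[where B=1]) auto
    have ind: "(\<integral>\<omega>. \<bar>P x \<omega> * indicator (E e y) \<omega> - P x \<omega> * indicator (E e x) \<omega>\<bar> \<partial>M) \<le> 2 * sqrt 2 * \<bar>y - x\<bar>"
    proof (cases "x \<le> y")
      case True then show ?thesis using indicator_diff[of x e y e x] by simp
    next
      case False then show ?thesis using indicator_diff[of y e x e x] by (simp add: abs_minus_commute)
    qed
    have "\<bar>stay_exp M B K \<phi> e y - stay_exp M B K \<phi> e x\<bar>
      = \<bar>\<integral>\<omega>. P y \<omega> * indicator (E e y) \<omega> - P x \<omega> * indicator (E e x) \<omega> \<partial>M\<bar>"
      unfolding stay_exp_eq by (subst Bochner_Integration.integral_diff) (auto intro: integrable_PE)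
    also have "\<dots> \<le> (\<integral>\<omega>. \<bar>P y \<omega> * indicator (E e y) \<omega> - P x \<omega> * indicator (E e x) \<omega>\<bar> \<partial>M)"
      by (rule integral_abs_bound)
    \<comment> \<open>Inserting the tests at x with the barrier at y separates the two
      effects.\<close>
    also have "\<dots> \<le> (\<integral>\<omega>. \<bar>P y \<omega> - P x \<omega>\<bar> + \<bar>P x \<omega> * indicator (E e y) \<omega> - P x \<omega> * indicator (E e x) \<omega>\<bar> \<partial>M)"
      by (intro integral_mono integrable_abs Bochner_Integration.integrable_diff integrable_PE
          Bochner_Integration.integrable_add iP) (auto simp: indicator_def)
    also have "\<dots> = (\<integral>\<omega>. \<bar>P y \<omega> - P x \<omega>\<bar> \<partial>M) + (\<integral>\<omega>. \<bar>P x \<omega> * indicator (E e y) \<omega> - P x \<omega> * indicator (E e x) \<omega>\<bar> \<partial>M)"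
      by (intro Bochner_Integration.integral_add integrable_abs Bochner_Integration.integrable_diff integrable_PE iP)
    also note ind
    finally show ?thesis by simp
  qed
  have "(\<lambda>n. stay_exp M B K \<phi> e (X n) - stay_exp M B K \<phi> e x) \<longlonglongrightarrow> 0"
    by (rule tendsto_0_le[OF tendsto_add_zero[OF 1 2], of _ 1]) (use bound in \<open>auto intro!: always_eventually order_trans[OF bound]\<close>)
  then show ?thesis by (rule LIM_zero_cancel)
qed

lemma stay_exp_continuous: "continuous_on UNIV (stay_exp M B K \<phi> e)"
  by (auto simp: continuous_on_sequentially o_def intro: stay_exp_tendsto)

end

text \<open>The grid form of the barrier turns the integrand into a measurable functional of the
  path, to which uniqueness of the Brownian law applies. The kernel may thus be computed with any
  Brownian motion.\<close>

lemma std_BM_stay_law: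
  assumes V: "std_BM M V" and B: "std_BM N B" and K: "finite K" "K \<subseteq> {1/2<..}"
    and c: "\<And>t. continuous_on UNIV (\<phi> t)"
  shows "stay_exp M V K \<phi> e x = (\<integral>\<omega>. (\<Prod>t\<in>K. \<phi> t (x + B \<omega> (t - 1/2))) * of_bool (grid_ge (1/2) (- e) (\<lambda>s. x + B \<omega> s)) \<partial>N)"
proof -
  define \<Psi> where "\<Psi> v = (\<Prod>t\<in>K. \<phi> t (x + v (t - 1/2))) * of_bool (grid_ge (1/2) (- e) (\<lambda>s. x + v s))"
    for v :: "real \<Rightarrow> real"
  have m\<phi>: "\<phi> t \<in> borel_measurable borel" for t using c by (auto intro: borel_measurable_continuous_onI)
  have comp: "(\<lambda>v. v t) \<in> borel_measurable path_pos" if "t \<ge> 0" for t :: real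
    using that by (intro measurable_component_singleton) auto
  have [measurable]: "Measurable.pred path_pos (\<lambda>v. grid_ge (1/2) (- e) (\<lambda>s. x + v s))"
    by (intro grid_ge_measurable borel_measurable_add borel_measurable_const comp) auto
  have [measurable]: "(\<lambda>v. \<Prod>t\<in>K. \<phi> t (x + v (t - 1/2))) \<in> borel_measurable path_pos"
    using K by (intro borel_measurable_prod measurable_compose[OF borel_measurable_add[OF borel_measurable_const comp] m\<phi>]) force
  have \<Psi>: "\<Psi> \<in> borel_measurable path_pos" unfolding \<Psi>_def[abs_def] by measurable
  have restr: "\<Psi> (restrict v {0..}) = \<Psi> v" for v
  proof -
    have "grid_ge (1/2) (- e) (\<lambda>s. x + restrict v {0..} s) = grid_ge (1/2) (- e) (\<lambda>s. x + v s)"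
      by (rule grid_ge_cong) auto
    moreover have "(\<Prod>t\<in>K. \<phi> t (x + restrict v {0..} (t - 1/2))) = (\<Prod>t\<in>K. \<phi> t (x + v (t - 1/2)))"
      using K by (intro prod.cong) force+
    ultimately show ?thesis by (simp add: \<Psi>_def)
  qed
  have "stay_exp M V K \<phi> e x = (\<integral>\<omega>. \<Psi> (restrict (V \<omega>) {0..}) \<partial>M)"
    unfolding stay_exp_def restr
  proof (intro Bochner_Integration.integral_cong refl)
    fix \<omega> assume \<omega>: "\<omega> \<in> space M"
    have "continuous_on {0..1/2} (\<lambda>s. x + V \<omega> s)"
      by (intro continuous_intros continuous_on_subset[OF std_BM_continuous[OF V \<omega>]]) auto
    then show "(\<Prod>t\<in>K. \<phi> t (x + V \<omega> (t - 1/2))) * indicator {\<omega>\<in>space M. \<forall>s\<in>{0..1/2}. - e \<le> x + V \<omega> s} \<omega> = \<Psi> (V \<omega>)"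
      using \<omega> by (simp add: \<Psi>_def grid_ge_iff indicator_def)
  qed
  also have "\<dots> = (\<integral>\<omega>. \<Psi> (restrict (B \<omega>) {0..}) \<partial>N)"
    by (rule std_BM_law_unique[OF V B order_refl \<Psi>])
  also have "\<dots> = (\<integral>\<omega>. \<Psi> (B \<omega>) \<partial>N)" unfolding restr ..
  finally show ?thesis unfolding \<Psi>_def .
qed

text \<open>Freeze X and integrate over the independent motion V. The kernel is stated with another
  motion B because V will be the increments after time 1/2, while the kernel should be written with
  the original motion.\<close>

lemma indep_stay_exp:
  fixes X :: "'a \<Rightarrow> real \<Rightarrow> real"
  assumes V: "std_BM M V" and B: "std_BM M B" and K: "finite K" "K \<subseteq> {1/2<..}"
    and c: "\<And>t. continuous_on UNIV (\<phi> t)" and b: "\<And>t x. 0 \<le> \<phi> t x \<and> \<phi> t x \<le> 1"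
    and ind: "prob_space.indep_var M S X path_pos (\<lambda>\<omega>. restrict (V \<omega>) {0..})"
    and a: "a \<in> borel_measurable S" "\<And>z. \<bar>a z\<bar> \<le> 1" and x: "x \<in> borel_measurable S"
  shows "(\<integral>\<omega>. a (X \<omega>) * ((\<Prod>t\<in>K. \<phi> t (x (X \<omega>) + V \<omega> (t - 1/2)))
            * indicator {\<omega>\<in>space M. \<forall>s\<in>{0..1/2}. - e \<le> x (X \<omega>) + V \<omega> s} \<omega>) \<partial>M)
       = (\<integral>\<omega>. a (X \<omega>) * stay_exp M B K \<phi> e (x (X \<omega>)) \<partial>M)"
proof -
  interpret prob_space M by (rule std_BM_prob_space[OF V])
  have m\<phi>[measurable]: "\<phi> t \<in> borel_measurable borel" for t using c by (auto intro: borel_measurable_continuous_onI)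
  note [measurable] = a(1) x
  define f where "f z = a (fst z) * ((\<Prod>t\<in>K. \<phi> t (x (fst z) + snd z (t - 1/2)))
      * of_bool (grid_ge (1/2) (- e) (\<lambda>s. x (fst z) + snd z s)))" for z :: "(real \<Rightarrow> real) \<times> (real \<Rightarrow> real)"
  have comp: "(\<lambda>z. snd z t) \<in> borel_measurable (S \<Otimes>\<^sub>M path_pos)" if "t \<ge> 0" for t :: real
    using that by (intro measurable_compose[OF measurable_snd measurable_component_singleton]) auto
  have xm: "(\<lambda>z. x (fst z)) \<in> borel_measurable (S \<Otimes>\<^sub>M path_pos)" by measurable
  have [measurable]: "Measurable.pred (S \<Otimes>\<^sub>M path_pos) (\<lambda>z. grid_ge (1/2) (- e) (\<lambda>s. x (fst z) + snd z s))"
    by (intro grid_ge_measurable borel_measurable_add xm comp) auto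
  have [measurable]: "(\<lambda>z. \<Prod>t\<in>K. \<phi> t (x (fst z) + snd z (t - 1/2))) \<in> borel_measurable (S \<Otimes>\<^sub>M path_pos)"
    using K by (intro borel_measurable_prod measurable_compose[OF borel_measurable_add[OF xm comp] m\<phi>]) force
  have fm: "f \<in> borel_measurable (S \<Otimes>\<^sub>M path_pos)" unfolding f_def[abs_def] by measurable
  have "0 \<le> (\<Prod>t\<in>K. \<phi> t (y t))" "(\<Prod>t\<in>K. \<phi> t (y t)) \<le> 1" for y using b by (auto intro!: prod_nonneg prod_le_1)
  then have fb: "\<bar>f z\<bar> \<le> 1" for z
    using a(2)[of "fst z"] unfolding f_def abs_mult by (intro mult_le_one) auto
  have restr: "f (w, restrict v {0..}) = f (w, v)" for w v
  proof -
    have "grid_ge (1/2) (- e) (\<lambda>s. x w + restrict v {0..} s) = grid_ge (1/2) (- e) (\<lambda>s. x w + v s)"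
      by (rule grid_ge_cong) auto
    moreover have "(\<Prod>t\<in>K. \<phi> t (x w + restrict v {0..} (t - 1/2))) = (\<Prod>t\<in>K. \<phi> t (x w + v (t - 1/2)))"
      using K by (intro prod.cong) force+
    ultimately show ?thesis by (simp add: f_def)
  qed
  have "(\<integral>\<omega>. a (X \<omega>) * ((\<Prod>t\<in>K. \<phi> t (x (X \<omega>) + V \<omega> (t - 1/2)))
            * indicator {\<omega>\<in>space M. \<forall>s\<in>{0..1/2}. - e \<le> x (X \<omega>) + V \<omega> s} \<omega>) \<partial>M)
      = (\<integral>\<omega>. f (X \<omega>, restrict (V \<omega>) {0..}) \<partial>M)"
    unfolding restr
  proof (intro Bochner_Integration.integral_cong refl)
    fix \<omega> assume \<omega>: "\<omega> \<in> space M"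
    have "continuous_on {0..1/2} (\<lambda>s. x (X \<omega>) + V \<omega> s)"
      by (intro continuous_intros continuous_on_subset[OF std_BM_continuous[OF V \<omega>]]) auto
    then show "a (X \<omega>) * ((\<Prod>t\<in>K. \<phi> t (x (X \<omega>) + V \<omega> (t - 1/2)))
            * indicator {\<omega>\<in>space M. \<forall>s\<in>{0..1/2}. - e \<le> x (X \<omega>) + V \<omega> s} \<omega>) = f (X \<omega>, V \<omega>)"
      using \<omega> by (simp add: f_def grid_ge_iff indicator_def)
  qed
  also have "\<dots> = (\<integral>\<omega>. (\<integral>\<omega>'. f (X \<omega>, restrict (V \<omega>') {0..}) \<partial>M) \<partial>M)"
    by (rule indep_var_integral_pair[OF ind fm fb])
  also have "(\<lambda>\<omega>. \<integral>\<omega>'. f (X \<omega>, restrict (V \<omega>') {0..}) \<partial>M) = (\<lambda>\<omega>. a (X \<omega>) * stay_exp M B K \<phi> e (x (X \<omega>)))"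
    unfolding restr std_BM_stay_law[OF B V K c] by (simp add: f_def fun_eq_iff)
  finally show ?thesis .
qed

section \<open>Splitting at time 1/2 and comparing two weak limits\<close>

lemma ball_split_half:
  "(\<forall>t\<in>{0..1}. P t) \<longleftrightarrow> (\<forall>t\<in>{0..1/2}. P t) \<and> (\<forall>s\<in>{0..1/2::real}. P (1/2 + s))"
proof (intro iffI conjI)
  assume *: "(\<forall>t\<in>{0..1/2}. P t) \<and> (\<forall>s\<in>{0..1/2::real}. P (1/2 + s))"
  show "\<forall>t\<in>{0..1}. P t"
  proof
    fix t :: real assume "t \<in> {0..1}"
    then show "P t" using * bspec[OF conjunct2[OF *], of "t - 1/2"] by (cases "t \<le> 1/2") auto
  qed
qed auto

lemma prod_split_half:
  fixes J :: "real set"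
  assumes "finite J"
  shows "(\<Prod>t\<in>J. f t) = (\<Prod>t\<in>J \<inter> {..1/2}. f t) * (\<Prod>t\<in>J \<inter> {1/2<..}. (f t :: real))"
  using assms by (subst prod.union_disjoint[symmetric]) (auto intro!: prod.cong)

text \<open>The Markov property at time 1/2: tests and barrier up to 1/2 depend on the past, and
  everything later is absorbed by the kernel at the current value.\<close>

lemma std_BM_split_half:
  assumes B: "std_BM M B" and J: "finite J" "J \<subseteq> {0..1}"
    and c: "\<And>t. continuous_on UNIV (\<phi> t)" and b: "\<And>t x. 0 \<le> \<phi> t x \<and> \<phi> t x \<le> 1"
  shows "(\<integral>\<omega>. (\<Prod>t\<in>J. \<phi> t (B \<omega> t)) * indicator {\<omega>\<in>space M. \<forall>t\<in>{0..1}. - e \<le> B \<omega> t} \<omega> \<partial>M)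
    = (\<integral>\<omega>. ((\<Prod>t\<in>J \<inter> {..1/2}. \<phi> t (B \<omega> t)) * indicator {\<omega>\<in>space M. \<forall>t\<in>{0..1/2}. - e \<le> B \<omega> t} \<omega>)
          * stay_exp M B (J \<inter> {1/2<..}) \<phi> e (B \<omega> (1/2)) \<partial>M)"
proof -
  interpret prob_space M by (rule std_BM_prob_space[OF B])
  have m\<phi>: "\<phi> t \<in> borel_measurable borel" for t using c by (auto intro: borel_measurable_continuous_onI)
  let ?S = "borel_paths {0..1/2}"
  define V where "V \<omega> t = B \<omega> (1/2 + t) - B \<omega> (1/2)" for \<omega> t
  have V: "std_BM M V" unfolding V_def[abs_def] by (rule std_BM_shift[OF B]) simp
  have ind: "indep_var ?S (\<lambda>\<omega>. restrict (B \<omega>) {0..1/2}) path_pos (\<lambda>\<omega>. restrict (V \<omega>) {0..})"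
    unfolding V_def[abs_def] by (rule std_BM_markov[OF B]) simp
  define a where "a w = (\<Prod>t\<in>J \<inter> {..1/2}. \<phi> t (w t)) * of_bool (grid_ge (1/2) (- e) w)" for w :: "real \<Rightarrow> real"
  have comp: "(\<lambda>w. w t) \<in> borel_measurable ?S" if "t \<in> {0..1/2}" for t
    using that by (intro measurable_component_singleton) auto
  have [measurable]: "Measurable.pred ?S (\<lambda>v. grid_ge (1/2) (- e) v)"
    by (intro grid_ge_measurable comp) auto
  have [measurable]: "(\<lambda>w. \<Prod>t\<in>J \<inter> {..1/2}. \<phi> t (w t)) \<in> borel_measurable ?S"
    using J by (intro borel_measurable_prod measurable_compose[OF comp m\<phi>]) auto
  have am: "a \<in> borel_measurable ?S" unfolding a_def[abs_def] by measurable
  have ab: "\<bar>a z\<bar> \<le> 1" for z unfolding a_def abs_mult using b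
    by (intro mult_le_one) (auto simp: abs_prod intro!: prod_le_1)
  have a_eq: "a (restrict (B \<omega>) {0..1/2}) = (\<Prod>t\<in>J \<inter> {..1/2}. \<phi> t (B \<omega> t)) * indicator {\<omega>\<in>space M. \<forall>t\<in>{0..1/2}. - e \<le> B \<omega> t} \<omega>"
    if \<omega>: "\<omega> \<in> space M" for \<omega>
  proof -
    have "continuous_on {0..1/2} (B \<omega>)"
      by (rule continuous_on_subset[OF std_BM_continuous[OF B \<omega>]]) auto
    moreover have "grid_ge (1/2) (- e) (restrict (B \<omega>) {0..1/2}) = grid_ge (1/2) (- e) (B \<omega>)"
      by (rule grid_ge_cong) auto
    moreover have "(\<Prod>t\<in>J \<inter> {..1/2}. \<phi> t (restrict (B \<omega>) {0..1/2} t)) = (\<Prod>t\<in>J \<inter> {..1/2}. \<phi> t (B \<omega> t))"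
      using J by (intro prod.cong) auto
    ultimately show ?thesis using \<omega> by (simp add: a_def grid_ge_iff indicator_def)
  qed
  have "(\<integral>\<omega>. (\<Prod>t\<in>J. \<phi> t (B \<omega> t)) * indicator {\<omega>\<in>space M. \<forall>t\<in>{0..1}. - e \<le> B \<omega> t} \<omega> \<partial>M)
   = (\<integral>\<omega>. a (restrict (B \<omega>) {0..1/2}) * ((\<Prod>t\<in>J \<inter> {1/2<..}. \<phi> t (restrict (B \<omega>) {0..1/2} (1/2) + V \<omega> (t - 1/2)))
            * indicator {\<omega>\<in>space M. \<forall>s\<in>{0..1/2}. - e \<le> restrict (B \<omega>) {0..1/2} (1/2) + V \<omega> s} \<omega>) \<partial>M)"
  proof (intro Bochner_Integration.integral_cong refl)
    fix \<omega> assume \<omega>: "\<omega> \<in> space M"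
    have "restrict (B \<omega>) {0..1/2} (1/2) + V \<omega> s = B \<omega> (1/2 + s)" for s by (simp add: V_def)
    then show "(\<Prod>t\<in>J. \<phi> t (B \<omega> t)) * indicator {\<omega>\<in>space M. \<forall>t\<in>{0..1}. - e \<le> B \<omega> t} \<omega>
      = a (restrict (B \<omega>) {0..1/2}) * ((\<Prod>t\<in>J \<inter> {1/2<..}. \<phi> t (restrict (B \<omega>) {0..1/2} (1/2) + V \<omega> (t - 1/2)))
            * indicator {\<omega>\<in>space M. \<forall>s\<in>{0..1/2}. - e \<le> restrict (B \<omega>) {0..1/2} (1/2) + V \<omega> s} \<omega>)"
      unfolding a_eq[OF \<omega>] prod_split_half[OF J(1)]
      using ball_split_half[of "\<lambda>t. - e \<le> B \<omega> t"] by (simp add: indicator_def)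
  qed
  also have "\<dots> = (\<integral>\<omega>. a (restrict (B \<omega>) {0..1/2}) * stay_exp M B (J \<inter> {1/2<..}) \<phi> e (restrict (B \<omega>) {0..1/2} (1/2)) \<partial>M)"
    by (rule indep_stay_exp[OF V B _ _ c b ind am ab, where x="\<lambda>w. w (1/2)"]) (use J comp in auto)
  also have "\<dots> = (\<integral>\<omega>. ((\<Prod>t\<in>J \<inter> {..1/2}. \<phi> t (B \<omega> t)) * indicator {\<omega>\<in>space M. \<forall>t\<in>{0..1/2}. - e \<le> B \<omega> t} \<omega>)
          * stay_exp M B (J \<inter> {1/2<..}) \<phi> e (B \<omega> (1/2)) \<partial>M)"
    by (intro Bochner_Integration.integral_cong refl) (simp add: a_eq)
  finally show ?thesis .
qed

text \<open>Counterpart for u, with the scaled meander as past and the independent B as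
  continuation. The barrier is 0 and acts only on the second half; nonnegativity of the first half
  comes later from that of the meander.\<close>

lemma u_proc_split_half:
  assumes m: "brownian_meander M m" and B: "std_BM M B"
    and ind: "prob_space.indep_var M path01 (\<lambda>\<omega>. restrict (m \<omega>) {0..1}) path_pos (\<lambda>\<omega>. restrict (B \<omega>) {0..})"
    and J: "finite J" "J \<subseteq> {0..1}"
    and c: "\<And>t. continuous_on UNIV (\<phi> t)" and b: "\<And>t x. 0 \<le> \<phi> t x \<and> \<phi> t x \<le> 1"
  shows "(\<integral>\<omega>. indicator {\<omega>\<in>space M. \<forall>s\<in>{0..1/2}. 0 \<le> u_proc m B \<omega> (1/2 + s)} \<omega> * (\<Prod>t\<in>J. \<phi> t (u_proc m B \<omega> t)) \<partial>M)
    = (\<integral>\<omega>. (\<Prod>t\<in>J \<inter> {..1/2}. \<phi> t (m \<omega> (2 * t) / sqrt 2)) * stay_exp M B (J \<inter> {1/2<..}) \<phi> 0 (m \<omega> 1 / sqrt 2) \<partial>M)"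
proof -
  interpret prob_space M by (rule std_BM_prob_space[OF B])
  have m\<phi>: "\<phi> t \<in> borel_measurable borel" for t using c by (auto intro: borel_measurable_continuous_onI)
  define a where "a w = (\<Prod>t\<in>J \<inter> {..1/2}. \<phi> t (w (2 * t) / sqrt 2))" for w :: "real \<Rightarrow> real"
  define x where "x w = w 1 / sqrt 2" for w :: "real \<Rightarrow> real"
  have comp: "(\<lambda>w. w t / sqrt 2) \<in> borel_measurable path01" if "t \<in> {0..1}" for t
    using measurable_component_singleton[OF that, of "\<lambda>_. borel :: real measure"] by measurable
  have am: "a \<in> borel_measurable path01" unfolding a_def[abs_def]
    using J by (intro borel_measurable_prod measurable_compose[OF comp m\<phi>]) auto
  have ab: "\<bar>a z\<bar> \<le> 1" for z unfolding a_def using b by (auto simp: abs_prod intro!: prod_le_1)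
  have xm: "x \<in> borel_measurable path01" unfolding x_def[abs_def] by (rule comp) simp
  have a_eq: "a (restrict (m \<omega>) {0..1}) = (\<Prod>t\<in>J \<inter> {..1/2}. \<phi> t (m \<omega> (2 * t) / sqrt 2))" for \<omega>
    unfolding a_def using J by (intro prod.cong) auto
  have x_eq: "x (restrict (m \<omega>) {0..1}) = m \<omega> 1 / sqrt 2" for \<omega> by (simp add: x_def)
  have "(\<integral>\<omega>. indicator {\<omega>\<in>space M. \<forall>s\<in>{0..1/2}. 0 \<le> u_proc m B \<omega> (1/2 + s)} \<omega> * (\<Prod>t\<in>J. \<phi> t (u_proc m B \<omega> t)) \<partial>M)
   = (\<integral>\<omega>. a (restrict (m \<omega>) {0..1}) * ((\<Prod>t\<in>J \<inter> {1/2<..}. \<phi> t (x (restrict (m \<omega>) {0..1}) + B \<omega> (t - 1/2)))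
            * indicator {\<omega>\<in>space M. \<forall>s\<in>{0..1/2}. - 0 \<le> x (restrict (m \<omega>) {0..1}) + B \<omega> s} \<omega>) \<partial>M)"
  proof (intro Bochner_Integration.integral_cong refl)
    fix \<omega> assume \<omega>: "\<omega> \<in> space M"
    have u: "u_proc m B \<omega> (1/2 + s) = m \<omega> 1 / sqrt 2 + B \<omega> s" if "s \<in> {0..1/2}" for s
      using that std_BM_zero[OF B \<omega>] by (auto simp: u_proc_def)
    have "(\<Prod>t\<in>J \<inter> {..1/2}. \<phi> t (u_proc m B \<omega> t)) = a (restrict (m \<omega>) {0..1})"
      unfolding a_eq by (intro prod.cong) (auto simp: u_proc_def)
    moreover have "(\<Prod>t\<in>J \<inter> {1/2<..}. \<phi> t (u_proc m B \<omega> t)) = (\<Prod>t\<in>J \<inter> {1/2<..}. \<phi> t (m \<omega> 1 / sqrt 2 + B \<omega> (t - 1/2)))"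
      by (intro prod.cong) (auto simp: u_proc_def)
    ultimately show "indicator {\<omega>\<in>space M. \<forall>s\<in>{0..1/2}. 0 \<le> u_proc m B \<omega> (1/2 + s)} \<omega> * (\<Prod>t\<in>J. \<phi> t (u_proc m B \<omega> t))
      = a (restrict (m \<omega>) {0..1}) * ((\<Prod>t\<in>J \<inter> {1/2<..}. \<phi> t (x (restrict (m \<omega>) {0..1}) + B \<omega> (t - 1/2)))
            * indicator {\<omega>\<in>space M. \<forall>s\<in>{0..1/2}. - 0 \<le> x (restrict (m \<omega>) {0..1}) + B \<omega> s} \<omega>)"
      unfolding prod_split_half[OF J(1)] x_eq using u by (simp add: indicator_def)
  qed
  also have "\<dots> = (\<integral>\<omega>. a (restrict (m \<omega>) {0..1}) * stay_exp M B (J \<inter> {1/2<..}) \<phi> 0 (x (restrict (m \<omega>) {0..1})) \<partial>M)"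
    by (rule indep_stay_exp[OF B B _ _ c b ind am ab xm]) (use J in auto)
  finally show ?thesis unfolding a_eq x_eq .
qed

lemma filterlim_scale_at_right_0: "a > 0 \<Longrightarrow> filterlim (\<lambda>x::real. a * x) (at_right 0) (at_right 0)"
  by (rule filterlim_times_pos[OF filterlim_ident]) auto

text \<open>Two instances of the weak limit are compared. Conditioning B on all of [0,1] gives the
  meander itself; conditioning only on [0,1/2] gives the scaled meander, followed by the kernel with
  barrier 0. The numerators differ by the kernel's change between the barriers -e and 0, and the
  denominators have ratio tending to sqrt 2.\<close>

lemma meander_test_decomposition:
  assumes m: "brownian_meander M m" and B: "std_BM M B"
    and ind: "prob_space.indep_var M path01 (\<lambda>\<omega>. restrict (m \<omega>) {0..1}) path_pos (\<lambda>\<omega>. restrict (B \<omega>) {0..})"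
    and J: "finite J" "J \<subseteq> {0..1}"
    and c: "\<And>t. continuous_on UNIV (\<phi> t)" and b: "\<And>t x. 0 \<le> \<phi> t x \<and> \<phi> t x \<le> 1"
  shows "(\<integral>\<omega>. (\<Prod>t\<in>J. \<phi> t (m \<omega> t)) \<partial>M)
    = sqrt 2 * (\<integral>\<omega>. indicator {\<omega>\<in>space M. \<forall>s\<in>{0..1/2}. 0 \<le> u_proc m B \<omega> (1/2 + s)} \<omega> * (\<Prod>t\<in>J. \<phi> t (u_proc m B \<omega> t)) \<partial>M)"
proof -
  interpret prob_space M by (rule std_BM_prob_space[OF B])
  let ?K = "J \<inter> {1/2<..}" and ?p = std_normal_cdf2
  interpret half_test M B ?K \<phi> by standard (use B J c b in auto)
  define H where "H e = stay_exp M B ?K \<phi> e" for e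
  have m\<phi>: "\<phi> t \<in> borel_measurable borel" for t using c by (auto intro: borel_measurable_continuous_onI)
  have cH: "continuous_on UNIV (H 0)" unfolding H_def by (rule stay_exp_continuous)
  have mH: "H e \<in> borel_measurable borel" for e
    unfolding H_def by (intro borel_measurable_continuous_onI stay_exp_continuous)
  have Hb: "0 \<le> H e x" "H e x \<le> 1" for e x unfolding H_def by (rule stay_exp_bounds)+
  have \<phi>b: "\<bar>\<Prod>t\<in>A. \<phi> t (y t)\<bar> \<le> 1" for A y using b by (auto simp: abs_prod intro!: prod_le_1)
  \<comment> \<open>For this motion, staying above -(sqrt 2 * e) on [0,1] means that B stays above
    -e on [0,1/2].\<close>
  define V where "V \<omega> t = sqrt 2 * B \<omega> (t / 2)" for \<omega> t
  have V: "std_BM M V" unfolding V_def[abs_def] by (rule std_BM_scale[OF B]) simp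
  let ?E = "\<lambda>e. {\<omega>\<in>space M. \<forall>t\<in>{0..1}. - e \<le> B \<omega> t}"
  let ?E' = "\<lambda>e. {\<omega>\<in>space M. \<forall>t\<in>{0..1/2}. - e \<le> B \<omega> t}"
  have EV: "{\<omega>\<in>space M. \<forall>t\<in>{0..1}. - (sqrt 2 * e) \<le> V \<omega> t} = ?E' e" for e
  proof -
    have *: "- (sqrt 2 * e) \<le> sqrt 2 * y \<longleftrightarrow> - e \<le> y" for y
      using mult_le_cancel_left_pos[of "sqrt 2" "- e" y] by simp
    have "(\<forall>t\<in>{0..1}. - e \<le> B \<omega> (t / 2)) \<longleftrightarrow> (\<forall>t\<in>{0..1/2}. - e \<le> B \<omega> t)" for \<omega>
    proof
      assume *: "\<forall>t\<in>{0..1}. - e \<le> B \<omega> (t / 2)"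
      show "\<forall>t\<in>{0..1/2}. - e \<le> B \<omega> t"
      proof
        fix t :: real assume "t \<in> {0..1/2}"
        then show "- e \<le> B \<omega> t" using bspec[OF *, of "2 * t"] by simp
      qed
    qed auto
    then show ?thesis by (simp add: V_def *)
  qed
  have E's: "?E' e \<in> sets M" for e by (rule std_BM_ge_sets[OF B]) simp
  have pE': "prob (?E' e) = ?p (sqrt 2 * e)" for e by (rule std_BM_ge_half[OF B])
  define F where "F \<omega> = (\<Prod>t\<in>J \<inter> {..1/2}. \<phi> t (B \<omega> t))" for \<omega>
  have F01: "0 \<le> F \<omega>" "F \<omega> \<le> 1" for \<omega> unfolding F_def using b by (auto intro!: prod_nonneg prod_le_1)
  have mF: "F \<in> borel_measurable M" unfolding F_def[abs_def]
    using J by (intro borel_measurable_prod measurable_compose[OF std_BM_measurable[OF B] m\<phi>]) auto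
  have mB: "(\<lambda>\<omega>. B \<omega> (1/2)) \<in> borel_measurable M" by (rule std_BM_measurable[OF B]) simp
  let ?D = "\<lambda>e e'. \<integral>\<omega>. F \<omega> * indicator (?E' e) \<omega> * H e' (B \<omega> (1/2)) \<partial>M"
  \<comment> \<open>Here the kernel has the same barrier -e as the first half, since B is
    conditioned on the whole interval.\<close>
  have lim1: "((\<lambda>e. ?D e e / ?p e)
      \<longlongrightarrow> (\<integral>\<omega>. (\<Prod>t\<in>J. \<phi> t (m \<omega> t)) \<partial>M)) (at_right 0)"
  proof -
    define \<Phi> where "\<Phi> w = (\<Prod>t\<in>J. \<phi> t (w t))" for w :: "real \<Rightarrow> real"
    have \<Phi>r: "\<Phi> (restrict w {0..1}) = \<Phi> w" for w unfolding \<Phi>_def using J by (intro prod.cong) auto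
    have comp: "(\<lambda>w. w t) \<in> borel_measurable path01" if "t \<in> {0..1}" for t :: real
      using that by (intro measurable_component_singleton) auto
    have 1: "\<Phi> \<in> borel_measurable path01" unfolding \<Phi>_def[abs_def] using J
      by (intro borel_measurable_prod measurable_compose[OF comp m\<phi>]) auto
    have 2: "bounded (range \<Phi>)" by (rule boundedI[of _ 1]) (auto simp: \<Phi>_def \<phi>b)
    have 3: "sup_continuous01 \<Phi>" unfolding sup_continuous01_def \<Phi>r
    proof (intro allI impI)
      fix f :: "real \<Rightarrow> real" and g assume u: "uniform_limit {0..1} g f sequentially"
      show "(\<lambda>n. \<Phi> (g n)) \<longlonglongrightarrow> \<Phi> f" unfolding \<Phi>_def
        using J by (intro tendsto_prod continuous_on_tendsto_compose[OF c] tendsto_uniform_limitI[OF u]) auto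
    qed
    show ?thesis
      using brownian_meander_limit[OF m B 1 2 3]
      unfolding \<Phi>r unfolding \<Phi>_def std_BM_split_half[OF B J c b] F_def H_def .
  qed
  define L where "L = (\<integral>\<omega>. (\<Prod>t\<in>J \<inter> {..1/2}. \<phi> t (m \<omega> (2 * t) / sqrt 2)) * H 0 (m \<omega> 1 / sqrt 2) \<partial>M)"
  \<comment> \<open>Here the kernel has the fixed barrier 0, so that the functional does not vary
    with e; its continuity is what the weak limit requires.\<close>
  have lim2: "((\<lambda>e. ?D e 0 / ?p (sqrt 2 * e)) \<longlongrightarrow> L) (at_right 0)"
  proof -
    define \<Phi> where "\<Phi> w = (\<Prod>t\<in>J \<inter> {..1/2}. \<phi> t (w (2 * t) / sqrt 2)) * H 0 (w 1 / sqrt 2)" for w :: "real \<Rightarrow> real"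
    have \<Phi>r: "\<Phi> (restrict w {0..1}) = \<Phi> w" for w
    proof -
      have "(\<Prod>t\<in>J \<inter> {..1/2}. \<phi> t (restrict w {0..1} (2 * t) / sqrt 2)) = (\<Prod>t\<in>J \<inter> {..1/2}. \<phi> t (w (2 * t) / sqrt 2))"
        using J by (intro prod.cong) auto
      then show ?thesis by (simp add: \<Phi>_def)
    qed
    have comp: "(\<lambda>w. w t / sqrt 2) \<in> borel_measurable path01" if "t \<in> {0..1}" for t
      using measurable_component_singleton[OF that, of "\<lambda>_. borel :: real measure"] by measurable
    have 1: "\<Phi> \<in> borel_measurable path01" unfolding \<Phi>_def[abs_def] using J
      by (intro borel_measurable_times borel_measurable_prod measurable_compose[OF comp m\<phi>] measurable_compose[OF comp mH]) auto
    have 2: "bounded (range \<Phi>)"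
    proof (rule boundedI[of _ 1])
      fix y assume "y \<in> range \<Phi>"
      then show "norm y \<le> 1" using Hb \<phi>b by (auto simp: \<Phi>_def abs_mult intro!: mult_le_one)
    qed
    have 3: "sup_continuous01 \<Phi>" unfolding sup_continuous01_def \<Phi>r
    proof (intro allI impI)
      fix f :: "real \<Rightarrow> real" and g assume u: "uniform_limit {0..1} g f sequentially"
      show "(\<lambda>n. \<Phi> (g n)) \<longlonglongrightarrow> \<Phi> f" unfolding \<Phi>_def
        using J by (intro tendsto_mult tendsto_prod continuous_on_tendsto_compose[OF c] tendsto_divide tendsto_const
           continuous_on_tendsto_compose[OF cH] tendsto_uniform_limitI[OF u]) auto
    qed
    have \<Phi>V: "\<Phi> (V \<omega>) = F \<omega> * H 0 (B \<omega> (1/2))" for \<omega> by (simp add: \<Phi>_def V_def F_def)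
    from filterlim_compose[OF brownian_meander_limit[OF m V 1 2 3] filterlim_scale_at_right_0[of "sqrt 2"]]
    show ?thesis unfolding \<Phi>r EV \<Phi>V unfolding \<Phi>_def L_def by (simp add: mult_ac)
  qed
  have "((\<lambda>e. ?D e e / ?p e) \<longlongrightarrow> L * sqrt 2) (at_right 0)"
  proof -
    have ppos: "?p e > 0" if "e > 0" for e
    proof -
      have "0 < 2 * e * std_normal_density e" using that by (simp add: std_normal_density_def)
      then show ?thesis using std_normal_cdf2_bounds(1)[of e] that by linarith
    qed
    have lim3: "((\<lambda>e. ?D e 0 / ?p (sqrt 2 * e) * (?p (sqrt 2 * e) / ?p e)) \<longlongrightarrow> L * sqrt 2) (at_right 0)"
      by (intro tendsto_mult lim2 std_normal_cdf2_ratio)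
    have "((\<lambda>e. 2 * sqrt 2 * e * (?p (sqrt 2 * e) / ?p e)) \<longlongrightarrow> 2 * sqrt 2 * 0 * sqrt 2) (at_right 0)"
      by (intro tendsto_mult std_normal_cdf2_ratio tendsto_const) (auto intro: tendsto_ident_at)
    then have lim4: "((\<lambda>e. 2 * sqrt 2 * e * (?p (sqrt 2 * e) / ?p e)) \<longlongrightarrow> 0) (at_right 0)" by simp
    have "((\<lambda>e. ?D e e / ?p e
        - ?D e 0 / ?p (sqrt 2 * e) * (?p (sqrt 2 * e) / ?p e)) \<longlongrightarrow> 0) (at_right 0)"
    proof (rule tendsto_0_le[OF lim4, of _ 1])
      have "norm (?D e e / ?p e
        - ?D e 0 / ?p (sqrt 2 * e) * (?p (sqrt 2 * e) / ?p e))
        \<le> norm (2 * sqrt 2 * e * (?p (sqrt 2 * e) / ?p e)) * 1" if e: "0 < e" for e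
      proof -
        let ?f = "\<lambda>e' \<omega>. F \<omega> * indicator (?E' e) \<omega> * H e' (B \<omega> (1/2))"
        have pp: "?p e > 0" "?p (sqrt 2 * e) > 0" using e by (auto intro: ppos)
        have int: "integrable M (?f e)" "integrable M (?f 0)"
        proof -
          have "norm (?f e' \<omega>) \<le> 1" for e' \<omega>
            using F01[of \<omega>] Hb[of e' "B \<omega> (1/2)"] by (auto simp: indicator_def abs_mult intro!: mult_le_one)
          then show "integrable M (?f e)" "integrable M (?f 0)"
            using mF measurable_compose[OF mB mH] E's by (auto intro!: integrable_const_bound[where B=1])
        qed
        have "\<bar>(\<integral>\<omega>. ?f e \<omega> \<partial>M) - (\<integral>\<omega>. ?f 0 \<omega> \<partial>M)\<bar> = \<bar>\<integral>\<omega>. ?f e \<omega> - ?f 0 \<omega> \<partial>M\<bar>"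
          using int by (subst Bochner_Integration.integral_diff) auto
        also have "\<dots> \<le> (\<integral>\<omega>. \<bar>?f e \<omega> - ?f 0 \<omega>\<bar> \<partial>M)" by (rule integral_abs_bound)
        \<comment> \<open>Keeping the indicator of the first half matters: e / \<open>?p e\<close>
          alone does not tend to 0, but the extra mass \<open>?p (sqrt 2 * e)\<close> is comparable
          to \<open>?p e\<close> and leaves a factor e.\<close>
        also have "\<dots> \<le> (\<integral>\<omega>. 2 * sqrt 2 * e * indicator (?E' e) \<omega> \<partial>M)"
        proof (rule integral_mono)
          fix \<omega>
          have "\<bar>?f e \<omega> - ?f 0 \<omega>\<bar> = F \<omega> * indicator (?E' e) \<omega> * \<bar>H e (B \<omega> (1/2)) - H 0 (B \<omega> (1/2))\<bar>"
            using F01[of \<omega>] by (simp add: right_diff_distrib[symmetric] abs_mult)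
          also have "\<dots> \<le> 1 * indicator (?E' e) \<omega> * (2 * sqrt 2 * e)"
            using stay_exp_close[of e] e F01[of \<omega>] unfolding H_def by (intro mult_mono) auto
          finally show "\<bar>?f e \<omega> - ?f 0 \<omega>\<bar> \<le> 2 * sqrt 2 * e * indicator (?E' e) \<omega>"
            by (simp only: mult_1 mult.commute[of "indicator (?E' e) \<omega>"])
        qed (use int E's in \<open>auto simp: emeasure_eq_measure intro!: integrable_mult_right\<close>)
        also have "\<dots> = 2 * sqrt 2 * e * ?p (sqrt 2 * e)" using E's by (simp add: pE')
        finally have *: "\<bar>(\<integral>\<omega>. ?f e \<omega> \<partial>M) - (\<integral>\<omega>. ?f 0 \<omega> \<partial>M)\<bar> \<le> 2 * sqrt 2 * e * ?p (sqrt 2 * e)" .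
        have "norm ((\<integral>\<omega>. ?f e \<omega> \<partial>M) / ?p e - (\<integral>\<omega>. ?f 0 \<omega> \<partial>M) / ?p (sqrt 2 * e) * (?p (sqrt 2 * e) / ?p e))
          = \<bar>(\<integral>\<omega>. ?f e \<omega> \<partial>M) - (\<integral>\<omega>. ?f 0 \<omega> \<partial>M)\<bar> / ?p e"
          using pp by (simp add: diff_divide_distrib[symmetric])
        also have "\<dots> \<le> (2 * sqrt 2 * e * ?p (sqrt 2 * e)) / ?p e"
          using * pp by (intro divide_right_mono) auto
        also have "\<dots> = norm (2 * sqrt 2 * e * (?p (sqrt 2 * e) / ?p e)) * 1"
          using e pp by simp
        finally show ?thesis .
      qed
      then show "\<forall>\<^sub>F e in at_right 0. norm (?D e e / ?p e
        - ?D e 0 / ?p (sqrt 2 * e) * (?p (sqrt 2 * e) / ?p e))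
        \<le> norm (2 * sqrt 2 * e * (?p (sqrt 2 * e) / ?p e)) * 1"
        unfolding eventually_at_right_field by (intro exI[of _ 1]) auto
    qed
    from tendsto_add[OF this lim3] show ?thesis by simp
  qed
  from tendsto_unique[OF _ lim1 this]
  have "(\<integral>\<omega>. (\<Prod>t\<in>J. \<phi> t (m \<omega> t)) \<partial>M) = sqrt 2 * L" by simp
  also have "L = (\<integral>\<omega>. indicator {\<omega>\<in>space M. \<forall>s\<in>{0..1/2}. 0 \<le> u_proc m B \<omega> (1/2 + s)} \<omega> * (\<Prod>t\<in>J. \<phi> t (u_proc m B \<omega> t)) \<partial>M)"
    unfolding L_def H_def u_proc_split_half[OF m B ind J c b] ..
  finally show ?thesis .
qed

section \<open>The law of the meander expressed through u\<close>

lemma u_proc_measurable: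
  assumes m: "brownian_meander M m" and B: "std_BM M B" and t: "t \<in> {0..1}"
  shows "(\<lambda>\<omega>. u_proc m B \<omega> t) \<in> borel_measurable M"
proof (cases "t \<le> 1/2")
  case True
  then have "(\<lambda>\<omega>. m \<omega> (2 * t)) \<in> borel_measurable M"
    using t by (intro brownian_meander_measurable[OF m]) auto
  then show ?thesis using True by (simp add: u_proc_def)
next
  case False
  then have "(\<lambda>\<omega>. m \<omega> 1) \<in> borel_measurable M" "(\<lambda>\<omega>. B \<omega> (t - 1/2)) \<in> borel_measurable M"
    using t by (auto intro!: brownian_meander_measurable[OF m] std_BM_measurable[OF B])
  then show ?thesis using False by (simp add: u_proc_def)
qed

lemma u_proc_continuous:
  assumes m: "continuous_on {0..1} (m \<omega>)" and B: "continuous_on {0..} (B \<omega>)" "B \<omega> 0 = 0"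
  shows "continuous_on {0..1} (u_proc m B \<omega>)"
proof -
  have "continuous_on {t\<in>{0..1}. t \<le> 1/2} (\<lambda>t. m \<omega> (2 * t) / sqrt 2)"
    by (intro continuous_intros continuous_on_compose2[OF m]) auto
  moreover have "continuous_on {t\<in>{0..1}. 1/2 \<le> t} (\<lambda>t. m \<omega> 1 / sqrt 2 + B \<omega> (t - 1/2))"
    by (intro continuous_intros continuous_on_compose2[OF B(1)]) auto
  ultimately show ?thesis
    unfolding u_proc_def[abs_def]
  proof (rule continuous_on_cases_le)
    fix t :: real assume t: "t = 1/2"
    show "m \<omega> (2 * t) / sqrt 2 = m \<omega> 1 / sqrt 2 + B \<omega> (t - 1/2)" unfolding t using B(2) by simp
  qed (auto intro: continuous_intros)
qed

text \<open>The identity for test products extends to all measurable functionals, with sqrt 2 times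
  the barrier indicator as weight on the side of u.\<close>

lemma meander_law:
  assumes m: "brownian_meander M m" and B: "std_BM M B"
    and ind: "prob_space.indep_var M path01 (\<lambda>\<omega>. restrict (m \<omega>) {0..1}) path_pos (\<lambda>\<omega>. restrict (B \<omega>) {0..})"
    and \<Psi>: "\<Psi> \<in> borel_measurable path01"
  shows "(\<integral>\<omega>. \<Psi> (restrict (m \<omega>) {0..1}) \<partial>M)
    = sqrt 2 * (\<integral>\<omega>. indicator {\<omega>\<in>space M. \<forall>t\<in>{0..1}. 0 \<le> u_proc m B \<omega> t} \<omega> * \<Psi> (restrict (u_proc m B \<omega>) {0..1}) \<partial>M)"
proof -
  interpret prob_space M by (rule std_BM_prob_space[OF B])
  let ?u = "u_proc m B"
  let ?G = "{\<omega>\<in>space M. \<forall>s\<in>{0..1/2}. 0 \<le> ?u \<omega> (1/2 + s)}"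
  let ?G1 = "{\<omega>\<in>space M. \<forall>t\<in>{0..1}. 0 \<le> ?u \<omega> t}"
  have uc: "continuous_on {0..1} (?u \<omega>)" if "\<omega> \<in> space M" for \<omega>
    by (intro u_proc_continuous brownian_meander_continuous[OF m that] std_BM_continuous[OF B that] std_BM_zero[OF B that])
  have G: "?G \<in> sets M"
    by (rule sets_path_ge)
       (auto intro!: u_proc_measurable[OF m B] continuous_on_compose2[OF uc] continuous_intros)
  have G1: "?G1 \<in> sets M"
    by (rule sets_path_ge) (auto intro!: u_proc_measurable[OF m B] uc)
  have mu: "(\<lambda>\<omega>. restrict (?u \<omega>) {0..1}) \<in> measurable M path01"
    by (intro measurable_restrict u_proc_measurable[OF m B])
  have m\<Psi>: "(\<lambda>\<omega>. \<Psi> (restrict (?u \<omega>) {0..1})) \<in> borel_measurable M" by (rule measurable_compose[OF mu \<Psi>])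
  have "(\<integral>\<omega>. 1 * \<Psi> (restrict (m \<omega>) {0..1}) \<partial>M) = (\<integral>\<omega>. (sqrt 2 * indicator ?G \<omega>) * \<Psi> (restrict (?u \<omega>) {0..1}) \<partial>M)"
  proof (rule integral_eq_of_test_functions[OF brownian_meander_path_measurable[OF m] mu _ _ _ _ _ \<Psi>])
    fix J :: "real set" and \<phi> :: "real \<Rightarrow> real \<Rightarrow> real"
    assume J: "finite J" "J \<subseteq> {0..1}" "\<And>i. continuous_on UNIV (\<phi> i)" "\<And>i x. 0 \<le> \<phi> i x \<and> \<phi> i x \<le> 1"
    have *: "(\<Prod>i\<in>J. \<phi> i (restrict w {0..1} i)) = (\<Prod>i\<in>J. \<phi> i (w i))" for w
      using J(2) by (intro prod.cong) auto
    show "(\<integral>\<omega>. 1 * (\<Prod>i\<in>J. \<phi> i (restrict (m \<omega>) {0..1} i)) \<partial>M)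
      = (\<integral>\<omega>. (sqrt 2 * indicator ?G \<omega>) * (\<Prod>i\<in>J. \<phi> i (restrict (?u \<omega>) {0..1} i)) \<partial>M)"
      unfolding * mult_1 mult.assoc using meander_test_decomposition[OF m B ind J] by simp
  qed (use G in \<open>auto simp: emeasure_eq_measure intro!: integrable_mult_right\<close>)
  \<comment> \<open>Almost surely the meander, hence u on [0,1/2], is nonnegative, so the barrier on
    the second half alone is the barrier on [0,1].\<close>
  also have "\<dots> = (\<integral>\<omega>. sqrt 2 * (indicator ?G1 \<omega> * \<Psi> (restrict (?u \<omega>) {0..1})) \<partial>M)"
  proof (rule integral_cong_AE)
    show "AE \<omega> in M. sqrt 2 * indicator ?G \<omega> * \<Psi> (restrict (?u \<omega>) {0..1})
      = sqrt 2 * (indicator ?G1 \<omega> * \<Psi> (restrict (?u \<omega>) {0..1}))"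
      using brownian_meander_nonneg[OF m B] AE_space
    proof eventually_elim
      case (elim \<omega>)
      have "\<forall>t\<in>{0..1/2}. 0 \<le> ?u \<omega> t" using elim(1) by (auto simp: u_proc_def)
      then have "\<omega> \<in> ?G \<longleftrightarrow> \<omega> \<in> ?G1" using ball_split_half[of "\<lambda>t. 0 \<le> ?u \<omega> t"] by simp
      then show ?case by (simp only: indicator_def mult.assoc)
    qed
  qed (use G G1 m\<Psi> in auto)
  finally show ?thesis by simp
qed

section \<open>Translating Gaussian measures\<close>

lemma distr_normal_shift:
  assumes \<sigma>: "\<sigma> > 0"
  defines "N \<equiv> density lborel (\<lambda>x. ennreal (normal_density 0 \<sigma> x))"
  shows "distr N borel (\<lambda>x. x + b) = density N (\<lambda>x. ennreal (exp (b * x / \<sigma>\<^sup>2 - b\<^sup>2 / (2 * \<sigma>\<^sup>2))))"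
proof (rule measure_eqI)
  fix A assume "A \<in> sets (distr N borel (\<lambda>x. x + b))"
  then have A[measurable]: "A \<in> sets borel" by (simp add: N_def)
  have dens: "normal_density 0 \<sigma> (x - b) = normal_density 0 \<sigma> x * exp (b * x / \<sigma>\<^sup>2 - b\<^sup>2 / (2 * \<sigma>\<^sup>2))" for x
  proof -
    have "- (x - b)\<^sup>2 / (2 * \<sigma>\<^sup>2) = - x\<^sup>2 / (2 * \<sigma>\<^sup>2) + (b * x / \<sigma>\<^sup>2 - b\<^sup>2 / (2 * \<sigma>\<^sup>2))"
      using \<sigma> by (simp add: field_simps power2_eq_square)
    then show ?thesis by (simp add: normal_density_def exp_add[symmetric])
  qed
  have "emeasure (distr N borel (\<lambda>x. x + b)) A = (\<integral>\<^sup>+x. indicator A (x + b) \<partial>N)"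
    by (subst nn_integral_indicator[symmetric], simp, subst nn_integral_distr) (auto simp: N_def)
  also have "\<dots> = (\<integral>\<^sup>+x. ennreal (normal_density 0 \<sigma> x) * indicator A (x + b) \<partial>lborel)"
    unfolding N_def by (subst nn_integral_density) auto
  also have "\<dots> = (\<integral>\<^sup>+x. ennreal (normal_density 0 \<sigma> (x - b)) * indicator A x \<partial>lborel)"
    by (subst nn_integral_real_affine[where t="-b" and c=1]) auto
  also have "\<dots> = (\<integral>\<^sup>+x. ennreal (normal_density 0 \<sigma> x) * (ennreal (exp (b * x / \<sigma>\<^sup>2 - b\<^sup>2 / (2 * \<sigma>\<^sup>2))) * indicator A x) \<partial>lborel)"
    unfolding dens by (simp add: ennreal_mult mult.assoc)
  also have "\<dots> = (\<integral>\<^sup>+x. ennreal (exp (b * x / \<sigma>\<^sup>2 - b\<^sup>2 / (2 * \<sigma>\<^sup>2))) * indicator A x \<partial>N)"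
    unfolding N_def by (subst nn_integral_density) auto
  also have "\<dots> = emeasure (density N (\<lambda>x. ennreal (exp (b * x / \<sigma>\<^sup>2 - b\<^sup>2 / (2 * \<sigma>\<^sup>2))))) A"
    by (subst emeasure_density) (auto simp: N_def)
  finally show "emeasure (distr N borel (\<lambda>x. x + b)) A
    = emeasure (density N (\<lambda>x. ennreal (exp (b * x / \<sigma>\<^sup>2 - b\<^sup>2 / (2 * \<sigma>\<^sup>2))))) A" .
qed (simp add: N_def)

text \<open>The finite-dimensional Cameron-Martin formula. The translated product measure and the
  product measure with the exponential density both equal the product of the translated
  one-dimensional laws, since they agree on boxes.\<close>

lemma gaussian_shift_PiM:
  fixes b :: "'i \<Rightarrow> real" and F :: "('i \<Rightarrow> real) \<Rightarrow> real"
  assumes I: "finite I" and \<sigma>: "\<sigma> > 0"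
  defines "N \<equiv> density lborel (\<lambda>x. ennreal (normal_density 0 \<sigma> x))"
  assumes F: "F \<in> borel_measurable (borel_paths I)"
  shows "(\<integral>x. F (\<lambda>i\<in>I. x i + b i) \<partial>PiM I (\<lambda>_. N))
    = (\<integral>x. exp (\<Sum>i\<in>I. b i * x i / \<sigma>\<^sup>2 - (b i)\<^sup>2 / (2 * \<sigma>\<^sup>2)) * F x \<partial>PiM I (\<lambda>_. N))"
proof -
  let ?\<Pi> = "PiM I (\<lambda>_. N)"
  interpret N: prob_space N unfolding N_def by (rule prob_space_normal_density[OF \<sigma>])
  interpret PN: product_sigma_finite "\<lambda>_. N" ..
  have sN: "sets N = sets borel" by (simp add: N_def)
  have sP: "sets ?\<Pi> = sets (borel_paths I)" using sN by (intro sets_PiM_cong) auto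
  define D where "D i = distr N borel (\<lambda>x. x + b i)" for i
  have sft: "(\<lambda>x. x + b i) \<in> measurable N borel" for i using sN by measurable
  have pD: "prob_space (D i)" for i unfolding D_def by (rule N.prob_space_distr[OF sft])
  interpret PD: product_sigma_finite D
    by (auto simp: product_sigma_finite_def intro: prob_space_imp_sigma_finite pD)
  define e where "e i x = exp (b i * x / \<sigma>\<^sup>2 - (b i)\<^sup>2 / (2 * \<sigma>\<^sup>2))" for i x
  have De: "D i = density N (\<lambda>x. ennreal (e i x))" for i
    unfolding D_def e_def N_def by (rule distr_normal_shift[OF \<sigma>])
  have me: "e i \<in> borel_measurable N" for i unfolding e_def[abs_def] using sN by measurable
  have sD: "sets (PiM I D) = sets (borel_paths I)" by (intro sets_PiM_cong) (auto simp: D_def)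
  have comp: "(\<lambda>x. x i) \<in> measurable ?\<Pi> N" if "i \<in> I" for i
    using measurable_component_singleton[OF that, of "\<lambda>_. N"] .
  have msft: "(\<lambda>x. \<lambda>i\<in>I. x i + b i) \<in> measurable ?\<Pi> (borel_paths I)"
    by (intro measurable_restrict measurable_compose[OF comp sft])
  define E where "E x = exp (\<Sum>i\<in>I. b i * x i / \<sigma>\<^sup>2 - (b i)\<^sup>2 / (2 * \<sigma>\<^sup>2))" for x
  have Ee: "E x = (\<Prod>i\<in>I. e i (x i))" for x unfolding E_def e_def by (rule exp_sum[OF I])
  have mE: "E \<in> borel_measurable ?\<Pi>"
    unfolding Ee[abs_def] by (intro borel_measurable_prod measurable_compose[OF comp me])
  have "distr ?\<Pi> (borel_paths I) (\<lambda>x. \<lambda>i\<in>I. x i + b i) = PiM I D"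
  proof (rule PD.PiM_eqI[OF I])
    fix A assume "\<And>i. i \<in> I \<Longrightarrow> A i \<in> sets (D i)"
    then have A: "A i \<in> sets borel" if "i \<in> I" for i using that by (simp add: D_def)
    have pre: "(\<lambda>x. x + b i) -` A i \<inter> space N \<in> sets N" if "i \<in> I" for i
      by (rule measurable_sets[OF sft A[OF that]])
    have "emeasure (distr ?\<Pi> (borel_paths I) (\<lambda>x. \<lambda>i\<in>I. x i + b i)) (Pi\<^sub>E I A)
      = emeasure ?\<Pi> ((\<lambda>x. \<lambda>i\<in>I. x i + b i) -` Pi\<^sub>E I A \<inter> space ?\<Pi>)"
      using A I by (intro emeasure_distr msft sets_PiM_I_finite) auto
    also have "(\<lambda>x. \<lambda>i\<in>I. x i + b i) -` Pi\<^sub>E I A \<inter> space ?\<Pi> = (\<Pi>\<^sub>E i\<in>I. (\<lambda>x. x + b i) -` A i \<inter> space N)"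
      by (auto simp: space_PiM PiE_iff)
    also have "emeasure ?\<Pi> \<dots> = (\<Prod>i\<in>I. emeasure N ((\<lambda>x. x + b i) -` A i \<inter> space N))"
      using pre I by (intro PN.emeasure_PiM) auto
    also have "\<dots> = (\<Prod>i\<in>I. emeasure (D i) (A i))"
      unfolding D_def using A by (intro prod.cong refl emeasure_distr[symmetric] sft) auto
    finally show "emeasure (distr ?\<Pi> (borel_paths I) (\<lambda>x. \<lambda>i\<in>I. x i + b i)) (Pi\<^sub>E I A)
      = (\<Prod>i\<in>I. emeasure (D i) (A i))" .
  qed (simp add: sD)
  moreover have "density ?\<Pi> (\<lambda>x. ennreal (E x)) = PiM I D"
  proof (rule PD.PiM_eqI[OF I])
    fix A assume "\<And>i. i \<in> I \<Longrightarrow> A i \<in> sets (D i)"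
    then have A: "A i \<in> sets N" if "i \<in> I" for i using that sN by (simp add: D_def)
    have "emeasure (density ?\<Pi> (\<lambda>x. ennreal (E x))) (Pi\<^sub>E I A) = (\<integral>\<^sup>+x. ennreal (E x) * indicator (Pi\<^sub>E I A) x \<partial>?\<Pi>)"
      using mE A I by (intro emeasure_density sets_PiM_I_finite) auto
    also have "\<dots> = (\<integral>\<^sup>+x. (\<Prod>i\<in>I. ennreal (e i (x i)) * indicator (A i) (x i)) \<partial>?\<Pi>)"
    proof (rule nn_integral_cong)
      fix x assume x: "x \<in> space ?\<Pi>"
      have "indicator (Pi\<^sub>E I A) x = (\<Prod>i\<in>I. indicator (A i) (x i) :: ennreal)"
        using x I by (auto simp: indicator_def space_PiM PiE_iff)
      moreover have "ennreal (E x) = (\<Prod>i\<in>I. ennreal (e i (x i)))"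
        unfolding Ee by (rule prod_ennreal[symmetric]) (simp add: e_def)
      ultimately show "ennreal (E x) * indicator (Pi\<^sub>E I A) x = (\<Prod>i\<in>I. ennreal (e i (x i)) * indicator (A i) (x i))"
        by (simp add: prod.distrib)
    qed
    also have "\<dots> = (\<Prod>i\<in>I. \<integral>\<^sup>+x. ennreal (e i x) * indicator (A i) x \<partial>N)"
      using A me by (intro PN.product_nn_integral_prod I) auto
    also have "\<dots> = (\<Prod>i\<in>I. emeasure (D i) (A i))"
      unfolding De using A me by (intro prod.cong refl emeasure_density[symmetric]) auto
    finally show "emeasure (density ?\<Pi> (\<lambda>x. ennreal (E x))) (Pi\<^sub>E I A) = (\<Prod>i\<in>I. emeasure (D i) (A i))" .
  qed (simp add: sD sP)
  ultimately have eq: "distr ?\<Pi> (borel_paths I) (\<lambda>x. \<lambda>i\<in>I. x i + b i) = density ?\<Pi> (\<lambda>x. ennreal (E x))"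
    by simp
  have F': "F \<in> borel_measurable ?\<Pi>" using F by (simp add: measurable_cong_sets[OF sP refl])
  have "(\<integral>x. F (\<lambda>i\<in>I. x i + b i) \<partial>?\<Pi>) = (\<integral>x. F x \<partial>distr ?\<Pi> (borel_paths I) (\<lambda>x. \<lambda>i\<in>I. x i + b i))"
    by (rule integral_distr[OF msft F, symmetric])
  also have "\<dots> = (\<integral>x. E x * F x \<partial>?\<Pi>)"
    unfolding eq by (rule integral_real_density[OF mE _ F']) (simp add: E_def)
  finally show ?thesis unfolding E_def .
qed

section \<open>A damped Cameron--Martin formula\<close>

text \<open>Up to scaling, the discrete form of the integral of (1/2 - s)^2 over [0,1/2], which is
  the variance 1/24 of the integral of B.\<close>

lemma sum_odd_squares:
  "(\<Sum>i<k. (1 - (2 * real i + 1) * h)\<^sup>2) = real k - 2 * h * (real k)\<^sup>2 + h\<^sup>2 * real k * (4 * (real k)\<^sup>2 - 1) / 3"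
proof (induction k)
  case (Suc k)
  then show ?case by (simp add: field_simps power2_eq_square)
qed simp

text \<open>The coefficient is 1/2 minus the midpoint of the i-th cell and drops by h from cell to
  cell. This is the discrete form of writing the integral of B over [0,1/2] as the stochastic
  integral of 1/2 - s.\<close>

lemma summation_by_parts_linear:
  fixes w :: "nat \<Rightarrow> real"
  assumes "w 0 = 0"
  shows "(\<Sum>i<k. (1 - (2 * real i + 1) * h) / 2 * (w (Suc i) - w i))
    = (1 - (2 * real k - 1) * h) / 2 * w k + h * (\<Sum>i<k. w i)"
proof (induction k)
  case (Suc k)
  then show ?case by (simp add: field_simps)
qed (use assms in simp)

text \<open>On \<open>[0,1/2]\<close>, \<open>cm_shift s\<close> is the covariance of \<open>B s\<close> with \<open>24\<close> times the integral of \<open>B\<close>.\<close>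

definition cm_shift :: "real \<Rightarrow> real" where
  "cm_shift s = 12 * s * (1 - s)"

text \<open>Since B starts at 0, \<open>Y n\<close> is the trapezoidal rule for the integral of B,
  and by summation by parts a linear form in the increments. Translating each increment by that of
  \<open>a * cm_shift\<close> changes \<open>Y n\<close> by \<open>a * (1 - (h n)\<^sup>2)\<close>,
  where 1 - h^2 is 24 times the variance of \<open>Y n\<close>. So the identity is exact on every
  grid, with corrections of order h^2.\<close>

lemma damped_cameron_martin_grid:
  fixes \<phi> :: "real \<Rightarrow> real \<Rightarrow> real"
  assumes B: "std_BM M B" and J: "finite J" "J \<subseteq> {0..1/2}"
    and c: "\<And>t. continuous_on UNIV (\<phi> t)"
  defines "h \<equiv> (\<lambda>n. (1/2) / real (Suc n))"
  defines "Y \<equiv> (\<lambda>n \<omega>. h n * (\<Sum>k<Suc n. B \<omega> (real k * h n)) + h n / 2 * B \<omega> (1/2))"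
  shows "(\<integral>\<omega>. exp (- 12 * (Y n \<omega> + a * (1 - (h n)\<^sup>2))\<^sup>2) * (\<Prod>t\<in>J. \<phi> t (B \<omega> (rnd (h n) t) + a * cm_shift (rnd (h n) t))) \<partial>M)
    = (\<integral>\<omega>. exp (- 12 * (Y n \<omega> - a)\<^sup>2 + 12 * a\<^sup>2 * (h n)\<^sup>2) * (\<Prod>t\<in>J. \<phi> t (B \<omega> (rnd (h n) t))) \<partial>M)"
proof -
  interpret prob_space M by (rule std_BM_prob_space[OF B])
  let ?h = "h n" and ?N = "Suc n"
  have h: "?h > 0" and hN: "real ?N * ?h = 1/2" by (auto simp: h_def)
  \<comment> \<open>1/2 minus the midpoint of the cell; midpoints make the next constant an exact
    increment.\<close>
  define C where "C i = (1 - (2 * real i + 1) * ?h) / 2" for i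
  \<comment> \<open>Equals a times the increment of \<open>cm_shift\<close> over the i-th cell, so
    the shifted walk carries the true values of \<open>a * cm_shift\<close> at grid times.\<close>
  define b where "b i = 24 * a * ?h * C i" for i
  define X where "X \<omega> = (\<lambda>i\<in>{..<?N}. B \<omega> (real (Suc i) * ?h) - B \<omega> (real i * ?h))" for \<omega>
  define PP where "PP = PiM {..<?N} (\<lambda>_. density lborel (\<lambda>x. ennreal (normal_density 0 (sqrt ?h) x)))"
  define Z where "Z x = (\<Sum>i<?N. C i * x i)" for x
  define G where "G x = (\<Prod>t\<in>J. \<phi> t (\<Sum>i<nat \<lfloor>t / ?h\<rfloor>. x i))" for x
  define F where "F x = exp (- 12 * (Z x)\<^sup>2) * G x" for x
  have m\<phi>: "\<phi> t \<in> borel_measurable borel" for t using c by (auto intro: borel_measurable_continuous_onI)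
  have idx: "nat \<lfloor>t / ?h\<rfloor> \<le> ?N" if "t \<in> J" for t
    unfolding h_def using that J by (intro rnd_step_index) auto
  have comp: "(\<lambda>x. x i) \<in> borel_measurable (borel_paths {..<?N})" if "i < ?N" for i
    using that by (intro measurable_component_singleton) auto
  have mZ[measurable]: "Z \<in> borel_measurable (borel_paths {..<?N})"
    unfolding Z_def[abs_def] by (intro borel_measurable_sum borel_measurable_times comp borel_measurable_const) auto
  have mG[measurable]: "G \<in> borel_measurable (borel_paths {..<?N})"
    unfolding G_def[abs_def]
    by (intro borel_measurable_prod measurable_compose[OF borel_measurable_sum m\<phi>] comp) (use idx in force)
  have mF: "F \<in> borel_measurable (borel_paths {..<?N})" unfolding F_def[abs_def] by measurable
  have law: "distr M (borel_paths {..<?N}) X = PP"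
    unfolding X_def[abs_def] PP_def by (rule std_BM_grid_law[OF B h])
  have mX: "X \<in> measurable M (borel_paths {..<?N})"
    unfolding X_def[abs_def] using h by (intro measurable_restrict borel_measurable_diff std_BM_measurable[OF B]) auto
  have transfer: "(\<integral>x. f x \<partial>PP) = (\<integral>\<omega>. f (X \<omega>) \<partial>M)" if "f \<in> borel_measurable (borel_paths {..<?N})"
    for f :: "(nat \<Rightarrow> real) \<Rightarrow> real"
    unfolding law[symmetric] by (rule integral_distr[OF mX that])
  \<comment> \<open>With real N * h = 1/2 the sum is the variance of \<open>Y n\<close> divided by
    h.\<close>
  have sumC: "(\<Sum>i<?N. (C i)\<^sup>2) = (1 - ?h\<^sup>2) / (24 * ?h)"
  proof -
    have "(\<Sum>i<?N. (C i)\<^sup>2) = (\<Sum>i<?N. (1 - (2 * real i + 1) * ?h)\<^sup>2) / 4"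
      by (simp add: C_def power_divide sum_divide_distrib[symmetric] del: sum.lessThan_Suc)
    also have "\<dots> = (real ?N - 2 * ?h * (real ?N)\<^sup>2 + ?h\<^sup>2 * real ?N * (4 * (real ?N)\<^sup>2 - 1) / 3) / 4"
      by (simp only: sum_odd_squares)
    also have "real ?N = 1 / (2 * ?h)" using hN h by (simp add: field_simps)
    also have "(1 / (2 * ?h) - 2 * ?h * (1 / (2 * ?h))\<^sup>2 + ?h\<^sup>2 * (1 / (2 * ?h)) * (4 * (1 / (2 * ?h))\<^sup>2 - 1) / 3) / 4
        = (1 - ?h\<^sup>2) / (24 * ?h)"
      using h by (simp add: field_simps power2_eq_square)
    finally show ?thesis .
  qed
  have sb: "(\<Sum>i<k. b i) = a * cm_shift (real k * ?h)" for k
  proof (induction k)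
    case (Suc k)
    have "b k = 12 * a * ?h * (1 - (2 * real k + 1) * ?h)" by (simp add: b_def C_def)
    with Suc have "(\<Sum>i<Suc k. b i) = a * cm_shift (real k * ?h) + 12 * a * ?h * (1 - (2 * real k + 1) * ?h)" by simp
    also have "\<dots> = a * cm_shift (real (Suc k) * ?h)" by (simp add: cm_shift_def algebra_simps)
    finally show ?case .
  qed (simp add: cm_shift_def)
  have ZX: "Z (X \<omega>) = Y n \<omega>" if \<omega>: "\<omega> \<in> space M" for \<omega>
  proof -
    have "Z (X \<omega>) = (\<Sum>i<?N. (1 - (2 * real i + 1) * ?h) / 2 * (B \<omega> (real (Suc i) * ?h) - B \<omega> (real i * ?h)))"
      unfolding Z_def by (intro sum.cong) (auto simp: C_def X_def)
    also have "\<dots> = (1 - (2 * real ?N - 1) * ?h) / 2 * B \<omega> (real ?N * ?h) + ?h * (\<Sum>i<?N. B \<omega> (real i * ?h))"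
      by (rule summation_by_parts_linear) (simp add: std_BM_zero[OF B \<omega>])
    also have "(1 - (2 * real ?N - 1) * ?h) / 2 = ?h / 2"
      using hN by (simp add: algebra_simps)
    finally show ?thesis unfolding hN Y_def by simp
  qed
  have GX: "G (X \<omega>) = (\<Prod>t\<in>J. \<phi> t (B \<omega> (rnd ?h t)))" if \<omega>: "\<omega> \<in> space M" for \<omega>
  proof -
    have "(\<Sum>i<nat \<lfloor>t / ?h\<rfloor>. X \<omega> i) = B \<omega> (rnd ?h t)" if "t \<in> J" for t
      unfolding rnd_def X_def using idx[OF that]
      by (intro trans[OF _ std_BM_grid_sum[OF B \<omega>, symmetric]] sum.cong) auto
    then show ?thesis by (simp add: G_def)
  qed
  have Zs: "Z (\<lambda>i\<in>{..<?N}. x i + b i) = Z x + a * (1 - ?h\<^sup>2)" for x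
  proof -
    have "Z (\<lambda>i\<in>{..<?N}. x i + b i) = Z x + (\<Sum>i<?N. C i * b i)"
      unfolding Z_def by (simp add: algebra_simps sum.distrib)
    also have "(\<Sum>i<?N. C i * b i) = 24 * a * ?h * (\<Sum>i<?N. (C i)\<^sup>2)"
      unfolding b_def sum_distrib_left by (intro sum.cong) (auto simp: power2_eq_square)
    also have "\<dots> = a * (1 - ?h\<^sup>2)" unfolding sumC using h by simp
    finally show ?thesis .
  qed
  have Gs: "G (\<lambda>i\<in>{..<?N}. x i + b i) = (\<Prod>t\<in>J. \<phi> t ((\<Sum>i<nat \<lfloor>t / ?h\<rfloor>. x i) + a * cm_shift (rnd ?h t)))" for x
    unfolding G_def
  proof (rule prod.cong)
    fix t assume t: "t \<in> J"
    have "(\<Sum>i<nat \<lfloor>t / ?h\<rfloor>. (\<lambda>i\<in>{..<?N}. x i + b i) i) = (\<Sum>i<nat \<lfloor>t / ?h\<rfloor>. x i + b i)"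
      using idx[OF t] by (intro sum.cong) auto
    also have "\<dots> = (\<Sum>i<nat \<lfloor>t / ?h\<rfloor>. x i) + a * cm_shift (rnd ?h t)"
      unfolding rnd_def sum.distrib sb ..
    finally show "\<phi> t (\<Sum>i<nat \<lfloor>t / ?h\<rfloor>. (\<lambda>i\<in>{..<?N}. x i + b i) i) = \<phi> t ((\<Sum>i<nat \<lfloor>t / ?h\<rfloor>. x i) + a * cm_shift (rnd ?h t))"
      by simp
  qed simp
  \<comment> \<open>Because the translation is proportional to C, the log density is a function of Z
    alone.\<close>
  have expo: "(\<Sum>i<?N. b i * x i / (sqrt ?h)\<^sup>2 - (b i)\<^sup>2 / (2 * (sqrt ?h)\<^sup>2)) = 24 * a * Z x - 12 * a\<^sup>2 * (1 - ?h\<^sup>2)" for x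
  proof -
    have "(sqrt ?h)\<^sup>2 = ?h" using h by simp
    moreover have "(\<Sum>i<?N. b i * x i / ?h - (b i)\<^sup>2 / (2 * ?h)) = (\<Sum>i<?N. 24 * a * (C i * x i) - 288 * a\<^sup>2 * ?h * (C i)\<^sup>2)"
      using h by (intro sum.cong refl) (simp add: b_def field_simps power2_eq_square)
    moreover have "\<dots> = 24 * a * Z x - 288 * a\<^sup>2 * ?h * (\<Sum>i<?N. (C i)\<^sup>2)"
      by (simp add: Z_def sum_subtractf sum_distrib_left del: sum.lessThan_Suc)
    moreover have "288 * a\<^sup>2 * ?h * (\<Sum>i<?N. (C i)\<^sup>2) = 12 * a\<^sup>2 * (1 - ?h\<^sup>2)"
      unfolding sumC using h by (simp add: field_simps)
    ultimately show ?thesis by simp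
  qed
  have shift: "(\<integral>x. F (\<lambda>i\<in>{..<?N}. x i + b i) \<partial>PP) = (\<integral>x. exp (24 * a * Z x - 12 * a\<^sup>2 * (1 - ?h\<^sup>2)) * F x \<partial>PP)"
    unfolding PP_def expo[symmetric] using h by (intro gaussian_shift_PiM mF) auto
  have ms: "(\<lambda>x. F (\<lambda>i\<in>{..<?N}. x i + b i)) \<in> borel_measurable (borel_paths {..<?N})"
    by (intro measurable_compose[OF measurable_restrict mF] borel_measurable_add comp borel_measurable_const) auto
  have me: "(\<lambda>x. exp (24 * a * Z x - 12 * a\<^sup>2 * (1 - ?h\<^sup>2)) * F x) \<in> borel_measurable (borel_paths {..<?N})"
    using mF by measurable
  have "(\<integral>\<omega>. exp (- 12 * (Y n \<omega> + a * (1 - ?h\<^sup>2))\<^sup>2) * (\<Prod>t\<in>J. \<phi> t (B \<omega> (rnd ?h t) + a * cm_shift (rnd ?h t))) \<partial>M)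
    = (\<integral>\<omega>. F (\<lambda>i\<in>{..<?N}. X \<omega> i + b i) \<partial>M)"
  proof (intro Bochner_Integration.integral_cong refl)
    fix \<omega> assume \<omega>: "\<omega> \<in> space M"
    have "(\<Sum>i<nat \<lfloor>t / ?h\<rfloor>. X \<omega> i) = B \<omega> (rnd ?h t)" if "t \<in> J" for t
      unfolding rnd_def X_def using idx[OF that]
      by (intro trans[OF _ std_BM_grid_sum[OF B \<omega>, symmetric]] sum.cong) auto
    then show "exp (- 12 * (Y n \<omega> + a * (1 - ?h\<^sup>2))\<^sup>2) * (\<Prod>t\<in>J. \<phi> t (B \<omega> (rnd ?h t) + a * cm_shift (rnd ?h t)))
      = F (\<lambda>i\<in>{..<?N}. X \<omega> i + b i)"
      unfolding F_def Zs Gs ZX[OF \<omega>] by simp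
  qed
  also have "\<dots> = (\<integral>x. F (\<lambda>i\<in>{..<?N}. x i + b i) \<partial>PP)" by (rule transfer[OF ms, symmetric])
  also note shift
  also have "(\<integral>x. exp (24 * a * Z x - 12 * a\<^sup>2 * (1 - ?h\<^sup>2)) * F x \<partial>PP)
      = (\<integral>\<omega>. exp (24 * a * Z (X \<omega>) - 12 * a\<^sup>2 * (1 - ?h\<^sup>2)) * F (X \<omega>) \<partial>M)" by (rule transfer[OF me])
  also have "\<dots> = (\<integral>\<omega>. exp (- 12 * (Y n \<omega> - a)\<^sup>2 + 12 * a\<^sup>2 * ?h\<^sup>2) * (\<Prod>t\<in>J. \<phi> t (B \<omega> (rnd ?h t))) \<partial>M)"
  proof (intro Bochner_Integration.integral_cong refl)
    fix \<omega> assume \<omega>: "\<omega> \<in> space M"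
    \<comment> \<open>Multiplying the density by the damping exp(-12 y^2) completes the square, up
      to the term from the discrete variance.\<close>
    have "24 * a * y - 12 * a\<^sup>2 * (1 - ?h\<^sup>2) + (- 12 * y\<^sup>2) = - 12 * (y - a)\<^sup>2 + 12 * a\<^sup>2 * ?h\<^sup>2" for y
      by (simp add: algebra_simps power2_eq_square)
    then show "exp (24 * a * Z (X \<omega>) - 12 * a\<^sup>2 * (1 - ?h\<^sup>2)) * F (X \<omega>)
      = exp (- 12 * (Y n \<omega> - a)\<^sup>2 + 12 * a\<^sup>2 * ?h\<^sup>2) * (\<Prod>t\<in>J. \<phi> t (B \<omega> (rnd ?h t)))"
      unfolding F_def ZX[OF \<omega>] GX[OF \<omega>] mult.assoc[symmetric] exp_add[symmetric] by simp
  qed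
  finally show ?thesis .
qed

text \<open>Both sides of the grid identity are bounded uniformly in n thanks to the damping factor,
  so path continuity and convergence of the trapezoidal sums carry it to the limit.\<close>

lemma damped_cameron_martin_test:
  fixes \<phi> :: "real \<Rightarrow> real \<Rightarrow> real"
  assumes B: "std_BM M B" and J: "finite J" "J \<subseteq> {0..1/2}"
    and c: "\<And>t. continuous_on UNIV (\<phi> t)" and b: "\<And>t x. 0 \<le> \<phi> t x \<and> \<phi> t x \<le> 1"
  shows "(\<integral>\<omega>. exp (- 12 * (integral {0..1/2} (B \<omega>) + a)\<^sup>2) * (\<Prod>t\<in>J. \<phi> t (B \<omega> t + a * cm_shift t)) \<partial>M)
    = (\<integral>\<omega>. exp (- 12 * (integral {0..1/2} (B \<omega>) - a)\<^sup>2) * (\<Prod>t\<in>J. \<phi> t (B \<omega> t)) \<partial>M)"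
proof -
  interpret prob_space M by (rule std_BM_prob_space[OF B])
  define h where "h = (\<lambda>n. (1/2) / real (Suc n))"
  define Y where "Y = (\<lambda>n \<omega>. h n * (\<Sum>k<Suc n. B \<omega> (real k * h n)) + h n / 2 * B \<omega> (1/2))"
  have h: "\<And>n. h n > 0" "h \<longlonglongrightarrow> 0" using step_tendsto[of "1/2"] by (auto simp: h_def)
  have h1: "(h n)\<^sup>2 \<le> 1" for n using h(1)[of n] by (intro power_le_one) (auto simp: h_def field_simps)
  have m\<phi>: "\<phi> t \<in> borel_measurable borel" for t using c by (auto intro: borel_measurable_continuous_onI)
  have mB: "(\<lambda>\<omega>. B \<omega> (rnd (h n) t)) \<in> borel_measurable M" if "t \<in> J" for t n
    using rnd_bounds(1)[OF h(1)[of n], of t] that J by (intro std_BM_measurable[OF B]) auto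
  have mY[measurable]: "Y n \<in> borel_measurable M" for n
    unfolding Y_def using h(1)[of n]
    by (intro borel_measurable_add borel_measurable_times borel_measurable_sum borel_measurable_const std_BM_measurable[OF B]) auto
  have \<phi>b: "\<bar>\<Prod>t\<in>J. \<phi> t (y t)\<bar> \<le> 1" for y using b by (auto simp: abs_prod intro!: prod_le_1)
  have cB: "continuous_on {0..1/2} (B \<omega>)" if "\<omega> \<in> space M" for \<omega>
    by (rule continuous_on_subset[OF std_BM_continuous[OF B that]]) auto
  have limY: "(\<lambda>n. Y n \<omega>) \<longlonglongrightarrow> integral {0..1/2} (B \<omega>)" if \<omega>: "\<omega> \<in> space M" for \<omega>
  proof -
    have "(\<lambda>n. Y n \<omega>) \<longlonglongrightarrow> integral {0..1/2} (B \<omega>) + 0 / 2 * B \<omega> (1/2)"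
      unfolding Y_def
    proof (intro tendsto_add tendsto_mult tendsto_divide tendsto_const h(2))
      show "(\<lambda>n. h n * (\<Sum>k<Suc n. B \<omega> (real k * h n))) \<longlonglongrightarrow> integral {0..1/2} (B \<omega>)"
        unfolding h_def by (rule riemann_sum_tendsto[OF cB[OF \<omega>]]) simp
    qed simp
    then show ?thesis by simp
  qed
  have limh: "(\<lambda>n. (h n)\<^sup>2) \<longlonglongrightarrow> 0" using tendsto_power[OF h(2), of 2] by simp
  have rt: "(\<lambda>n. rnd (h n) t) \<longlonglongrightarrow> t" if "t \<in> J" for t using that J by (intro rnd_tendsto[OF h]) auto
  have Brt: "(\<lambda>n. B \<omega> (rnd (h n) t)) \<longlonglongrightarrow> B \<omega> t" if "t \<in> J" "\<omega> \<in> space M" for t \<omega>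
    using J that by (intro rnd_tendsto_continuous[OF h _ std_BM_continuous[OF B]]) auto
  have 1: "(\<lambda>n. \<integral>\<omega>. exp (- 12 * (Y n \<omega> + a * (1 - (h n)\<^sup>2))\<^sup>2) * (\<Prod>t\<in>J. \<phi> t (B \<omega> (rnd (h n) t) + a * cm_shift (rnd (h n) t))) \<partial>M)
    \<longlonglongrightarrow> (\<integral>\<omega>. exp (- 12 * (integral {0..1/2} (B \<omega>) + a)\<^sup>2) * (\<Prod>t\<in>J. \<phi> t (B \<omega> t + a * cm_shift t)) \<partial>M)"
  proof (rule bounded_convergence[where B=1, OF finite_measure_axioms])
    fix \<omega> assume \<omega>: "\<omega> \<in> space M"
    have "(\<lambda>n. Y n \<omega> + a * (1 - (h n)\<^sup>2)) \<longlonglongrightarrow> integral {0..1/2} (B \<omega>) + a * (1 - 0)"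
      by (intro tendsto_intros limY[OF \<omega>] limh)
    then have "(\<lambda>n. exp (- 12 * (Y n \<omega> + a * (1 - (h n)\<^sup>2))\<^sup>2)) \<longlonglongrightarrow> exp (- 12 * (integral {0..1/2} (B \<omega>) + a * (1 - 0))\<^sup>2)"
      by (intro tendsto_exp tendsto_mult tendsto_const tendsto_power)
    moreover have "(\<lambda>n. \<Prod>t\<in>J. \<phi> t (B \<omega> (rnd (h n) t) + a * cm_shift (rnd (h n) t))) \<longlonglongrightarrow> (\<Prod>t\<in>J. \<phi> t (B \<omega> t + a * cm_shift t))"
      unfolding cm_shift_def
      by (intro tendsto_prod continuous_on_tendsto_compose[OF c] tendsto_add Brt[OF _ \<omega>] tendsto_mult tendsto_const tendsto_diff rt) auto
    ultimately show "(\<lambda>n. exp (- 12 * (Y n \<omega> + a * (1 - (h n)\<^sup>2))\<^sup>2) * (\<Prod>t\<in>J. \<phi> t (B \<omega> (rnd (h n) t) + a * cm_shift (rnd (h n) t))))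
      \<longlonglongrightarrow> exp (- 12 * (integral {0..1/2} (B \<omega>) + a)\<^sup>2) * (\<Prod>t\<in>J. \<phi> t (B \<omega> t + a * cm_shift t))"
      using tendsto_mult by fastforce
    show "\<bar>exp (- 12 * (Y n \<omega> + a * (1 - (h n)\<^sup>2))\<^sup>2) * (\<Prod>t\<in>J. \<phi> t (B \<omega> (rnd (h n) t) + a * cm_shift (rnd (h n) t)))\<bar> \<le> 1" for n
      unfolding abs_mult by (intro mult_le_one \<phi>b) auto
  next
    show "(\<lambda>\<omega>. exp (- 12 * (Y n \<omega> + a * (1 - (h n)\<^sup>2))\<^sup>2) * (\<Prod>t\<in>J. \<phi> t (B \<omega> (rnd (h n) t) + a * cm_shift (rnd (h n) t)))) \<in> borel_measurable M" for n
    proof (rule borel_measurable_times)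
      show "(\<lambda>\<omega>. \<Prod>t\<in>J. \<phi> t (B \<omega> (rnd (h n) t) + a * cm_shift (rnd (h n) t))) \<in> borel_measurable M"
        by (intro borel_measurable_prod measurable_compose[OF borel_measurable_add[OF mB borel_measurable_const] m\<phi>])
    qed measurable
  qed
  have 2: "(\<lambda>n. \<integral>\<omega>. exp (- 12 * (Y n \<omega> - a)\<^sup>2 + 12 * a\<^sup>2 * (h n)\<^sup>2) * (\<Prod>t\<in>J. \<phi> t (B \<omega> (rnd (h n) t))) \<partial>M)
    \<longlonglongrightarrow> (\<integral>\<omega>. exp (- 12 * (integral {0..1/2} (B \<omega>) - a)\<^sup>2) * (\<Prod>t\<in>J. \<phi> t (B \<omega> t)) \<partial>M)"
  \<comment> \<open>The square is nonnegative and h is at most 1, so only the correction term can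
    make the exponent positive.\<close>
  proof (rule bounded_convergence[where B="exp (12 * a\<^sup>2)", OF finite_measure_axioms])
    fix \<omega> assume \<omega>: "\<omega> \<in> space M"
    have "(\<lambda>n. exp (- 12 * (Y n \<omega> - a)\<^sup>2 + 12 * a\<^sup>2 * (h n)\<^sup>2)) \<longlonglongrightarrow> exp (- 12 * (integral {0..1/2} (B \<omega>) - a)\<^sup>2 + 12 * a\<^sup>2 * 0)"
      by (intro tendsto_intros limY[OF \<omega>] limh)
    moreover have "(\<lambda>n. \<Prod>t\<in>J. \<phi> t (B \<omega> (rnd (h n) t))) \<longlonglongrightarrow> (\<Prod>t\<in>J. \<phi> t (B \<omega> t))"
      by (intro tendsto_prod continuous_on_tendsto_compose[OF c] Brt[OF _ \<omega>]) auto
    ultimately show "(\<lambda>n. exp (- 12 * (Y n \<omega> - a)\<^sup>2 + 12 * a\<^sup>2 * (h n)\<^sup>2) * (\<Prod>t\<in>J. \<phi> t (B \<omega> (rnd (h n) t))))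
      \<longlonglongrightarrow> exp (- 12 * (integral {0..1/2} (B \<omega>) - a)\<^sup>2) * (\<Prod>t\<in>J. \<phi> t (B \<omega> t))"
      using tendsto_mult by fastforce
    show "\<bar>exp (- 12 * (Y n \<omega> - a)\<^sup>2 + 12 * a\<^sup>2 * (h n)\<^sup>2) * (\<Prod>t\<in>J. \<phi> t (B \<omega> (rnd (h n) t)))\<bar> \<le> exp (12 * a\<^sup>2)" for n
    proof -
      have "12 * a\<^sup>2 * (h n)\<^sup>2 \<le> 12 * a\<^sup>2 * 1" using h1 by (intro mult_left_mono) auto
      moreover have "0 \<le> (Y n \<omega> - a)\<^sup>2" by simp
      ultimately have "exp (- 12 * (Y n \<omega> - a)\<^sup>2 + 12 * a\<^sup>2 * (h n)\<^sup>2) \<le> exp (12 * a\<^sup>2)"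
        unfolding exp_le_cancel_iff by linarith
      then have "\<bar>exp (- 12 * (Y n \<omega> - a)\<^sup>2 + 12 * a\<^sup>2 * (h n)\<^sup>2)\<bar> * \<bar>\<Prod>t\<in>J. \<phi> t (B \<omega> (rnd (h n) t))\<bar> \<le> exp (12 * a\<^sup>2) * 1"
        by (intro mult_mono \<phi>b) auto
      then show ?thesis unfolding abs_mult by simp
    qed
  next
    show "(\<lambda>\<omega>. exp (- 12 * (Y n \<omega> - a)\<^sup>2 + 12 * a\<^sup>2 * (h n)\<^sup>2) * (\<Prod>t\<in>J. \<phi> t (B \<omega> (rnd (h n) t)))) \<in> borel_measurable M" for n
    proof (rule borel_measurable_times)
      show "(\<lambda>\<omega>. \<Prod>t\<in>J. \<phi> t (B \<omega> (rnd (h n) t))) \<in> borel_measurable M"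
        by (intro borel_measurable_prod measurable_compose[OF mB m\<phi>])
    qed measurable
  qed
  have eq: "(\<integral>\<omega>. exp (- 12 * (Y n \<omega> + a * (1 - (h n)\<^sup>2))\<^sup>2) * (\<Prod>t\<in>J. \<phi> t (B \<omega> (rnd (h n) t) + a * cm_shift (rnd (h n) t))) \<partial>M)
    = (\<integral>\<omega>. exp (- 12 * (Y n \<omega> - a)\<^sup>2 + 12 * a\<^sup>2 * (h n)\<^sup>2) * (\<Prod>t\<in>J. \<phi> t (B \<omega> (rnd (h n) t))) \<partial>M)" for n
    unfolding Y_def h_def by (rule damped_cameron_martin_grid[OF B J c])
  show ?thesis by (rule LIMSEQ_unique[OF 1 2[folded eq]])
qed

text \<open>The two exponentials are the weights of the test-function criterion. On the left the
  tested path is the shifted one, and its own integral is the original one plus a.\<close>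

lemma damped_cameron_martin:
  assumes B: "std_BM M B" and \<Psi>: "\<Psi> \<in> borel_measurable (borel_paths {0..1/2})"
  shows "(\<integral>\<omega>. exp (- 12 * (integral {0..1/2} (B \<omega>) + a)\<^sup>2) * \<Psi> (restrict (\<lambda>t. B \<omega> t + a * cm_shift t) {0..1/2}) \<partial>M)
    = (\<integral>\<omega>. exp (- 12 * (integral {0..1/2} (B \<omega>) - a)\<^sup>2) * \<Psi> (restrict (B \<omega>) {0..1/2}) \<partial>M)"
proof -
  interpret prob_space M by (rule std_BM_prob_space[OF B])
  have [measurable]: "(\<lambda>\<omega>. integral {0..1/2} (B \<omega>)) \<in> borel_measurable M"
    by (rule integral_process_measurable) (auto intro!: std_BM_measurable[OF B] continuous_on_subset[OF std_BM_continuous[OF B]])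
  show ?thesis
  proof (rule integral_eq_of_test_functions[OF _ _ _ _ _ _ _ \<Psi>])
    show "(\<lambda>\<omega>. restrict (\<lambda>t. B \<omega> t + a * cm_shift t) {0..1/2}) \<in> measurable M (borel_paths {0..1/2})"
      by (intro measurable_restrict borel_measurable_add borel_measurable_const std_BM_measurable[OF B]) auto
    show "(\<lambda>\<omega>. restrict (B \<omega>) {0..1/2}) \<in> measurable M (borel_paths {0..1/2})"
      by (rule std_BM_path_measurable[OF B]) auto
    fix J :: "real set" and \<phi> :: "real \<Rightarrow> real \<Rightarrow> real"
    assume J: "finite J" "J \<subseteq> {0..1/2}" "\<And>i. continuous_on UNIV (\<phi> i)" "\<And>i x. 0 \<le> \<phi> i x \<and> \<phi> i x \<le> 1"
    have *: "(\<Prod>i\<in>J. \<phi> i (restrict w {0..1/2} i)) = (\<Prod>i\<in>J. \<phi> i (w i))" for w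
      using J(2) by (intro prod.cong) auto
    show "(\<integral>\<omega>. exp (- 12 * (integral {0..1/2} (B \<omega>) + a)\<^sup>2) * (\<Prod>i\<in>J. \<phi> i (restrict (\<lambda>t. B \<omega> t + a * cm_shift t) {0..1/2} i)) \<partial>M)
      = (\<integral>\<omega>. exp (- 12 * (integral {0..1/2} (B \<omega>) - a)\<^sup>2) * (\<Prod>i\<in>J. \<phi> i (restrict (B \<omega>) {0..1/2} i)) \<partial>M)"
      unfolding * by (rule damped_cameron_martin_test[OF B J])
  qed (auto intro!: integrable_const_bound[where B=1])
qed

text \<open>The formula for B alone is applied for each frozen value of the independent component X,
  here meant to be the meander.\<close>

lemma damped_cameron_martin_pair:
  assumes B: "std_BM M B"
    and ind: "prob_space.indep_var M S X path_pos (\<lambda>\<omega>. restrict (B \<omega>) {0..})"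
    and \<Psi>: "\<Psi> \<in> borel_measurable (S \<Otimes>\<^sub>M borel_paths {0..1/2})" and b: "\<And>z. \<bar>\<Psi> z\<bar> \<le> C"
  shows "(\<integral>\<omega>. exp (- 12 * (integral {0..1/2} (B \<omega>) + a)\<^sup>2) * \<Psi> (X \<omega>, restrict (\<lambda>t. B \<omega> t + a * cm_shift t) {0..1/2}) \<partial>M)
    = (\<integral>\<omega>. exp (- 12 * (integral {0..1/2} (B \<omega>) - a)\<^sup>2) * \<Psi> (X \<omega>, restrict (B \<omega>) {0..1/2}) \<partial>M)"
proof -
  interpret prob_space M by (rule std_BM_prob_space[OF B])
  let ?S = "S \<Otimes>\<^sub>M path_pos"
  have comp: "(\<lambda>z. snd z t) \<in> borel_measurable ?S" if "t \<in> {0..1/2}" for t :: real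
    using that by (intro measurable_compose[OF measurable_snd measurable_component_singleton]) auto
  have pm: "(\<lambda>z. path_int (1/2) (snd z)) \<in> borel_measurable ?S" by (intro path_int_measurable comp) auto
  have Xm: "X \<in> measurable M S" by (rule indep_var_rv1[OF ind])
  \<comment> \<open>The displacement d in the exponent and the path shift b are separate so that one
    Fubini step serves both sides: d = b = a on the left, d = -a and b = 0 on the right.\<close>
  define f where "f d b z = exp (- 12 * (path_int (1/2) (snd z) + d)\<^sup>2) * \<Psi> (fst z, restrict (\<lambda>t. snd z t + b * cm_shift t) {0..1/2})"
    for d b and z :: "(real \<Rightarrow> real) \<times> (real \<Rightarrow> real)"
  have fm: "f d b \<in> borel_measurable ?S" for d b
    unfolding f_def[abs_def]
  proof (rule borel_measurable_times)
    show "(\<lambda>z. exp (- 12 * (path_int (1/2) (snd z) + d)\<^sup>2)) \<in> borel_measurable ?S" using pm by measurable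
    show "(\<lambda>z. \<Psi> (fst z, restrict (\<lambda>t. snd z t + b * cm_shift t) {0..1/2})) \<in> borel_measurable ?S"
      by (intro measurable_compose[OF measurable_Pair \<Psi>] measurable_fst measurable_restrict borel_measurable_add comp borel_measurable_const)
  qed
  have fb: "\<bar>f d b z\<bar> \<le> C" for d b z
  proof -
    have "\<bar>exp (- 12 * (path_int (1/2) (snd z) + d)\<^sup>2)\<bar> * \<bar>\<Psi> (fst z, restrict (\<lambda>t. snd z t + b * cm_shift t) {0..1/2})\<bar> \<le> 1 * C"
      by (intro mult_mono b) auto
    then show ?thesis by (simp add: f_def abs_mult)
  qed
  have feq: "f d b (x, restrict (B \<omega>) {0..}) = exp (- 12 * (integral {0..1/2} (B \<omega>) + d)\<^sup>2) * \<Psi> (x, restrict (\<lambda>t. B \<omega> t + b * cm_shift t) {0..1/2})"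
    if \<omega>: "\<omega> \<in> space M" for d b x \<omega>
  proof -
    have "path_int (1/2) (restrict (B \<omega>) {0..}) = path_int (1/2) (B \<omega>)" by (rule path_int_cong) auto
    moreover have "continuous_on {0..1/2} (B \<omega>)" by (rule continuous_on_subset[OF std_BM_continuous[OF B \<omega>]]) auto
    moreover have "restrict (\<lambda>t. restrict (B \<omega>) {0..} t + b * cm_shift t) {0..1/2} = restrict (\<lambda>t. B \<omega> t + b * cm_shift t) {0..1/2}"
      by (auto simp: fun_eq_iff)
    ultimately show ?thesis by (simp add: f_def path_int_eq)
  qed
  have Fub: "(\<integral>\<omega>. exp (- 12 * (integral {0..1/2} (B \<omega>) + d)\<^sup>2) * \<Psi> (X \<omega>, restrict (\<lambda>t. B \<omega> t + b * cm_shift t) {0..1/2}) \<partial>M)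
    = (\<integral>\<omega>. (\<integral>\<omega>'. exp (- 12 * (integral {0..1/2} (B \<omega>') + d)\<^sup>2) * \<Psi> (X \<omega>, restrict (\<lambda>t. B \<omega>' t + b * cm_shift t) {0..1/2}) \<partial>M) \<partial>M)" (is "?l = ?r") for d b
  proof -
    have "?l = (\<integral>\<omega>. f d b (X \<omega>, restrict (B \<omega>) {0..}) \<partial>M)"
      by (intro Bochner_Integration.integral_cong refl feq[symmetric])
    also have "\<dots> = (\<integral>\<omega>. (\<integral>\<omega>'. f d b (X \<omega>, restrict (B \<omega>') {0..}) \<partial>M) \<partial>M)"
      by (rule indep_var_integral_pair[OF ind fm fb])
    also have "\<dots> = ?r" by (intro Bochner_Integration.integral_cong refl feq)
    finally show ?thesis .
  qed
  have inner: "(\<integral>\<omega>'. exp (- 12 * (integral {0..1/2} (B \<omega>') + a)\<^sup>2) * \<Psi> (X \<omega>, restrict (\<lambda>t. B \<omega>' t + a * cm_shift t) {0..1/2}) \<partial>M)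
    = (\<integral>\<omega>'. exp (- 12 * (integral {0..1/2} (B \<omega>') + (- a))\<^sup>2) * \<Psi> (X \<omega>, restrict (\<lambda>t. B \<omega>' t + 0 * cm_shift t) {0..1/2}) \<partial>M)"
    if "\<omega> \<in> space M" for \<omega>
    using damped_cameron_martin[OF B measurable_compose[OF measurable_Pair1'[OF measurable_space[OF Xm that]] \<Psi>], of a] by simp
  show ?thesis
    using Fub[of a a] Fub[of "- a" 0] inner by (simp cong: Bochner_Integration.integral_cong)
qed

text \<open>The weight is an unnormalised normal density of variance 1/24, hence its mass sqrt(2 pi
  / 24).\<close>

lemma
  fixes S :: real
  shows gauss_integrable: "integrable lborel (\<lambda>x. exp (- 12 * (x - S)\<^sup>2))"
    and gauss_integral: "(\<integral>x. exp (- 12 * (x - S)\<^sup>2) \<partial>lborel) = sqrt (pi / 12)"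
proof -
  have *: "exp (- 12 * (x - S)\<^sup>2) = sqrt (pi / 12) * normal_density S (sqrt (1/24)) x" for x
  proof -
    have "(sqrt (1/24))\<^sup>2 = (1/24 :: real)" by simp
    then have "normal_density S (sqrt (1/24)) x = 1 / sqrt (pi / 12) * exp (- 12 * (x - S)\<^sup>2)"
      unfolding normal_density_def by (simp only:) (simp add: algebra_simps)
    then show ?thesis by simp
  qed
  show "integrable lborel (\<lambda>x. exp (- 12 * (x - S)\<^sup>2))"
    unfolding * by (intro integrable_mult_right integrable_normal_density) simp
  show "(\<integral>x. exp (- 12 * (x - S)\<^sup>2) \<partial>lborel) = sqrt (pi / 12)"
    unfolding * by (simp add: integral_normal_density)
qed

text \<open>Integrating the bound over the real line gives the same constant wherever the random
  centre \<open>S \<omega>\<close> lies, so the inner integrals are uniformly bounded on a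
  probability space.\<close>

lemma gauss_dominated_integrable:
  fixes q :: "'a \<times> real \<Rightarrow> real"
  assumes M: "prob_space M" and q[measurable]: "q \<in> borel_measurable (M \<Otimes>\<^sub>M lborel)"
    and b: "\<And>\<omega> c. \<omega> \<in> space M \<Longrightarrow> \<bar>q (\<omega>, c)\<bar> \<le> C * exp (- 12 * (c - S \<omega>)\<^sup>2)"
  shows "integrable (M \<Otimes>\<^sub>M lborel) q"
proof -
  interpret prob_space M by fact
  interpret pair_sigma_finite M "lborel :: real measure" ..
  have int: "integrable lborel (\<lambda>c. q (\<omega>, c))" if "\<omega> \<in> space M" for \<omega>
  proof (rule Bochner_Integration.integrable_bound[OF integrable_mult_right[OF gauss_integrable[of "S \<omega>"], of C]])
    show "(\<lambda>c. q (\<omega>, c)) \<in> borel_measurable lborel" using that by measurable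
    show "AE c in lborel. norm (q (\<omega>, c)) \<le> norm (C * exp (- 12 * (c - S \<omega>)\<^sup>2))"
      using b[OF that] by (intro AE_I2) (auto intro: order_trans[OF _ abs_ge_self])
  qed
  show ?thesis
  proof (rule Fubini_integrable[OF q])
    have "\<bar>\<integral>c. norm (q (\<omega>, c)) \<partial>lborel\<bar> \<le> C * sqrt (pi / 12)" if \<omega>: "\<omega> \<in> space M" for \<omega>
    proof -
      have "\<bar>\<integral>c. norm (q (\<omega>, c)) \<partial>lborel\<bar> = (\<integral>c. norm (q (\<omega>, c)) \<partial>lborel)" by (simp add: integral_nonneg_AE)
      also have "\<dots> \<le> (\<integral>c. C * exp (- 12 * (c - S \<omega>)\<^sup>2) \<partial>lborel)"
        using b[OF \<omega>] int[OF \<omega>] by (intro integral_mono integrable_norm integrable_mult_right gauss_integrable) auto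
      also have "\<dots> = C * sqrt (pi / 12)" by (simp only: integral_mult_right_zero gauss_integral)
      finally show ?thesis .
    qed
    then show "integrable M (\<lambda>\<omega>. \<integral>c. norm (q (\<omega>, c)) \<partial>lborel)"
      by (intro integrable_const_bound[where B="C * sqrt (pi / 12)"]) auto
    show "AE \<omega> in M. integrable lborel (\<lambda>c. q (\<omega>, c))" using int by (intro AE_I2)
  qed
qed

section \<open>Disintegration along the area\<close>

text \<open>Identifies the polynomial in \<open>U_proc\<close> as the Cameron-Martin shift with its
  clock started at time 1/2.\<close>

lemma cm_shift_half: "1/2 \<le> t \<Longrightarrow> cm_shift (t - 1/2) = 12 * t * (2 - t) - 9"
  by (simp add: cm_shift_def algebra_simps)

text \<open>The normalisation behind the choice of polynomial: adding a times it raises the area by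
  exactly a.\<close>

lemma integral_cm_shift: "((\<lambda>t. cm_shift (t - 1/2)) has_integral 1) {1/2..1}"
proof -
  \<comment> \<open>The antiderivative is 12 t^2 - 4 t^3 - 9 t.\<close>
  have "((\<lambda>t. 12 * t * (2 - t) - 9) has_integral (12 * 1\<^sup>2 - 4 * 1 ^ 3 - 9 * 1) - (12 * (1/2)\<^sup>2 - 4 * (1/2) ^ 3 - 9 * (1/2))) {1/2..1::real}"
    by (rule fundamental_theorem_of_calculus)
       (auto intro!: derivative_eq_intros simp: has_real_derivative_iff_has_vector_derivative[symmetric] power2_eq_square algebra_simps)
  then have "((\<lambda>t. 12 * t * (2 - t) - 9) has_integral 1) {1/2..1::real}" by (simp add: power2_eq_square power3_eq_cube)
  then show ?thesis by (rule has_integral_eq[rotated]) (simp add: cm_shift_half)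
qed

text \<open>The process \<open>u\<close> as a function of the pair \<open>(m, B)\<close> of paths.\<close>

definition glue :: "(real \<Rightarrow> real) \<times> (real \<Rightarrow> real) \<Rightarrow> real \<Rightarrow> real" where
  "glue z t = (if t \<le> 1/2 then fst z (2 * t) / sqrt 2 else fst z 1 / sqrt 2 + snd z (t - 1/2))"

lemma glue_measurable:
  assumes "t \<in> {0..1}"
  shows "(\<lambda>z. glue z t) \<in> borel_measurable (path01 \<Otimes>\<^sub>M borel_paths {0..1/2})"
proof -
  let ?S = "path01 \<Otimes>\<^sub>M borel_paths {0..1/2}"
  have 1: "(\<lambda>z. fst z s) \<in> borel_measurable ?S" if "s \<in> {0..1}" for s
    by (rule measurable_compose[OF measurable_fst measurable_component_singleton[OF that]])
  have 2: "(\<lambda>z. snd z s) \<in> borel_measurable ?S" if "s \<in> {0..1/2}" for s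
    by (rule measurable_compose[OF measurable_snd measurable_component_singleton[OF that]])
  show ?thesis
  proof (cases "t \<le> 1/2")
    case True
    then show ?thesis using 1[of "2 * t"] assms by (simp add: glue_def)
  next
    case False
    then show ?thesis using 1[of 1] 2[of "t - 1/2"] assms by (simp add: glue_def)
  qed
qed

context
  fixes M :: "'a measure" and m B :: "'a \<Rightarrow> real \<Rightarrow> real"
  assumes m: "brownian_meander M m" and B: "std_BM M B"
begin

lemma u_proc_cont: "\<omega> \<in> space M \<Longrightarrow> continuous_on {0..1} (u_proc m B \<omega>)"
  by (intro u_proc_continuous brownian_meander_continuous[OF m] std_BM_continuous[OF B] std_BM_zero[OF B])

lemma shifted_B_cont: "\<omega> \<in> space M \<Longrightarrow> continuous_on {0..1} (u_proc m (\<lambda>\<omega> s. B \<omega> s + a * cm_shift s) \<omega>)"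
  by (intro u_proc_continuous brownian_meander_continuous[OF m])
     (auto intro!: continuous_intros std_BM_continuous[OF B] simp: std_BM_zero[OF B] cm_shift_def)

lemma glue_shift:
  assumes "t \<in> {0..1}"
  shows "glue (restrict (m \<omega>) {0..1}, restrict (\<lambda>s. B \<omega> s + a * cm_shift s) {0..1/2}) t
    = u_proc m (\<lambda>\<omega> s. B \<omega> s + a * cm_shift s) \<omega> t"
  using assms by (auto simp: glue_def u_proc_def)

lemma u_proc_shift:
  "u_proc m (\<lambda>\<omega> s. B \<omega> s + a * cm_shift s) \<omega> t = u_proc m B \<omega> t + (if t \<le> 1/2 then 0 else a * (12 * t * (2 - t) - 9))"
  by (simp add: u_proc_def cm_shift_half)

text \<open>For each sample point, \<open>U_proc\<close> is u built from B with a Cameron-Martin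
  shift. The shift size is random; it is evaluated at the outer \<open>\<omega>\<close> and is a
  constant as far as the inner \<open>\<omega>'\<close> is concerned.\<close>

lemma U_proc_eq_shift:
  "U_proc m B c \<omega> = u_proc m (\<lambda>\<omega>' s. B \<omega>' s + (c - integral {0..1} (u_proc m B \<omega>)) * cm_shift s) \<omega>"
  by (auto simp: U_proc_def u_proc_shift fun_eq_iff)

lemma integral_u_proc_shift:
  assumes \<omega>: "\<omega> \<in> space M"
  shows "integral {0..1} (u_proc m (\<lambda>\<omega> s. B \<omega> s + a * cm_shift s) \<omega>) = integral {0..1} (u_proc m B \<omega>) + a"
proof -
  let ?u = "u_proc m B \<omega>" and ?v = "u_proc m (\<lambda>\<omega> s. B \<omega> s + a * cm_shift s) \<omega>"
  have cu: "continuous_on {0..1} ?u" by (rule u_proc_cont[OF \<omega>])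
  have cv: "continuous_on {0..1} ?v" by (rule shifted_B_cont[OF \<omega>])
  have int: "?u integrable_on {0..1}" "?v integrable_on {0..1}"
    by (intro integrable_continuous_interval cu cv)+
  have intu: "?u integrable_on {1/2..1}"
    by (intro integrable_continuous_interval continuous_on_subset[OF cu]) auto
  have "integral {0..1} ?v = integral {0..1/2} ?v + integral {1/2..1} ?v"
    using int by (intro Henstock_Kurzweil_Integration.integral_combine[symmetric]) auto
  also have "integral {0..1/2} ?v = integral {0..1/2} ?u"
    by (intro Henstock_Kurzweil_Integration.integral_cong) (auto simp: u_proc_shift)
  also have "integral {1/2..1} ?v = integral {1/2..1} (\<lambda>t. ?u t + a * cm_shift (t - 1/2))"
  proof (intro Henstock_Kurzweil_Integration.integral_cong)
    fix t :: real assume "t \<in> {1/2..1}"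
    \<comment> \<open>At t = 1/2 the definition takes the unshifted branch, which agrees with the
      formula because \<open>cm_shift 0\<close> is 0.\<close>
    then consider "t = 1/2" | "1/2 < t" by fastforce
    then show "?v t = ?u t + a * cm_shift (t - 1/2)"
    proof cases
      case 1
      have "cm_shift 0 = 0" by (simp add: cm_shift_def)
      then show ?thesis unfolding 1 by (simp add: u_proc_shift)
    qed (simp add: u_proc_shift cm_shift_half)
  qed
  also have "\<dots> = integral {1/2..1} ?u + a * 1"
    using integral_cm_shift
    by (intro integral_unique has_integral_add has_integral_mult_right integrable_integral intu)
  also have "integral {0..1/2} ?u + (integral {1/2..1} ?u + a * 1) = integral {0..1} ?u + a"
    using int Henstock_Kurzweil_Integration.integral_combine[of 0 "1/2" 1 ?u] by simp
  finally show ?thesis .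
qed

text \<open>Explains the exponent of the theorem: the first term is the area of u if the path were
  frozen after time 1/2, so it differs from the true area by the integral of B.\<close>

lemma integral_u_proc:
  assumes \<omega>: "\<omega> \<in> space M"
  shows "integral {0..1} (u_proc m B \<omega>)
    = integral {0..1/2} (\<lambda>r. u_proc m B \<omega> r + u_proc m B \<omega> (1/2)) + integral {0..1/2} (B \<omega>)"
proof -
  let ?u = "u_proc m B \<omega>"
  have cu: "continuous_on {0..1} ?u" by (rule u_proc_cont[OF \<omega>])
  have cB: "continuous_on {0..1/2} (B \<omega>)" by (rule continuous_on_subset[OF std_BM_continuous[OF B \<omega>]]) auto
  have "integral {0..1} ?u = integral {0..1/2} ?u + integral {1/2..1} ?u"
    by (intro Henstock_Kurzweil_Integration.integral_combine[symmetric] integrable_continuous_interval cu) auto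
  also have "integral {1/2..1} ?u = integral {0..1/2} (\<lambda>s. ?u (1/2 + s))"
    using integral_shift_Icc_real[of 0 "1/2" ?u "1/2"] by (simp add: o_def)
  also have "\<dots> = integral {0..1/2} (\<lambda>s. ?u (1/2) + B \<omega> s)"
    using std_BM_zero[OF B \<omega>] by (intro Henstock_Kurzweil_Integration.integral_cong) (auto simp: u_proc_def)
  also have "\<dots> = integral {0..1/2} (\<lambda>s::real. ?u (1/2)) + integral {0..1/2} (B \<omega>)"
    by (intro Henstock_Kurzweil_Integration.integral_add integrable_continuous_interval cB continuous_intros)
  also have "integral {0..1/2} ?u + (integral {0..1/2} (\<lambda>s::real. ?u (1/2)) + integral {0..1/2} (B \<omega>))
     = integral {0..1/2} (\<lambda>r. ?u r + ?u (1/2)) + integral {0..1/2} (B \<omega>)"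
    by (subst Henstock_Kurzweil_Integration.integral_add)
       (auto intro!: integrable_continuous_interval continuous_on_subset[OF cu])
  finally show ?thesis .
qed

end

theorem theorem1p1:
  fixes M :: "'a measure" and m B :: "'a \<Rightarrow> real \<Rightarrow> real"
    and \<Phi> :: "(real \<Rightarrow> real) \<Rightarrow> real" and f :: "real \<Rightarrow> real"
  assumes meander: "brownian_meander M m"
    and BM: "std_BM M B"
    and indep: "prob_space.indep_var M path01 (\<lambda>\<omega>. restrict (m \<omega>) {0..1})
                                      path_pos (\<lambda>\<omega>. restrict (B \<omega>) {0..})"
    and \<Phi>_meas: "\<Phi> \<in> borel_measurable path01" and \<Phi>_bdd: "bounded (range \<Phi>)"
    and f_meas: "f \<in> borel_measurable borel" and f_bdd: "bounded (range f)"
  shows "(\<integral>\<omega>. \<Phi> (restrict (m \<omega>) {0..1}) * f (integral {0..1} (m \<omega>)) \<partial>M)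
       = (LINT c:{0..}|lborel.
            sqrt (24 / pi)
            * (\<integral>\<omega>. \<Phi> (restrict (U_proc m B c \<omega>) {0..1})
                  * exp (- 12 * (integral {0..1/2} (\<lambda>r. U_proc m B c \<omega> r + U_proc m B c \<omega> (1/2)) - c)\<^sup>2)
                  * indicator {\<omega>\<in>space M. \<forall>t\<in>{0..1}. U_proc m B c \<omega> t \<ge> 0} \<omega> \<partial>M)
            * f c)"
proof -
  interpret prob_space M by (rule std_BM_prob_space[OF BM])
  interpret Mlb: pair_sigma_finite M "lborel :: real measure" ..
  define S where "S = path01 \<Otimes>\<^sub>M borel_paths {0..1/2::real}"
  obtain K where K: "\<bar>\<Phi> w\<bar> \<le> K" for w using \<Phi>_bdd by (auto simp: bounded_iff)
  obtain L where L: "\<bar>f x\<bar> \<le> L" for x using f_bdd by (auto simp: bounded_iff)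
  have K0: "0 \<le> K" using K[of undefined] by linarith
  have L0: "0 \<le> L" using L[of undefined] by linarith
  define I where "I \<omega> = integral {0..1/2} (B \<omega>)" for \<omega>
  define R where "R \<omega> = integral {0..1} (u_proc m B \<omega>)" for \<omega>
  define v where "v a \<omega> = u_proc m (\<lambda>\<omega> s. B \<omega> s + a * cm_shift s) \<omega>" for a \<omega>
  have v0: "v 0 = u_proc m B" by (simp add: v_def fun_eq_iff)
  have mI[measurable]: "I \<in> borel_measurable M" unfolding I_def[abs_def]
    by (rule integral_process_measurable) (auto intro!: std_BM_measurable[OF BM] continuous_on_subset[OF std_BM_continuous[OF BM]])
  have mR[measurable]: "R \<in> borel_measurable M" unfolding R_def[abs_def]
    by (rule integral_process_measurable) (auto intro!: u_proc_measurable[OF meander BM] u_proc_cont[OF meander BM])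
  \<comment> \<open>The functional, the area and the barrier, all in grid form, as one measurable
    function of the pair (m, B), as the Cameron-Martin formula for pairs requires.\<close>
  define \<Psi> where "\<Psi> z = \<Phi> (restrict (glue z) {0..1}) * f (path_int 1 (glue z)) * of_bool (grid_ge 1 0 (glue z))" for z
  have m\<Psi>: "\<Psi> \<in> borel_measurable S"
    unfolding \<Psi>_def[abs_def]
  proof (intro borel_measurable_times)
    show "(\<lambda>z. \<Phi> (restrict (glue z) {0..1})) \<in> borel_measurable S"
      unfolding S_def by (intro measurable_compose[OF measurable_restrict \<Phi>_meas] glue_measurable)
    show "(\<lambda>z. f (path_int 1 (glue z))) \<in> borel_measurable S"
      unfolding S_def by (intro measurable_compose[OF path_int_measurable f_meas] glue_measurable) auto
    have [measurable]: "Measurable.pred S (\<lambda>z. grid_ge 1 0 (glue z))"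
      unfolding S_def by (intro grid_ge_measurable glue_measurable) auto
    show "(\<lambda>z. of_bool (grid_ge 1 0 (glue z)) :: real) \<in> borel_measurable S" by measurable
  qed
  have \<Psi>b: "\<bar>\<Psi> z\<bar> \<le> K * L" for z
  proof -
    have "\<bar>\<Phi> (restrict (glue z) {0..1})\<bar> * \<bar>f (path_int 1 (glue z))\<bar> * \<bar>of_bool (grid_ge 1 0 (glue z)) :: real\<bar> \<le> K * L * 1"
      using K0 L0 by (intro mult_mono K L) auto
    then show ?thesis by (simp add: \<Psi>_def abs_mult)
  qed
  \<comment> \<open>The same functional after B is shifted by a multiple a of
    \<open>cm_shift\<close>; \<open>Q 0\<close> belongs to u itself.\<close>
  define Q where "Q a \<omega> = \<Psi> (restrict (m \<omega>) {0..1}, restrict (\<lambda>s. B \<omega> s + a * cm_shift s) {0..1/2})" for a \<omega>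
  have Q_eq: "Q a \<omega> = \<Phi> (restrict (v a \<omega>) {0..1}) * f (R \<omega> + a) * indicator {\<omega>\<in>space M. \<forall>t\<in>{0..1}. 0 \<le> v a \<omega> t} \<omega>"
    if \<omega>: "\<omega> \<in> space M" for a \<omega>
  proof -
    let ?z = "(restrict (m \<omega>) {0..1}, restrict (\<lambda>s. B \<omega> s + a * cm_shift s) {0..1/2})"
    have g: "glue ?z t = v a \<omega> t" if "t \<in> {0..1}" for t unfolding v_def by (rule glue_shift[OF meander BM that])
    have cv: "continuous_on {0..1} (v a \<omega>)" unfolding v_def by (rule shifted_B_cont[OF meander BM \<omega>])
    have "restrict (glue ?z) {0..1} = restrict (v a \<omega>) {0..1}" using g by (auto simp: fun_eq_iff)
    moreover have "path_int 1 (glue ?z) = path_int 1 (v a \<omega>)" by (rule path_int_cong) (auto intro: g)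
    moreover have "grid_ge 1 0 (glue ?z) = grid_ge 1 0 (v a \<omega>)" by (rule grid_ge_cong) (auto intro: g)
    moreover have "integral {0..1} (v a \<omega>) = R \<omega> + a"
      unfolding v_def R_def by (rule integral_u_proc_shift[OF meander BM \<omega>])
    ultimately show ?thesis using \<omega> cv
      by (simp add: Q_def \<Psi>_def path_int_eq grid_ge_iff indicator_def)
  qed
  have mT: "(\<lambda>z. (restrict (m (fst z)) {0..1}, restrict (\<lambda>s. B (fst z) s + (snd z) * cm_shift s) {0..1/2}))
    \<in> measurable (M \<Otimes>\<^sub>M (borel :: real measure)) S"
    unfolding S_def
  proof (intro measurable_Pair measurable_compose[OF measurable_fst brownian_meander_path_measurable[OF meander]] measurable_restrict)
    fix s :: real assume "s \<in> {0..1/2}"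
    then have [measurable]: "(\<lambda>\<omega>. B \<omega> s) \<in> borel_measurable M" by (intro std_BM_measurable[OF BM]) auto
    show "(\<lambda>z. B (fst z) s + snd z * cm_shift s) \<in> borel_measurable (M \<Otimes>\<^sub>M (borel :: real measure))" by measurable
  qed
  have mQ0: "(\<lambda>z. Q (snd z) (fst z)) \<in> borel_measurable (M \<Otimes>\<^sub>M (borel :: real measure))"
    unfolding Q_def[abs_def] by (rule measurable_compose[OF mT m\<Psi>])
  have mQ: "(\<lambda>z. Q (g z) (fst z)) \<in> borel_measurable (M \<Otimes>\<^sub>M lborel)"
    if [measurable]: "g \<in> borel_measurable (M \<Otimes>\<^sub>M lborel)" for g :: "'a \<times> real \<Rightarrow> real"
  proof -
    have "(\<lambda>z. (fst z, g z)) \<in> measurable (M \<Otimes>\<^sub>M lborel) (M \<Otimes>\<^sub>M borel)" by measurable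
    from measurable_compose[OF this mQ0] show ?thesis by simp
  qed
  have Qb: "\<bar>Q a \<omega>\<bar> \<le> K * L" for a \<omega> unfolding Q_def by (rule \<Psi>b)
  have wb: "\<bar>exp y * Q a \<omega>\<bar> \<le> K * L * exp y" for y a \<omega>
    using mult_right_mono[OF Qb[of a \<omega>], of "exp y"] by (simp add: abs_mult mult.commute)
  \<comment> \<open>The integrand on the shifted side of the damped Cameron-Martin formula.\<close>
  define E where "E a \<omega> = exp (- 12 * (I \<omega> + a)\<^sup>2) * Q a \<omega>" for a \<omega>
  \<comment> \<open>This and the next two facts justify the three exchanges of integrals below; the
    Gaussian factors are centred at R - I, -I and I respectively.\<close>
  have int1: "integrable (M \<Otimes>\<^sub>M lborel) (\<lambda>(\<omega>, c). E (c - R \<omega>) \<omega>)"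
  proof (rule gauss_dominated_integrable[OF prob_space_axioms, where C="K * L" and S="\<lambda>\<omega>. R \<omega> - I \<omega>"])
    have "(\<lambda>z. Q (snd z - R (fst z)) (fst z)) \<in> borel_measurable (M \<Otimes>\<^sub>M lborel)" by (rule mQ) measurable
    then show "(\<lambda>(\<omega>, c). E (c - R \<omega>) \<omega>) \<in> borel_measurable (M \<Otimes>\<^sub>M lborel)"
      unfolding E_def case_prod_beta' by measurable
    show "\<bar>case (\<omega>, c) of (\<omega>, c) \<Rightarrow> E (c - R \<omega>) \<omega>\<bar> \<le> K * L * exp (- 12 * (c - (R \<omega> - I \<omega>))\<^sup>2)" for \<omega> c
      using wb[of "- 12 * (I \<omega> + (c - R \<omega>))\<^sup>2" "c - R \<omega>" \<omega>] by (simp add: E_def algebra_simps)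
  qed
  have int2: "integrable (M \<Otimes>\<^sub>M lborel) (\<lambda>(\<omega>, a). E a \<omega>)"
  proof (rule gauss_dominated_integrable[OF prob_space_axioms, where C="K * L" and S="\<lambda>\<omega>. - I \<omega>"])
    have "(\<lambda>z. Q (snd z) (fst z)) \<in> borel_measurable (M \<Otimes>\<^sub>M lborel)" by (rule mQ) measurable
    then show "(\<lambda>(\<omega>, a). E a \<omega>) \<in> borel_measurable (M \<Otimes>\<^sub>M lborel)"
      unfolding E_def case_prod_beta' by measurable
    show "\<bar>case (\<omega>, a) of (\<omega>, a) \<Rightarrow> E a \<omega>\<bar> \<le> K * L * exp (- 12 * (a - (- I \<omega>))\<^sup>2)" for \<omega> a
      using wb[of "- 12 * (I \<omega> + a)\<^sup>2" a \<omega>] by (simp add: E_def algebra_simps)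
  qed
  have mQ1: "Q a \<in> borel_measurable M" for a
  proof -
    have "(\<lambda>\<omega>. (\<omega>, a)) \<in> measurable M (M \<Otimes>\<^sub>M borel)" by measurable
    from measurable_compose[OF this mQ0] show ?thesis by simp
  qed
  have int3: "integrable (M \<Otimes>\<^sub>M lborel) (\<lambda>(\<omega>, a). exp (- 12 * (I \<omega> - a)\<^sup>2) * Q 0 \<omega>)"
  proof (rule gauss_dominated_integrable[OF prob_space_axioms, where C="K * L" and S="\<lambda>\<omega>. I \<omega>"])
    note [measurable] = mQ1
    show "(\<lambda>(\<omega>, a). exp (- 12 * (I \<omega> - a)\<^sup>2) * Q 0 \<omega>) \<in> borel_measurable (M \<Otimes>\<^sub>M lborel)" by measurable
    show "\<bar>case (\<omega>, a) of (\<omega>, a) \<Rightarrow> exp (- 12 * (I \<omega> - a)\<^sup>2) * Q 0 \<omega>\<bar> \<le> K * L * exp (- 12 * (a - I \<omega>)\<^sup>2)" for \<omega> a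
      using wb[of "- 12 * (I \<omega> - a)\<^sup>2" 0 \<omega>] by (simp add: power2_commute)
  qed
  have cm: "(\<integral>\<omega>. E a \<omega> \<partial>M) = (\<integral>\<omega>. exp (- 12 * (I \<omega> - a)\<^sup>2) * Q 0 \<omega> \<partial>M)" for a
    using damped_cameron_martin_pair[OF BM indep m\<Psi>[unfolded S_def] \<Psi>b, of a]
    unfolding E_def Q_def I_def by simp
  let ?X = "\<lambda>c \<omega>. \<Phi> (restrict (U_proc m B c \<omega>) {0..1})
                  * exp (- 12 * (integral {0..1/2} (\<lambda>r. U_proc m B c \<omega> r + U_proc m B c \<omega> (1/2)) - c)\<^sup>2)
                  * indicator {\<omega>\<in>space M. \<forall>t\<in>{0..1}. U_proc m B c \<omega> t \<ge> 0} \<omega>"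
  \<comment> \<open>For fixed c the integrand of the theorem is E at the random shift c - R, which
    brings the area to c and so replaces the argument of f by c.\<close>
  have slice: "indicator {0..} c *\<^sub>R (sqrt (24 / pi)
            * (\<integral>\<omega>. ?X c \<omega> \<partial>M) * f c)
     = sqrt (24 / pi) * (\<integral>\<omega>. E (c - R \<omega>) \<omega> \<partial>M)" for c
  proof -
    have U: "U_proc m B c \<omega> = v (c - R \<omega>) \<omega>" for \<omega> unfolding v_def R_def by (rule U_proc_eq_shift[OF meander BM])
    \<comment> \<open>U and u agree on [0,1/2], so the integral is R - I; the sign disappears in the
      square.\<close>
    have expo: "integral {0..1/2} (\<lambda>r. U_proc m B c \<omega> r + U_proc m B c \<omega> (1/2)) - c = - (I \<omega> + (c - R \<omega>))"
      if "\<omega> \<in> space M" for \<omega>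
    proof -
      have "integral {0..1/2} (\<lambda>r. U_proc m B c \<omega> r + U_proc m B c \<omega> (1/2))
         = integral {0..1/2} (\<lambda>r. u_proc m B \<omega> r + u_proc m B \<omega> (1/2))"
        by (intro Henstock_Kurzweil_Integration.integral_cong) (auto simp: U_proc_def)
      then show ?thesis using integral_u_proc[OF meander BM that] by (simp add: I_def R_def)
    qed
    have pt: "indicator {0..} c * ?X c \<omega> * f c = E (c - R \<omega>) \<omega>"
      if \<omega>: "\<omega> \<in> space M" for \<omega>
    proof (cases "c \<ge> 0")
      case True
      then show ?thesis using \<omega> unfolding expo[OF \<omega>] power2_minus E_def Q_eq[OF \<omega>]
        unfolding U by (simp add: indicator_def)
    next
      case False
      \<comment> \<open>The shifted path has area c, and a nonnegative path cannot have negative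
        area. Hence integrating over all real c gives the same value as over c \<ge> 0.\<close>
      have "\<not> (\<forall>t\<in>{0..1}. 0 \<le> v (c - R \<omega>) \<omega> t)"
      proof
        assume *: "\<forall>t\<in>{0..1}. 0 \<le> v (c - R \<omega>) \<omega> t"
        have "0 \<le> integral {0..1} (v (c - R \<omega>) \<omega>)"
          using * unfolding v_def
          by (intro integral_nonneg integrable_continuous_interval shifted_B_cont[OF meander BM \<omega>]) auto
        also have "\<dots> = c" unfolding v_def integral_u_proc_shift[OF meander BM \<omega>] by (simp add: R_def)
        finally show False using False by simp
      qed
      then have "Q (c - R \<omega>) \<omega> = 0" unfolding Q_eq[OF \<omega>] by simp
      then show ?thesis using False by (simp add: E_def)
    qed
    have "(\<integral>\<omega>. E (c - R \<omega>) \<omega> \<partial>M) = (\<integral>\<omega>. indicator {0..} c * ?X c \<omega> * f c \<partial>M)"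
      by (intro Bochner_Integration.integral_cong refl pt[symmetric])
    also have "\<dots> = indicator {0..} c * (\<integral>\<omega>. ?X c \<omega> \<partial>M) * f c"
      by (simp only: integral_mult_left_zero integral_mult_right_zero)
    finally show ?thesis by (simp add: mult_ac)
  qed
  \<comment> \<open>The Cameron-Martin formula needs a deterministic shift, but c - R is random. So
    c is integrated first for each sample point, where a = c - R is a mere translation of the line;
    then the order is exchanged, the formula is applied for each a, and after a last exchange only a
    Gaussian integral in a remains.\<close>
  have "(\<integral>c. (\<integral>\<omega>. E (c - R \<omega>) \<omega> \<partial>M) \<partial>lborel) = (\<integral>\<omega>. (\<integral>c. E (c - R \<omega>) \<omega> \<partial>lborel) \<partial>M)"
    by (rule Mlb.Fubini_integral[OF int1])
  also have "\<dots> = (\<integral>\<omega>. (\<integral>a. E a \<omega> \<partial>lborel) \<partial>M)"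
  proof (rule Bochner_Integration.integral_cong[OF refl])
    fix \<omega>
    show "(\<integral>c. E (c - R \<omega>) \<omega> \<partial>lborel) = (\<integral>a. E a \<omega> \<partial>lborel)"
      using lborel_integral_real_affine[of 1 "\<lambda>c. E (c - R \<omega>) \<omega>" "R \<omega>"] by simp
  qed
  also have "\<dots> = (\<integral>a. (\<integral>\<omega>. E a \<omega> \<partial>M) \<partial>lborel)"
    by (rule Mlb.Fubini_integral[OF int2, symmetric])
  also have "\<dots> = (\<integral>a. (\<integral>\<omega>. exp (- 12 * (I \<omega> - a)\<^sup>2) * Q 0 \<omega> \<partial>M) \<partial>lborel)" by (simp only: cm)
  also have "\<dots> = (\<integral>\<omega>. (\<integral>a. exp (- 12 * (I \<omega> - a)\<^sup>2) * Q 0 \<omega> \<partial>lborel) \<partial>M)"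
    by (rule Mlb.Fubini_integral[OF int3])
  also have "\<dots> = (\<integral>\<omega>. sqrt (pi / 12) * Q 0 \<omega> \<partial>M)"
    by (simp only: integral_mult_left_zero power2_commute[of "I _"] gauss_integral)
  also have "\<dots> = sqrt (pi / 12) * (\<integral>\<omega>. Q 0 \<omega> \<partial>M)" by simp
  finally have main: "(\<integral>c. (\<integral>\<omega>. E (c - R \<omega>) \<omega> \<partial>M) \<partial>lborel) = sqrt (pi / 12) * (\<integral>\<omega>. Q 0 \<omega> \<partial>M)" .
  \<comment> \<open>The normalising constant of the theorem times the Gaussian mass is the factor in
    the law of the meander.\<close>
  have const: "sqrt (24 / pi) * sqrt (pi / 12) = sqrt 2"
    by (simp add: real_sqrt_mult[symmetric])
  \<comment> \<open>The left-hand functional in measurable form on path space; the grid integral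
    agrees with the true one on the continuous paths of m and of u.\<close>
  define \<Theta> where "\<Theta> w = \<Phi> w * f (path_int 1 w)" for w
  have m\<Theta>: "\<Theta> \<in> borel_measurable path01" unfolding \<Theta>_def[abs_def]
    by (intro borel_measurable_times \<Phi>_meas measurable_compose[OF path_int_measurable f_meas] measurable_component_singleton) auto
  have \<Theta>_eq: "\<Theta> (restrict w {0..1}) = \<Phi> (restrict w {0..1}) * f (integral {0..1} w)" if "continuous_on {0..1} w" for w
  proof -
    have "path_int 1 (restrict w {0..1}) = path_int 1 w" by (rule path_int_cong) auto
    then show ?thesis by (simp add: \<Theta>_def path_int_eq[OF that])
  qed
  have "(\<integral>\<omega>. \<Phi> (restrict (m \<omega>) {0..1}) * f (integral {0..1} (m \<omega>)) \<partial>M) = (\<integral>\<omega>. \<Theta> (restrict (m \<omega>) {0..1}) \<partial>M)"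
    by (intro Bochner_Integration.integral_cong refl \<Theta>_eq[symmetric] brownian_meander_continuous[OF meander])
  also have "\<dots> = sqrt 2 * (\<integral>\<omega>. indicator {\<omega>\<in>space M. \<forall>t\<in>{0..1}. 0 \<le> u_proc m B \<omega> t} \<omega> * \<Theta> (restrict (u_proc m B \<omega>) {0..1}) \<partial>M)"
    by (rule meander_law[OF meander BM indep m\<Theta>])
  also have "(\<integral>\<omega>. indicator {\<omega>\<in>space M. \<forall>t\<in>{0..1}. 0 \<le> u_proc m B \<omega> t} \<omega> * \<Theta> (restrict (u_proc m B \<omega>) {0..1}) \<partial>M) = (\<integral>\<omega>. Q 0 \<omega> \<partial>M)"
    by (intro Bochner_Integration.integral_cong refl)
       (simp add: Q_eq v0 \<Theta>_eq[OF u_proc_cont[OF meander BM]] R_def)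
  finally have lhs: "(\<integral>\<omega>. \<Phi> (restrict (m \<omega>) {0..1}) * f (integral {0..1} (m \<omega>)) \<partial>M) = sqrt 2 * (\<integral>\<omega>. Q 0 \<omega> \<partial>M)" .
  show ?thesis
    unfolding set_lebesgue_integral_def slice lhs integral_mult_right_zero main
    by (simp only: const[symmetric] mult.assoc)
qed

end
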